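(* Let $0<s<1$, $\theta\in[s,1]$ and $1<p<N$. Then for all $u\in X(\Omega)$, $$\int_{\Omega}\frac{|u|^{p}}{|x|^{p\theta}}\,dx\;\le\;\frac{\theta-s}{(1-s)\,C_H}\int_{\Omega}|\nabla u|^p\,dx+\frac{1-\theta}{(1-s)\,C_{N,p,s}}\int_{\mathbb{R}^N}\int_{\mathbb{R}^N}\frac{|u(x)-u(y)|^p}{|x-y|^{N+sp}}\,dy\,dx .$$
   Context: $N$ is a positive integer (so $N\ge 2$ since $N>p>1$) and $\Omega\subset\mathbb{R}^N$ is an open set. $W_0^{1,p}(\Omega)$ is the closure of $C_c^\infty(\Omega)$ with respect to $\left(\int_\Omega|\nabla u|^p\right)^{1/p}$, and $$X(\Omega)=\{u\in W^{1,p}(\mathbb{R}^N): u|_\Omega\in W_0^{1,p}(\Omega),\ u=0 \text{ a.e. in } \mathbb{R}^N\setminus\Omega\}.$$ The constants are $C_H=\left(\frac{N-p}{p}\right)^p$ (the classical Hardy constant) and the fractional Hardy constant $$C_{N,p,s}=2\int_0^1 r^{ps-1}\left|1-r^{(N-ps)/p}\right|^p\Psi_{N,s,p}(r)\,dr,\qquad \Psi_{N,s,p}(r)=|\mathbb{S}^{N-2}|\int_{-1}^1\frac{(1-t^2)^{(N-3)/2}}{(1-2rt+r^2)^{(N+ps)/2}}\,dt ,$$ where $|\mathbb{S}^{N-2}|$ is the surface measure of the unit sphere of $\mathbb{R}^{N-1}$ (equal to $2$ when $N=2$). *)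

theory Defs
  imports "HOL-Analysis.Analysis"
begin

section \<open>Test functions and weak gradients\<close>

text \<open>Functions of class \<open>C\<^sup>k\<close> on the whole space.\<close>

fun C_k :: "nat \<Rightarrow> ('a::euclidean_space \<Rightarrow> real) \<Rightarrow> bool" where
  "C_k 0 f \<longleftrightarrow> continuous_on UNIV f"
| "C_k (Suc k) f \<longleftrightarrow> (\<forall>x. f differentiable (at x)) \<and>
     (\<forall>b\<in>Basis. C_k k (\<lambda>x. frechet_derivative f (at x) b))"

text \<open>\<open>C\<^sub>c\<^sup>\<infinity>(\<Omega>)\<close>, its elements being extended by zero to the whole space.\<close>

definition test_functions :: "'a::euclidean_space set \<Rightarrow> ('a \<Rightarrow> real) set" where
  "test_functions \<Omega> = {\<phi>. (\<forall>k. C_k k \<phi>) \<and>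
     compact (closure {x. \<phi> x \<noteq> 0}) \<and> closure {x. \<phi> x \<noteq> 0} \<subseteq> \<Omega>}"

definition gradient :: "('a::euclidean_space \<Rightarrow> real) \<Rightarrow> 'a \<Rightarrow> 'a" where
  "gradient f x = (\<Sum>b\<in>Basis. frechet_derivative f (at x) b *\<^sub>R b)"

definition locally_integrable_on ::
    "('a::euclidean_space \<Rightarrow> 'b::euclidean_space) \<Rightarrow> 'a set \<Rightarrow> bool" where
  "locally_integrable_on f \<Omega> \<longleftrightarrow>
     (\<forall>K. compact K \<and> K \<subseteq> \<Omega> \<longrightarrow> set_integrable lebesgue K f)"

definition is_weak_gradient ::
    "'a::euclidean_space set \<Rightarrow> ('a \<Rightarrow> real) \<Rightarrow> ('a \<Rightarrow> 'a) \<Rightarrow> bool" where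
  "is_weak_gradient \<Omega> u g \<longleftrightarrow>
     locally_integrable_on u \<Omega> \<and> locally_integrable_on g \<Omega> \<and>
     (\<forall>\<phi>\<in>test_functions \<Omega>.
        (LINT x:\<Omega>|lebesgue. u x *\<^sub>R gradient \<phi> x) = - (LINT x:\<Omega>|lebesgue. \<phi> x *\<^sub>R g x))"

text \<open>A representative of the weak gradient on the whole space, which is unique up to null sets;
  meaningful only if \<open>u\<close> is weakly differentiable.\<close>

definition weak_gradient :: "('a::euclidean_space \<Rightarrow> real) \<Rightarrow> 'a \<Rightarrow> 'a" where
  "weak_gradient u = (SOME g. is_weak_gradient UNIV u g)"


section \<open>Sobolev spaces\<close>

text \<open>Elements of the spaces below are functions, not classes modulo null sets.  For a space of
  functions on \<open>\<Omega>\<close>, the values outside \<open>\<Omega>\<close> are irrelevant.\<close>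

definition in_Lp ::
    "real \<Rightarrow> 'a::euclidean_space set \<Rightarrow> ('a \<Rightarrow> 'b::euclidean_space) \<Rightarrow> bool" where
  "in_Lp p \<Omega> f \<longleftrightarrow> f \<in> borel_measurable (lebesgue_on \<Omega>) \<and>
     (\<integral>\<^sup>+x\<in>\<Omega>. ennreal (norm (f x) powr p) \<partial>lebesgue) < \<infinity>"

definition W1p :: "real \<Rightarrow> 'a::euclidean_space set \<Rightarrow> ('a \<Rightarrow> real) set" where
  "W1p p \<Omega> = {u. in_Lp p \<Omega> u \<and> (\<exists>g. is_weak_gradient \<Omega> u g \<and> in_Lp p \<Omega> g)}"

text \<open>The closure of \<open>C\<^sub>c\<^sup>\<infinity>(\<Omega>)\<close> for the norm \<open>(\<integral>\<^sub>\<Omega> |\<nabla>u|\<^sup>p)\<^bsup>1/p\<^esup>\<close>, as a space of functions.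
  Outside \<open>C\<^sub>c\<^sup>\<infinity>(\<Omega>)\<close> this expression is only a seminorm, vanishing on locally constant functions,
  so convergence of the gradients alone does not determine the limit function.  The last
  condition identifies it: for \<open>p < N\<close>, a sequence of test functions whose gradients are Cauchy in
  \<open>L\<^sup>p\<close> converges in \<open>L\<^bsup>Np/(N-p)\<^esup>(\<Omega>)\<close> by the Sobolev inequality, in particular
  in \<open>L\<^sup>1\<close> on compact sets.\<close>

definition W0_1p :: "real \<Rightarrow> 'a::euclidean_space set \<Rightarrow> ('a \<Rightarrow> real) set" where
  "W0_1p p \<Omega> = {u. \<exists>g \<phi>. is_weak_gradient \<Omega> u g \<and> in_Lp p \<Omega> g \<and>
     (\<forall>n::nat. \<phi> n \<in> test_functions \<Omega>) \<and>
     (\<lambda>n. \<integral>\<^sup>+x\<in>\<Omega>. ennreal (norm (gradient (\<phi> n) x - g x) powr p) \<partial>lebesgue) \<longlonglongrightarrow> 0 \<and>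
     (\<forall>K. compact K \<and> K \<subseteq> \<Omega> \<longrightarrow>
        (\<lambda>n. \<integral>\<^sup>+x\<in>K. ennreal \<bar>\<phi> n x - u x\<bar> \<partial>lebesgue) \<longlonglongrightarrow> 0)}"

definition X_space :: "real \<Rightarrow> 'a::euclidean_space set \<Rightarrow> ('a \<Rightarrow> real) set" where
  "X_space p \<Omega> = {u \<in> W1p p UNIV. u \<in> W0_1p p \<Omega> \<and> (AE x in lebesgue. x \<notin> \<Omega> \<longrightarrow> u x = 0)}"


section \<open>Hardy constants\<close>

definition hardy_const :: "nat \<Rightarrow> real \<Rightarrow> real" where
  "hardy_const N p = ((real N - p) / p) powr p"

text \<open>The surface measure of the unit sphere of \<open>\<real>\<^sup>k\<close>, \<open>k \<ge> 1\<close>: the cone over the sphere is the unit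
  ball, so its volume is \<open>1/k\<close> times the surface measure.\<close>

definition unit_sphere_area :: "nat \<Rightarrow> real" where
  "unit_sphere_area k = real k * unit_ball_vol (real k)"

lemma unit_sphere_area_1: "unit_sphere_area 1 = 2"
  using unit_ball_vol_1 by (simp add: unit_sphere_area_def)

lemma unit_sphere_area_Gamma:
  assumes "k \<ge> 1"
  shows "unit_sphere_area k = 2 * pi powr (real k / 2) / Gamma (real k / 2)"
proof -
  have "real k / 2 \<notin> \<int>\<^sub>\<le>\<^sub>0"
    using assms by (auto elim!: nonpos_Ints_cases)
  then have "Gamma (real k / 2 + 1) = real k / 2 * Gamma (real k / 2)"
    by (rule Gamma_plus1)
  then have Gamma_eq: "Gamma (real k / 2 + 1) = real k * (Gamma (real k / 2) / 2)"
    by simp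
  have "unit_sphere_area k =
      real k * pi powr (real k / 2) / (real k * (Gamma (real k / 2) / 2))"
    unfolding unit_sphere_area_def unit_ball_vol_def Gamma_eq by (rule times_divide_eq_right)
  also have "\<dots> = pi powr (real k / 2) / (Gamma (real k / 2) / 2)"
    using assms by (subst mult_divide_mult_cancel_left) auto
  finally show ?thesis by simp
qed

definition Psi :: "nat \<Rightarrow> real \<Rightarrow> real \<Rightarrow> real \<Rightarrow> real" where
  "Psi N s p r = unit_sphere_area (N - 1) *
     (LINT t:{-1..1}|lborel. (1 - t\<^sup>2) powr ((real N - 3) / 2) /
        (1 - 2 * r * t + r\<^sup>2) powr ((real N + p * s) / 2))"

definition frac_hardy_const :: "nat \<Rightarrow> real \<Rightarrow> real \<Rightarrow> real" where
  "frac_hardy_const N p s = 2 *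
     (LINT r:{0..1}|lborel. r powr (p * s - 1) *
        \<bar>1 - r powr ((real N - p * s) / p)\<bar> powr p * Psi N s p r)"

end

theory Submission
  imports Defs
begin

text \<open>
  With \<open>\<mu> = (\<theta> - s) / (1 - s)\<close> one has \<open>\<theta> = \<mu> + (1 - \<mu>) s\<close>, and \<open>q \<mapsto> |x|\<^bsup>-q\<^esup>\<close> is log-convex, so
  \<open>|x|\<^bsup>-p\<theta>\<^esup> \<le> \<mu> |x|\<^bsup>-p\<^esup> + (1 - \<mu>) |x|\<^bsup>-ps\<^esup>\<close> (\<open>norm_powr_interpolation\<close>).  Multiplying by \<open>|u|\<^sup>p\<close> and
  integrating leaves the two endpoint cases \<open>\<theta> = 1\<close> and \<open>\<theta> = s\<close>: the classical and the fractional
  Hardy inequality, each with its sharp constant (\<open>X_space_hardy_inequality\<close> and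
  \<open>X_space_fractional_hardy\<close>).  Let \<open>N\<close> be the dimension.

  The fractional inequality (\<open>fractional_hardy\<close>) compares \<open>u\<close> with the ground state
  \<open>|x|\<^bsup>-\<alpha>\<^esup>\<close>, \<open>\<alpha> = (N - ps) / p\<close>, whose quotient between \<open>x\<close> and \<open>y\<close> is \<open>t = (|y| / |x|)\<^bsup>\<alpha>\<^esup>\<close>.
  For \<open>|y| < |x|\<close>, convexity of the \<open>p\<close>-th power gives
  \<open>(1 - t)\<^bsup>p-1\<^esup> |u(y)|\<^sup>p \<le> |u(x) - u(y)|\<^sup>p + (1 - t)\<^bsup>p-1\<^esup> t\<^bsup>1-p\<^esup> |u(x)|\<^sup>p\<close>, with equality for the ground
  state.  Integrated against \<open>|x - y|\<^bsup>-N-ps\<^esup>\<close> over \<open>|y| < \<kappa>|x|\<close>, the left side and the last term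
  become multiples \<open>A\<close> and \<open>B\<close> of \<open>H = \<integral> |u|\<^sup>p / |x|\<^bsup>ps\<^esup>\<close>, by rotation invariance and
  homogeneity of the kernel.  The truncation \<open>\<kappa> < 1\<close> keeps \<open>B\<close> finite, so
  that \<open>B H\<close> may be cancelled; polar coordinates about the axis \<open>x\<close> identify \<open>A - B\<close> with the
  integral over \<open>(0, \<kappa>)\<close> that defines half of the constant, and \<open>\<kappa> \<rightarrow> 1\<close> gives the claim.  The
  cancellation also needs \<open>H < \<infinity>\<close>, which the classical inequality supplies.

  For a test function, the classical inequality (\<open>hardy_inequality_test_function\<close>) follows by
  writing \<open>\<phi>(x)\<close> as the integral of \<open>- \<nabla>\<phi>(rx) \<bullet> x\<close> over \<open>r \<ge> 1\<close>: up to the factor \<open>|x|\<close> this is a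
  superposition of dilates of the gradient, the dilate by \<open>r\<close> has \<open>L\<^sup>p\<close> norm
  \<open>r\<^bsup>-N/p\<^esup> \<parallel>\<nabla>\<phi>\<parallel>\<close>, and \<open>\<integral>\<^sub>1\<^sup>\<infinity> r\<^bsup>-N/p\<^esup> dr = p / (N - p)\<close>.  Fatou's lemma carries it over to the
  closure of the test functions (\<open>hardy_inequality_gradient_limit\<close>).  The gradient obtained there
  as an \<open>L\<^sup>p\<close> limit agrees on \<open>\<Omega>\<close> with the weak gradient chosen on the whole space because weak
  gradients are unique (\<open>weak_gradient_unique\<close>); this is the only place where smooth functions have to be
  constructed.
\<close>

section \<open>Lebesgue measure and polar coordinates about an axis\<close>

lemma nn_integral_lborel_dilation:
  fixes f :: "'a::euclidean_space \<Rightarrow> ennreal"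
  assumes [measurable]: "f \<in> borel_measurable borel" and "c > 0"
  shows "(\<integral>\<^sup>+x. f x \<partial>lborel) = ennreal (c ^ DIM('a)) * (\<integral>\<^sup>+x. f (c *\<^sub>R x) \<partial>lborel)"
proof -
  have "(\<integral>\<^sup>+x. f x \<partial>lborel) =
      (\<integral>\<^sup>+x. f x \<partial>(density (distr lborel borel (\<lambda>x. 0 + c *\<^sub>R x)) (\<lambda>_. \<bar>c\<bar>^DIM('a))))"
    using lborel_affine[of c "0::'a"] \<open>c > 0\<close> by simp
  then show ?thesis
    using \<open>c > 0\<close> by (simp add: nn_integral_density nn_integral_distr nn_integral_cmult)
qed

lemma nn_integral_lborel_translation:
  fixes f :: "'a::euclidean_space \<Rightarrow> ennreal"
  assumes [measurable]: "f \<in> borel_measurable borel"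
  shows "(\<integral>\<^sup>+x. f (a + x) \<partial>lborel) = (\<integral>\<^sup>+x. f x \<partial>lborel)"
  by (subst (2) lborel_distr_plus[of a, symmetric]) (simp add: nn_integral_distr)

text \<open>The uniqueness of translation invariant measures, in the form of a computation with Fubini's
  theorem: the image of Lebesgue measure is translation invariant, hence proportional to it, and
  the unit ball, which \<open>R\<close> preserves, fixes the factor.\<close>
lemma nn_integral_lborel_isometric_involution:
  fixes R :: "'a::euclidean_space \<Rightarrow> 'a" and h :: "'a \<Rightarrow> ennreal"
  assumes "linear R" and inv: "\<And>x. R (R x) = x" and iso: "\<And>x. norm (R x) = norm x"
    and [measurable]: "h \<in> borel_measurable borel"
  shows "(\<integral>\<^sup>+x. h (R x) \<partial>lborel) = (\<integral>\<^sup>+x. h x \<partial>lborel)"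
proof -
  interpret linear R by fact
  have [measurable]: "R \<in> borel_measurable borel"
    using \<open>linear R\<close> by (intro borel_measurable_continuous_onI linear_continuous_on linear_conv_bounded_linear[THEN iffD1])
  define g where "g = (indicator (ball 0 1) :: 'a \<Rightarrow> ennreal)"
  have [measurable]: "g \<in> borel_measurable borel" unfolding g_def by (intro borel_measurable_indicator) simp
  define m where "m = (\<integral>\<^sup>+x. g x \<partial>lborel)"
  have m: "m = emeasure lborel (ball (0::'a) 1)" by (simp add: m_def g_def)
  have m0: "m \<noteq> 0" and minf: "m \<noteq> \<infinity>"
    using unit_ball_vol_pos[of "real DIM('a)"] unfolding m
    by (auto simp: emeasure_ball simp del: unit_ball_vol_pos)
  \<comment> \<open>The same double integral is evaluated in both orders; \<open>m\<close> is positive and finite and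
    cancels.\<close>
  have "m * (\<integral>\<^sup>+y. h (R y) \<partial>lborel) = (\<integral>\<^sup>+x. g x * (\<integral>\<^sup>+y. h (R y) \<partial>lborel) \<partial>lborel)"
    by (simp add: m_def nn_integral_multc)
  also have "\<dots> = (\<integral>\<^sup>+x. g x * (\<integral>\<^sup>+y. h (R (R x + y)) \<partial>lborel) \<partial>lborel)"
    by (subst nn_integral_lborel_translation) auto
  also have "\<dots> = (\<integral>\<^sup>+x. (\<integral>\<^sup>+y. g x * h (R y + x) \<partial>lborel) \<partial>lborel)"
    by (simp add: add inv nn_integral_cmult add.commute)
  also have "\<dots> = (\<integral>\<^sup>+y. (\<integral>\<^sup>+x. g x * h (R y + x) \<partial>lborel) \<partial>lborel)"
    by (rule lborel_pair.Fubini') measurable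
  also have "\<dots> = (\<integral>\<^sup>+y. (\<integral>\<^sup>+x. g ((R y + x) - R y) * h (R y + x) \<partial>lborel) \<partial>lborel)"
    by simp
  also have "\<dots> = (\<integral>\<^sup>+y. (\<integral>\<^sup>+x. g (x - R y) * h x \<partial>lborel) \<partial>lborel)"
    by (subst nn_integral_lborel_translation) auto
  also have "\<dots> = (\<integral>\<^sup>+x. (\<integral>\<^sup>+y. g (x - R y) * h x \<partial>lborel) \<partial>lborel)"
    by (rule lborel_pair.Fubini'[symmetric]) measurable
  also have "\<dots> = (\<integral>\<^sup>+x. (\<integral>\<^sup>+y. g (y - R x) \<partial>lborel) * h x \<partial>lborel)"
  proof -
    have "norm (x - R y) = norm (y - R x)" for x y
      using iso[of "x - R y"] by (simp add: diff inv norm_minus_commute)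
    then have "g (x - R y) = g (y - R x)" for x y
      by (auto simp: g_def indicator_def)
    then show ?thesis by (simp add: nn_integral_multc)
  qed
  also have "\<dots> = (\<integral>\<^sup>+x. m * h x \<partial>lborel)"
    unfolding m_def
    using nn_integral_lborel_translation[of g "- R _"] by simp
  also have "\<dots> = m * (\<integral>\<^sup>+x. h x \<partial>lborel)"
    by (simp add: nn_integral_cmult)
  finally show ?thesis
    using m0 minf by (simp add: ennreal_mult_cancel_left)
qed

text \<open>All axes are equivalent: the reflection in the hyperplane orthogonal to \<open>e - b\<close> exchanges \<open>e\<close>
  and \<open>b\<close>.\<close>
lemma nn_integral_axial_unit_vector:
  fixes h :: "real \<Rightarrow> real \<Rightarrow> ennreal" and e b :: "'a::euclidean_space"
  assumes [measurable]: "(\<lambda>x. h (fst x) (snd x)) \<in> borel_measurable (borel \<Otimes>\<^sub>M borel)"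
    and e: "norm e = 1" and b: "norm b = 1"
  shows "(\<integral>\<^sup>+y. h (y \<bullet> e) (norm y) \<partial>lborel) = (\<integral>\<^sup>+y. h (y \<bullet> b) (norm y) \<partial>lborel)"
proof (cases "e = b")
  case False
  define v where "v = e - b"
  define R where "R y = y - (2 * (y \<bullet> v) / (v \<bullet> v)) *\<^sub>R v" for y
  have vv: "v \<bullet> v \<noteq> 0" using False by (simp add: v_def)
  have ee: "e \<bullet> e = 1" "b \<bullet> b = 1" using e b by (simp_all add: dot_square_norm)
  have "linear R"
    by (rule linearI) (auto simp: R_def inner_add_left algebra_simps add_divide_distrib)
  moreover have "R (R x) = x" for x
    using vv by (simp add: R_def inner_diff_left)
  moreover have iso: "norm (R x) = norm x" for x
  proof -
    have "(R x) \<bullet> (R x) = x \<bullet> x"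
      using vv by (simp add: R_def inner_diff_left inner_diff_right inner_commute field_simps)
    then show ?thesis by (simp add: norm_eq_sqrt_inner)
  qed
  moreover have Rb: "R y \<bullet> b = y \<bullet> e" for y
  proof -
    have "v \<bullet> v = - 2 * (v \<bullet> b)"
      by (simp add: v_def inner_diff_left inner_diff_right ee inner_commute[of b e])
    then have "2 * (y \<bullet> v) / (v \<bullet> v) * (v \<bullet> b) = - (y \<bullet> v)"
      using vv by (simp add: field_simps)
    then have "R y \<bullet> b = y \<bullet> b + y \<bullet> v"
      by (simp add: R_def inner_diff_left)
    then show ?thesis by (simp add: v_def inner_diff_right)
  qed
  ultimately have "(\<integral>\<^sup>+y. h (R y \<bullet> b) (norm (R y)) \<partial>lborel) = (\<integral>\<^sup>+y. h (y \<bullet> b) (norm y) \<partial>lborel)"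
    by (intro nn_integral_lborel_isometric_involution[where h = "\<lambda>y. h (y \<bullet> b) (norm y)"])
      (auto intro!: measurable_compose[OF _ assms(1), of "\<lambda>y. (y \<bullet> b, norm y)", simplified])
  then show ?thesis by (simp add: Rb iso)
qed simp

text \<open>Both sides integrate \<open>g\<close> against a measure on the line, and these two measures agree on all
  half-lines because the volume of a ball is known.  The index set is arbitrary, since the formula
  is needed for the orthogonal complement of a basis vector as well as for the whole space.\<close>
lemma nn_integral_radial_PiM:
  fixes g :: "real \<Rightarrow> ennreal"
  assumes A: "finite A" "A \<noteq> {}" and [measurable]: "g \<in> borel_measurable borel"
  shows "(\<integral>\<^sup>+z. g (sqrt (\<Sum>i\<in>A. (z i)\<^sup>2)) \<partial>(\<Pi>\<^sub>M i\<in>A. lborel)) =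
    (\<integral>\<^sup>+r. ennreal (unit_sphere_area (card A) * r ^ (card A - 1)) * indicator {0..} r * g r \<partial>lborel)"
proof -
  let ?n = "card A" and ?P = "\<Pi>\<^sub>M i\<in>A. (lborel :: real measure)"
  let ?f = "\<lambda>r. ennreal (unit_sphere_area ?n * r ^ (?n - 1)) * indicator {0..} (r::real)"
  let ?w = "unit_ball_vol (real ?n)"
  define N where "N z = sqrt (\<Sum>i\<in>A. (z i)\<^sup>2)" for z :: "'a \<Rightarrow> real"
  have [measurable]: "N \<in> ?P \<rightarrow>\<^sub>M borel" unfolding N_def by measurable
  have n: "?n > 0" using A by (simp add: card_gt_0_iff)
  have pos: "emeasure ?P ({z. N z \<le> r} \<inter> space ?P) = ennreal (?w * r ^ ?n)" if "r > 0" for r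
    using emeasure_cball_aux[OF A(1) that] by (simp add: N_def)
  \<comment> \<open>The volume formula covers positive radii only; \<open>r = 0\<close> is reached as a limit.\<close>
  have zero: "emeasure ?P ({z. N z \<le> r} \<inter> space ?P) = 0" if "r \<le> 0" for r
  proof -
    have "emeasure ?P ({z. N z \<le> r} \<inter> space ?P) \<le> ennreal (?w * x ^ ?n)" if "x > 0" for x
      unfolding pos[OF that, symmetric] using that \<open>r \<le> 0\<close> by (intro emeasure_mono) auto
    moreover have "((\<lambda>x. ennreal (?w * x ^ ?n)) \<longlongrightarrow> ennreal (?w * 0 ^ ?n)) (at_right 0)"
      by (intro tendsto_intros)
    ultimately have "emeasure ?P ({z. N z \<le> r} \<inter> space ?P) \<le> ennreal (?w * 0 ^ ?n)"
      by (intro tendsto_lowerbound[of _ _ "at_right (0::real)"])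
        (auto intro: eventually_mono[OF eventually_at_right_less])
    then show ?thesis using zero_power[OF n, where 'a = real] by simp
  qed
  have "distr ?P borel N = density lborel ?f"
  proof (rule measure_eqI_generator_eq[where E = "range atMost" and \<Omega> = UNIV and A = "\<lambda>n. {..real n}"])
    show "Int_stable (range atMost :: real set set)"
      by (auto simp: Int_stable_def)
    show "sets (distr ?P borel N) = sigma_sets UNIV (range atMost)"
      by (simp add: borel_eq_atMost)
    show "sets (density lborel ?f) = sigma_sets UNIV (range atMost)"
      by (simp add: borel_eq_atMost)
    show "(\<Union>n. {..real n}) = UNIV" using real_arch_simple by auto
    have lhs: "emeasure (distr ?P borel N) {..r} = (if r > 0 then ennreal (?w * r ^ ?n) else 0)" for r
      using pos[of r] zero[of r] by (simp add: emeasure_distr vimage_def)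
    then show "emeasure (distr ?P borel N) {..real n} \<noteq> \<infinity>" for n by simp
    fix X :: "real set" assume "X \<in> range atMost"
    then obtain r where X: "X = {..r}" by auto
    have "emeasure (density lborel ?f) {..r} =
        (\<integral>\<^sup>+x. ennreal (unit_sphere_area ?n * x ^ (?n - 1)) * indicator {0..r} x \<partial>lborel)"
      by (subst emeasure_density) (auto intro!: nn_integral_cong simp: indicator_def)
    also have "\<dots> = (if r > 0 then ennreal (?w * r ^ ?n) else 0)"
    proof (cases "r > 0")
      case True
      have "((\<lambda>x. ?w * x ^ ?n) has_real_derivative unit_sphere_area ?n * x ^ (?n - 1)) (at x)" for x
        by (auto intro!: derivative_eq_intros simp: unit_sphere_area_def)
      then have "(\<integral>\<^sup>+x. ennreal (unit_sphere_area ?n * x ^ (?n - 1)) * indicator {0..r} x \<partial>lborel)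
          = ?w * r ^ ?n - ?w * 0 ^ ?n"
        using True by (intro nn_integral_FTC_Icc) (auto simp: unit_sphere_area_def)
      then show ?thesis using True n by simp
    next
      case False
      then have "AE x in lborel. x \<notin> {0..r}"
        by (intro AE_not_in countable_imp_null_set_lborel) (cases "r = 0", auto)
      then have "(\<integral>\<^sup>+x. ennreal (unit_sphere_area ?n * x ^ (?n - 1)) * indicator {0..r} x \<partial>lborel)
          = (\<integral>\<^sup>+(x::real). 0 \<partial>lborel)"
        by (intro nn_integral_cong_AE) (erule eventually_mono, simp)
      then show ?thesis using False by simp
    qed
    finally show "emeasure (distr ?P borel N) X = emeasure (density lborel ?f) X"
      by (simp add: X lhs)
  qed auto
  then have "(\<integral>\<^sup>+r. g r \<partial>distr ?P borel N) = (\<integral>\<^sup>+r. g r \<partial>density lborel ?f)" by simp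
  then show ?thesis
    by (simp add: nn_integral_distr nn_integral_density N_def)
qed

lemma nn_integral_radial:
  fixes g :: "real \<Rightarrow> ennreal"
  assumes [measurable]: "g \<in> borel_measurable borel"
  shows "(\<integral>\<^sup>+x. g (norm (x::'a::euclidean_space)) \<partial>lborel) =
    (\<integral>\<^sup>+r. ennreal (unit_sphere_area DIM('a) * r ^ (DIM('a) - 1)) * indicator {0..} r * g r \<partial>lborel)"
proof -
  have n: "norm (\<Sum>b\<in>Basis. f b *\<^sub>R b :: 'a) = sqrt (\<Sum>i\<in>Basis. (f i)\<^sup>2)" for f
    using euclidean_dist_l2[of "0::'a" "\<Sum>b\<in>Basis. f b *\<^sub>R b"] by (simp add: L2_set_def)
  show ?thesis
    by (subst lborel_eq, subst nn_integral_distr)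
      (simp_all add: n nn_integral_radial_PiM)
qed

text \<open>Substitution on a set exhausted by compact intervals, so that \<open>g'\<close> may blow up at the ends.\<close>
lemma nn_integral_substitution_exhaustion:
  fixes f :: "real \<Rightarrow> ennreal" and c d :: "nat \<Rightarrow> real"
  assumes [measurable]: "f \<in> borel_measurable borel"
    and deriv: "\<And>x. x \<in> S \<Longrightarrow> (g has_real_derivative g' x) (at x)"
    and cont: "continuous_on S g'"
    and nonneg: "\<And>x. x \<in> S \<Longrightarrow> g' x \<ge> 0"
    and cd: "decseq c" "incseq d" "\<And>n. c n < d n"
    and S: "S = (\<Union>n. {c n..d n})" and T: "T = (\<Union>n. {g (c n)..g (d n)})"
  shows "(\<integral>\<^sup>+x. f x * indicator T x \<partial>lborel) = (\<integral>\<^sup>+x. f (g x) * g' x * indicator S x \<partial>lborel)"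
proof -
  have sub: "{c n..d n} \<subseteq> S" for n using S by auto
  have mono: "{c m..d m} \<subseteq> {c n..d n}" if "m \<le> n" for m n
    using decseqD[OF cd(1) that] incseqD[OF cd(2) that] by auto
  have gmono: "g x \<le> g y" if "x \<le> y" "{x..y} \<subseteq> S" for x y
  proof (rule DERIV_nonneg_imp_nondecreasing[OF that(1)])
    fix z assume "x \<le> z" "z \<le> y"
    then have "z \<in> S" using that(2) by auto
    then show "\<exists>y. (g has_real_derivative y) (at z) \<and> 0 \<le> y"
      by (intro exI[of _ "g' z"] conjI deriv nonneg)
  qed
  have mono': "{g (c m)..g (d m)} \<subseteq> {g (c n)..g (d n)}" if "m \<le> n" for m n
  proof -
    have "c n \<le> c m" "d m \<le> d n" using decseqD[OF cd(1) that] incseqD[OF cd(2) that] by auto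
    moreover have "{c n..c m} \<subseteq> S" "{d m..d n} \<subseteq> S"
      using sub[of n] cd(3)[of m] calculation by (auto simp: subset_eq)
    ultimately have "g (c n) \<le> g (c m)" "g (d m) \<le> g (d n)" using gmono by auto
    then show ?thesis by auto
  qed
  have SUP_ind: "(SUP n. indicator (X n) x) = (indicator (\<Union>n. X n) x :: ennreal)" for X :: "nat \<Rightarrow> real set" and x
    by (rule antisym) (auto simp: indicator_def intro!: SUP_least SUP_upper2)
  have eq: "(\<integral>\<^sup>+x. F x * indicator (\<Union>n. X n) x \<partial>lborel) = (SUP n. \<integral>\<^sup>+x. F x * indicator (X n) x \<partial>lborel)"
    if X: "\<And>m n. m \<le> n \<Longrightarrow> X m \<subseteq> X n" and m: "\<And>n. (\<lambda>x. F x * indicator (X n) x) \<in> borel_measurable borel"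
    for F :: "real \<Rightarrow> ennreal" and X :: "nat \<Rightarrow> real set"
  proof -
    have "(\<integral>\<^sup>+x. F x * indicator (\<Union>n. X n) x \<partial>lborel) = (\<integral>\<^sup>+x. (SUP n. F x * indicator (X n) x) \<partial>lborel)"
      by (simp add: SUP_ind SUP_mult_left_ennreal[symmetric])
    also have "\<dots> = (SUP n. \<integral>\<^sup>+x. F x * indicator (X n) x \<partial>lborel)"
      using X m by (intro nn_integral_monotone_convergence_SUP)
        (auto simp: incseq_def le_fun_def subset_eq split: split_indicator)
    finally show ?thesis .
  qed
  have contg: "continuous_on S g"
    using deriv by (intro continuous_at_imp_continuous_on ballI DERIV_isCont) auto
  have m: "(\<lambda>x. f (g x) * g' x * indicator {c n..d n} x) \<in> borel_measurable borel" for n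
  proof -
    define h where "h x = indicator {c n..d n} x * g x" for x
    define h' where "h' x = indicator {c n..d n} x * g' x" for x
    have [measurable]: "h \<in> borel_measurable borel" "h' \<in> borel_measurable borel"
      using borel_measurable_continuous_on_indicator[OF _ continuous_on_subset[OF contg sub[of n]]]
        borel_measurable_continuous_on_indicator[OF _ continuous_on_subset[OF cont sub[of n]]]
      by (auto simp: h_def[abs_def] h'_def[abs_def])
    have "(\<lambda>x. f (g x) * g' x * indicator {c n..d n} x) = (\<lambda>x. f (h x) * h' x * indicator {c n..d n} x)"
      by (auto simp: h_def h'_def indicator_def)
    then show ?thesis by simp
  qed
  have "(\<integral>\<^sup>+x. f x * indicator T x \<partial>lborel) = (SUP n. \<integral>\<^sup>+x. f x * indicator {g (c n)..g (d n)} x \<partial>lborel)"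
    unfolding T using mono' by (intro eq) auto
  also have "\<dots> = (SUP n. \<integral>\<^sup>+x. f (g x) * g' x * indicator {c n..d n} x \<partial>lborel)"
    using sub cd by (intro SUP_cong refl nn_integral_substitution_aux)
      (auto intro!: deriv nonneg continuous_on_subset[OF cont] simp: subset_eq)
  also have "\<dots> = (\<integral>\<^sup>+x. f (g x) * g' x * indicator S x \<partial>lborel)"
    unfolding S using mono m by (intro eq[symmetric]) auto
  finally show ?thesis .
qed

text \<open>Fubini's theorem for the splitting of the space into the line spanned by \<open>b\<close> and its
  orthogonal complement, where only the length \<open>r\<close> of the orthogonal component matters.\<close>
lemma nn_integral_axial_basis:
  fixes h :: "real \<Rightarrow> real \<Rightarrow> ennreal" and b :: "'a::euclidean_space"
  assumes h[measurable]: "(\<lambda>x. h (fst x) (snd x)) \<in> borel_measurable (borel \<Otimes>\<^sub>M borel)"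
    and b: "b \<in> Basis" and N: "2 \<le> DIM('a)"
  shows "(\<integral>\<^sup>+y. h (y \<bullet> b) (norm y) \<partial>lborel) =
    (\<integral>\<^sup>+a. (\<integral>\<^sup>+r. ennreal (unit_sphere_area (DIM('a) - 1) * r ^ (DIM('a) - 2)) * indicator {0..} r *
        h a (sqrt (a\<^sup>2 + r\<^sup>2)) \<partial>lborel) \<partial>lborel)"
proof -
  interpret product_sigma_finite "\<lambda>_::'a. lborel :: real measure" by standard
  let ?B = "Basis - {b}"
  have B: "finite ?B" "b \<notin> ?B" "insert b ?B = Basis" using b by auto
  have card: "card ?B = DIM('a) - 1" using b by simp
  have n: "norm (\<Sum>b\<in>Basis. f b *\<^sub>R b :: 'a) = sqrt (\<Sum>i\<in>Basis. (f i)\<^sup>2)" for f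
    using euclidean_dist_l2[of "0::'a" "\<Sum>b\<in>Basis. f b *\<^sub>R b"] by (simp add: L2_set_def)
  define H where "H f = h (f b) (sqrt (\<Sum>i\<in>Basis. (f i)\<^sup>2))" for f :: "'a \<Rightarrow> real"
  have [measurable]: "H \<in> borel_measurable (\<Pi>\<^sub>M i\<in>Basis. lborel)"
    unfolding H_def
    by (rule measurable_compose[OF _ h, of "\<lambda>f. (f b, sqrt (\<Sum>i\<in>Basis. (f i)\<^sup>2))", simplified])
      (use b in measurable)
  have [measurable]: "(\<lambda>y::'a. h (y \<bullet> b) (norm y)) \<in> borel_measurable borel"
    by (rule measurable_compose[OF _ h, of "\<lambda>y. (y \<bullet> b, norm y)", simplified]) measurable
  have "(\<integral>\<^sup>+y. h (y \<bullet> b) (norm y) \<partial>lborel) = (\<integral>\<^sup>+f. H f \<partial>(\<Pi>\<^sub>M i\<in>insert b ?B. lborel))"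
    using b unfolding B(3)
    by (subst lborel_eq, subst nn_integral_distr) (simp_all add: n H_def[abs_def])
  also have "\<dots> = (\<integral>\<^sup>+a. (\<integral>\<^sup>+z. H (z(b := a)) \<partial>(\<Pi>\<^sub>M i\<in>?B. lborel)) \<partial>lborel)"
    by (rule product_nn_integral_insert_rev[OF B(1,2)]) (simp only: B(3), measurable)
  also have "\<dots> = (\<integral>\<^sup>+a. (\<integral>\<^sup>+z. h a (sqrt (a\<^sup>2 + (sqrt (\<Sum>i\<in>?B. (z i)\<^sup>2))\<^sup>2)) \<partial>(\<Pi>\<^sub>M i\<in>?B. lborel)) \<partial>lborel)"
  proof -
    have "(\<Sum>i\<in>Basis. ((z(b := a)) i)\<^sup>2) = a\<^sup>2 + (\<Sum>i\<in>?B. (z i)\<^sup>2)" for z :: "'a \<Rightarrow> real" and a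
      by (subst B(3)[symmetric], subst sum.insert) (auto intro!: sum.cong)
    then show ?thesis by (simp add: H_def sum_nonneg)
  qed
  also have "\<dots> = (\<integral>\<^sup>+a. (\<integral>\<^sup>+r. ennreal (unit_sphere_area (DIM('a) - 1) * r ^ (DIM('a) - 2)) * indicator {0..} r *
        h a (sqrt (a\<^sup>2 + r\<^sup>2)) \<partial>lborel) \<partial>lborel)"
  proof (rule nn_integral_cong)
    fix a :: real
    have ne: "?B \<noteq> {}" using N card by (metis card.empty diff_is_0_eq' not_less_eq_eq numeral_2_eq_2 Suc_le_eq diff_diff_cancel One_nat_def zero_less_diff less_irrefl)
    have hm: "(\<lambda>r. h a (sqrt (a\<^sup>2 + r\<^sup>2))) \<in> borel_measurable borel"
      by (rule measurable_compose[OF _ h, of "\<lambda>r. (a, sqrt (a\<^sup>2 + r\<^sup>2))", simplified]) measurable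
    show "(\<integral>\<^sup>+z. h a (sqrt (a\<^sup>2 + (sqrt (\<Sum>i\<in>?B. (z i)\<^sup>2))\<^sup>2)) \<partial>(\<Pi>\<^sub>M i\<in>?B. lborel)) =
      (\<integral>\<^sup>+r. ennreal (unit_sphere_area (DIM('a) - 1) * r ^ (DIM('a) - 2)) * indicator {0..} r *
        h a (sqrt (a\<^sup>2 + r\<^sup>2)) \<partial>lborel)"
      using nn_integral_radial_PiM[OF B(1) ne hm]
      unfolding card diff_diff_eq one_add_one .
  qed
  finally show ?thesis .
qed

lemma nn_integral_sqrt_substitution:
  fixes f :: "real \<Rightarrow> ennreal"
  assumes f[measurable]: "f \<in> borel_measurable borel"
  shows "(\<integral>\<^sup>+r. f r * indicator {0<..} r \<partial>lborel) =
    (\<integral>\<^sup>+x. f (sqrt (x\<^sup>2 - a\<^sup>2)) * ennreal (x / sqrt (x\<^sup>2 - a\<^sup>2)) * indicator {\<bar>a\<bar><..} x \<partial>lborel)"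
proof (rule nn_integral_substitution_exhaustion[OF f])
  define c where "c n = sqrt (a\<^sup>2 + (inverse (real (Suc n)))\<^sup>2)" for n
  define d where "d n = sqrt (a\<^sup>2 + (real (Suc (Suc n)))\<^sup>2)" for n
  have sq: "\<bar>a\<bar> < x \<Longrightarrow> a\<^sup>2 < x\<^sup>2" for x :: real by (simp add: power2_strict_mono)
  show "((\<lambda>x. sqrt (x\<^sup>2 - a\<^sup>2)) has_real_derivative x / sqrt (x\<^sup>2 - a\<^sup>2)) (at x)"
    if "x \<in> {\<bar>a\<bar><..}" for x
    using sq[of x] that by (auto intro!: derivative_eq_intros simp: field_simps)
  show "continuous_on {\<bar>a\<bar><..} (\<lambda>x. x / sqrt (x\<^sup>2 - a\<^sup>2))"
    using sq by (intro continuous_intros) fastforce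
  show "0 \<le> x / sqrt (x\<^sup>2 - a\<^sup>2)" if "x \<in> {\<bar>a\<bar><..}" for x
    using sq[of x] that by auto
  show "decseq c"
    unfolding c_def decseq_def by (auto intro!: power_mono le_imp_inverse_le)
  show "incseq d"
    unfolding d_def incseq_def by (auto intro!: power_mono)
  have inv1: "inverse (real (Suc n)) \<le> 1" for n by (simp add: inverse_le_1_iff)
  have "inverse (real (Suc n)) < real (Suc (Suc n))" for n
    using inv1[of n] by linarith
  then show "c n < d n" for n
    unfolding c_def d_def by (auto intro!: power_strict_mono simp del: of_nat_Suc)
  have c0: "\<bar>a\<bar> < c n" for n
    unfolding c_def by (rule real_less_rsqrt) (simp add: power2_eq_square)
  have gc: "sqrt ((c n)\<^sup>2 - a\<^sup>2) = inverse (real (Suc n))" for n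
    by (simp add: c_def del: of_nat_Suc)
  have gd: "sqrt ((d n)\<^sup>2 - a\<^sup>2) = real (Suc (Suc n))" for n
    by (simp add: d_def del: of_nat_Suc)
  have ex: "\<exists>n. inverse (real (Suc n)) \<le> r \<and> r \<le> real (Suc (Suc n))" if r: "0 < r" for r :: real
  proof -
    obtain m where m: "inverse (real (Suc m)) < r" using reals_Archimedean[OF r] by auto
    obtain k where k: "r \<le> real k" using real_arch_simple by blast
    have "inverse (real (Suc (max m k))) \<le> inverse (real (Suc m))"
      by (intro le_imp_inverse_le) auto
    then show ?thesis using m k by (intro exI[of _ "max m k"] conjI) linarith+
  qed
  show "{0<..} = (\<Union>n. {sqrt ((c n)\<^sup>2 - a\<^sup>2)..sqrt ((d n)\<^sup>2 - a\<^sup>2)})"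
    unfolding gc gd using ex by (auto intro: less_le_trans[rotated])
  show "{\<bar>a\<bar><..} = (\<Union>n. {c n..d n})"
  proof (intro set_eqI iffI)
    fix x assume "x \<in> {\<bar>a\<bar><..}"
    then have x: "\<bar>a\<bar> < x" by simp
    obtain n where n: "inverse (real (Suc n)) \<le> sqrt (x\<^sup>2 - a\<^sup>2)" "sqrt (x\<^sup>2 - a\<^sup>2) \<le> real (Suc (Suc n))"
      using ex[of "sqrt (x\<^sup>2 - a\<^sup>2)"] sq[OF x] by auto
    have "(inverse (real (Suc n)))\<^sup>2 \<le> x\<^sup>2 - a\<^sup>2"
      using power_mono[OF n(1), of 2] sq[OF x] by simp
    moreover have "x\<^sup>2 - a\<^sup>2 \<le> (real (Suc (Suc n)))\<^sup>2"
      using power_mono[OF n(2), of 2] sq[OF x] by simp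
    ultimately have "c n \<le> x" "x \<le> d n"
      using x by (auto simp: c_def d_def intro!: real_le_lsqrt real_le_rsqrt)
    then show "x \<in> (\<Union>n. {c n..d n})" by auto
  qed (use c0 in \<open>auto intro: less_le_trans\<close>)
qed

text \<open>Integration of a function of \<open>y \<bullet> e\<close> and \<open>|y|\<close>, with \<open>r = |y|\<close> and \<open>t\<close> the cosine of the angle
  between \<open>y\<close> and \<open>e\<close>.  On the slice \<open>y \<bullet> e = a\<close> one passes from the length of the orthogonal
  component to \<open>x = |y|\<close>, and then, for fixed \<open>|y|\<close>, from \<open>a\<close> to \<open>t\<close>.\<close>
lemma nn_integral_axial_polar:
  fixes h :: "real \<Rightarrow> real \<Rightarrow> ennreal" and e :: "'a::euclidean_space"
  assumes h[measurable]: "(\<lambda>x. h (fst x) (snd x)) \<in> borel_measurable (borel \<Otimes>\<^sub>M borel)"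
    and e: "norm e = 1" and N: "2 \<le> DIM('a)"
  shows "(\<integral>\<^sup>+y. h (y \<bullet> e) (norm y) \<partial>lborel) =
    (\<integral>\<^sup>+r. indicator {0<..} r * (\<integral>\<^sup>+t. indicator {-1<..<1} t *
        ennreal (unit_sphere_area (DIM('a) - 1) * r ^ (DIM('a) - 1) * (1 - t\<^sup>2) powr ((real DIM('a) - 3) / 2)) *
        h (r * t) r \<partial>lborel) \<partial>lborel)"
proof -
  let ?N = "DIM('a)" and ?S = "unit_sphere_area (DIM('a) - 1)"
  obtain b :: 'a where b: "b \<in> Basis" using nonempty_Basis by blast
  have S: "?S \<ge> 0" by (simp add: unit_sphere_area_def)
  have mh[measurable]: "(\<lambda>x. h (f x) (g x)) \<in> borel_measurable M"
    if "f \<in> borel_measurable M" "g \<in> borel_measurable M" for f g and M :: "'z measure"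
    using that by (intro measurable_compose[OF _ h, of "\<lambda>x. (f x, g x)", simplified]) measurable
  \<comment> \<open>The density of \<open>(y \<bullet> e, |y|)\<close> on the region \<open>\<bar>a\<bar> < x\<close>.\<close>
  define w where "w a x = ?S * (x * (x\<^sup>2 - a\<^sup>2) powr ((real ?N - 3) / 2))" for a x :: real
  have sq: "\<bar>a\<bar> < x \<Longrightarrow> a\<^sup>2 < x\<^sup>2" for a x :: real by (simp add: power2_strict_mono)
  have "(\<integral>\<^sup>+y. h (y \<bullet> e) (norm y) \<partial>lborel) = (\<integral>\<^sup>+y. h (y \<bullet> b) (norm y) \<partial>lborel)"
    using b e by (intro nn_integral_axial_unit_vector) auto
  also have "\<dots> = (\<integral>\<^sup>+a. (\<integral>\<^sup>+r. ennreal (?S * r ^ (?N - 2)) * indicator {0..} r *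
        h a (sqrt (a\<^sup>2 + r\<^sup>2)) \<partial>lborel) \<partial>lborel)"
    by (rule nn_integral_axial_basis[OF h b N])
  also have "\<dots> = (\<integral>\<^sup>+a. (\<integral>\<^sup>+x. indicator {\<bar>a\<bar><..} x * ennreal (w a x) * h a x \<partial>lborel) \<partial>lborel)"
  proof (rule nn_integral_cong)
    fix a :: real
    let ?f = "\<lambda>r. ennreal (?S * r ^ (?N - 2)) * h a (sqrt (a\<^sup>2 + r\<^sup>2))"
    have "AE r in lborel. (r::real) \<notin> {0}" by (intro AE_not_in countable_imp_null_set_lborel) simp
    then have "(\<integral>\<^sup>+r. ennreal (?S * r ^ (?N - 2)) * indicator {0..} r * h a (sqrt (a\<^sup>2 + r\<^sup>2)) \<partial>lborel)
        = (\<integral>\<^sup>+r. ?f r * indicator {0<..} r \<partial>lborel)"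
      by (intro nn_integral_cong_AE) (auto elim!: eventually_mono simp: indicator_def)
    also have "\<dots> = (\<integral>\<^sup>+x. ?f (sqrt (x\<^sup>2 - a\<^sup>2)) * ennreal (x / sqrt (x\<^sup>2 - a\<^sup>2)) * indicator {\<bar>a\<bar><..} x \<partial>lborel)"
      by (rule nn_integral_sqrt_substitution) measurable
    also have "\<dots> = (\<integral>\<^sup>+x. indicator {\<bar>a\<bar><..} x * ennreal (w a x) * h a x \<partial>lborel)"
    proof (rule nn_integral_cong)
      fix x
      show "?f (sqrt (x\<^sup>2 - a\<^sup>2)) * ennreal (x / sqrt (x\<^sup>2 - a\<^sup>2)) * indicator {\<bar>a\<bar><..} x =
        indicator {\<bar>a\<bar><..} x * ennreal (w a x) * h a x"
      proof (cases "\<bar>a\<bar> < x")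
        case True
        define q where "q = x\<^sup>2 - a\<^sup>2"
        have q: "q > 0" using sq[OF True] by (simp add: q_def)
        have "sqrt q ^ (?N - 2) = (q powr (1/2)) powr (real (?N - 2))"
          using q by (simp add: powr_half_sqrt powr_realpow)
        also have "\<dots> / sqrt q = q powr ((real ?N - 2) / 2) / q powr (1/2)"
          using q N by (simp add: powr_powr of_nat_diff powr_half_sqrt[symmetric])
        also have "\<dots> = q powr ((real ?N - 3) / 2)"
          using q by (simp add: powr_diff[symmetric] diff_divide_distrib)
        finally have qq: "sqrt q ^ (?N - 2) / sqrt q = q powr ((real ?N - 3) / 2)" .
        have "?S * sqrt q ^ (?N - 2) * (x / sqrt q) = w a x"
          unfolding w_def q_def[symmetric] qq[symmetric] by simp
        moreover have "ennreal (?S * sqrt q ^ (?N - 2)) * ennreal (x / sqrt q) =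
            ennreal (?S * sqrt q ^ (?N - 2) * (x / sqrt q))"
          using q S by (intro ennreal_mult''[symmetric]) (use True in auto)
        moreover have "sqrt (a\<^sup>2 + (sqrt q)\<^sup>2) = x"
          using q True by (simp add: q_def)
        ultimately show ?thesis
          using True by (simp add: q_def[symmetric] mult_ac)
      qed simp
    qed
    finally show "(\<integral>\<^sup>+r. ennreal (?S * r ^ (?N - 2)) * indicator {0..} r * h a (sqrt (a\<^sup>2 + r\<^sup>2)) \<partial>lborel)
      = (\<integral>\<^sup>+x. indicator {\<bar>a\<bar><..} x * ennreal (w a x) * h a x \<partial>lborel)" .
  qed
  also have "\<dots> = (\<integral>\<^sup>+r. (\<integral>\<^sup>+a. indicator {\<bar>a\<bar><..} r * ennreal (w a r) * h a r \<partial>lborel) \<partial>lborel)"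
  proof (rule lborel_pair.Fubini')
    have "(\<lambda>(x, a). indicator {z. \<bar>snd z\<bar> < fst z} (x, a) * ennreal (w a x) * h a x)
        \<in> borel_measurable (lborel \<Otimes>\<^sub>M lborel)"
      unfolding w_def by measurable
    then show "(\<lambda>(x, a). indicator {\<bar>a\<bar><..} x * ennreal (w a x) * h a x) \<in> borel_measurable (lborel \<Otimes>\<^sub>M lborel)"
      by (simp add: indicator_def)
  qed
  also have "\<dots> = (\<integral>\<^sup>+r. indicator {0<..} r * (\<integral>\<^sup>+t. indicator {-1<..<1} t *
        ennreal (?S * r ^ (?N - 1) * (1 - t\<^sup>2) powr ((real ?N - 3) / 2)) * h (r * t) r \<partial>lborel) \<partial>lborel)"
  proof (rule nn_integral_cong)
    fix r :: real
    show "(\<integral>\<^sup>+a. indicator {\<bar>a\<bar><..} r * ennreal (w a r) * h a r \<partial>lborel) =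
      indicator {0<..} r * (\<integral>\<^sup>+t. indicator {-1<..<1} t *
        ennreal (?S * r ^ (?N - 1) * (1 - t\<^sup>2) powr ((real ?N - 3) / 2)) * h (r * t) r \<partial>lborel)"
    proof (cases "r > 0")
      case True
      have [measurable]: "(\<lambda>a. indicator {\<bar>a\<bar><..} r :: ennreal) \<in> borel_measurable borel"
      proof -
        have "(\<lambda>a. indicator {\<bar>a\<bar><..} r :: ennreal) = indicator {a. \<bar>a\<bar> < r}"
          by (auto simp: indicator_def)
        then show ?thesis by simp
      qed
      have "(\<integral>\<^sup>+a. indicator {\<bar>a\<bar><..} r * ennreal (w a r) * h a r \<partial>lborel) =
         ennreal r * (\<integral>\<^sup>+t. indicator {\<bar>r * t\<bar><..} r * ennreal (w (r * t) r) * h (r * t) r \<partial>lborel)"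
        using True by (subst nn_integral_real_affine[where c = r and t = 0]) (simp_all add: w_def)
      also have "\<dots> = (\<integral>\<^sup>+t. ennreal r * (indicator {\<bar>r * t\<bar><..} r * ennreal (w (r * t) r) * h (r * t) r) \<partial>lborel)"
        by (subst nn_integral_cmult) (auto simp: w_def)
      also have "\<dots> = (\<integral>\<^sup>+t. indicator {-1<..<1} t *
        ennreal (?S * r ^ (?N - 1) * (1 - t\<^sup>2) powr ((real ?N - 3) / 2)) * h (r * t) r \<partial>lborel)"
      proof (rule nn_integral_cong)
        fix t :: real
        have iff: "\<bar>r * t\<bar> < r \<longleftrightarrow> -1 < t \<and> t < 1"
          using True by (auto simp: abs_mult abs_less_iff mult_less_cancel_left1)
        show "ennreal r * (indicator {\<bar>r * t\<bar><..} r * ennreal (w (r * t) r) * h (r * t) r) =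
          indicator {-1<..<1} t *
        ennreal (?S * r ^ (?N - 1) * (1 - t\<^sup>2) powr ((real ?N - 3) / 2)) * h (r * t) r"
        proof (cases "-1 < t \<and> t < 1")
          case t: True
          have pos: "1 - t\<^sup>2 > 0" using t by (simp add: abs_square_less_1 abs_less_iff)
          have "(r\<^sup>2 - (r * t)\<^sup>2) = r\<^sup>2 * (1 - t\<^sup>2)" by (simp add: power_mult_distrib algebra_simps)
          then have "(r\<^sup>2 - (r * t)\<^sup>2) powr ((real ?N - 3) / 2) = (r\<^sup>2) powr ((real ?N - 3) / 2) * (1 - t\<^sup>2) powr ((real ?N - 3) / 2)"
            using pos by (simp add: powr_mult)
          also have "(r\<^sup>2) powr ((real ?N - 3) / 2) = r powr (real ?N - 3)"
          proof -
            have "r\<^sup>2 = r powr 2" using True by simp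
            moreover have "2 * ((real ?N - 3) / 2) = real ?N - 3" by (simp add: field_simps)
            ultimately show ?thesis by (simp only: powr_powr)
          qed
          finally have "r * w (r * t) r = ?S * (r * r * r powr (real ?N - 3)) * (1 - t\<^sup>2) powr ((real ?N - 3) / 2)"
            by (simp add: w_def)
          also have "r * r = r powr 2"
            using True by (simp add: power2_eq_square)
          also have "r powr 2 * r powr (real ?N - 3) = r powr (real (?N - 1))"
            using N by (simp add: of_nat_diff flip: powr_add)
          also have "\<dots> = r ^ (?N - 1)" by (rule powr_realpow[OF True])
          finally have "r * w (r * t) r = ?S * r ^ (?N - 1) * (1 - t\<^sup>2) powr ((real ?N - 3) / 2)" .
          then show ?thesis
            using iff t True by (simp add: ennreal_mult'[symmetric] mult.assoc[symmetric])
        next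
          case False
          then have "\<not> \<bar>r * t\<bar> < r" using iff by simp
          then show ?thesis using False by (auto simp: indicator_def)
        qed
      qed
      finally show ?thesis using True by simp
    next
      case False
      then have "indicator {\<bar>a\<bar><..} r = (0::ennreal)" for a by (auto simp: indicator_def)
      then show ?thesis using False by simp
    qed
  qed
  finally show ?thesis .
qed

section \<open>The angular kernel and the fractional Hardy constant\<close>

lemma nn_integral_inversion_substitution:
  fixes f :: "real \<Rightarrow> ennreal"
  assumes f[measurable]: "f \<in> borel_measurable borel"
  shows "(\<integral>\<^sup>+x. f x * indicator {1<..} x \<partial>lborel) =
    (\<integral>\<^sup>+r. f (1 / r) * ennreal (1 / r\<^sup>2) * indicator {0<..<1} r \<partial>lborel)"
proof -
  define c where "c n = - 1 + inverse (real (n + 3))" for n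
  define d where "d n = - inverse (real (n + 3))" for n
  have inv: "0 < inverse (real (n + 3))" "inverse (real (n + 3)) \<le> 1 / 3" for n
    by (auto simp: field_simps)
  have arch: "\<exists>n. inverse (real (n + 3)) \<le> r" if "r > 0" for r :: real
  proof -
    obtain n where "inverse (real (Suc n)) < r" using reals_Archimedean[OF \<open>r > 0\<close>] by auto
    moreover have "inverse (real (n + 3)) \<le> inverse (real (Suc n))"
      by (intro le_imp_inverse_le) auto
    ultimately show ?thesis by (intro exI[of _ n]) linarith
  qed
  have inv_mono: "inverse (real (n + 3)) \<le> inverse (real (m + 3))" if "m \<le> n" for m n
    using that by (intro le_imp_inverse_le) auto
  \<comment> \<open>The inversion is decreasing, so the increasing map \<open>r \<mapsto> - 1 / r\<close> on \<open>(-1,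
    0)\<close> is used first.\<close>
  have "(\<integral>\<^sup>+x. f x * indicator {1<..} x \<partial>lborel) =
    (\<integral>\<^sup>+r. f (- 1 / r) * ennreal (1 / r\<^sup>2) * indicator {-1<..<0} r \<partial>lborel)"
  proof (rule nn_integral_substitution_exhaustion[OF f, where c = c and d = d])
    show "((\<lambda>r. - 1 / r) has_real_derivative 1 / x\<^sup>2) (at x)" if "x \<in> {-1<..<0}" for x
      using that by (auto intro!: derivative_eq_intros simp: power2_eq_square)
    show "continuous_on {-1<..<0::real} (\<lambda>r. 1 / r\<^sup>2)" by (intro continuous_intros) auto
    show "decseq c" "incseq d" using inv_mono by (auto simp: decseq_def incseq_def c_def d_def)
    show "c n < d n" for n using inv[of n] unfolding c_def d_def by linarith
    show "{-1<..<0} = (\<Union>n. {c n..d n})"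
    proof (intro set_eqI iffI)
      fix x :: real assume x: "x \<in> {-1<..<0}"
      then obtain n where "inverse (real (n + 3)) \<le> min (x + 1) (- x)" using arch[of "min (x + 1) (- x)"] by auto
      then show "x \<in> (\<Union>n. {c n..d n})" by (auto simp: c_def d_def intro!: exI[of _ n])
    next
      fix x assume "x \<in> (\<Union>n. {c n..d n})"
      then obtain n where "c n \<le> x" "x \<le> d n" by auto
      then have "-1 < x \<and> x < 0" using inv[of n] unfolding c_def d_def by linarith
      then show "x \<in> {-1<..<0}" by simp
    qed
    show "{1<..} = (\<Union>n. {- 1 / c n..- 1 / d n})"
    proof (intro set_eqI iffI)
      fix x :: real assume "x \<in> {1<..}"
      then have x: "x > 1" by simp
      obtain n where n: "inverse (real (n + 3)) \<le> min (1 / x) (1 - 1 / x)"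
        using arch[of "min (1 / x) (1 - 1 / x)"] x by auto
      have "- 1 / c n = 1 / (1 - inverse (real (n + 3)))"
        using inv[of n] by (simp add: c_def field_simps)
      also have "\<dots> \<le> 1 / (1 / x)"
        using n x inv[of n] by (intro divide_left_mono) auto
      finally have "- 1 / c n \<le> x" by simp
      moreover have "1 / (1 / x) \<le> 1 / inverse (real (n + 3))"
        using n x inv[of n] by (intro divide_left_mono) auto
      then have "x \<le> - 1 / d n" by (simp add: d_def)
      ultimately show "x \<in> (\<Union>n. {- 1 / c n..- 1 / d n})" by auto
    next
      fix x assume "x \<in> (\<Union>n. {- 1 / c n..- 1 / d n})"
      then obtain n where n: "- 1 / c n \<le> x" by auto
      have "1 < - 1 / c n"
        using inv[of n] by (simp add: c_def field_simps)
      then show "x \<in> {1<..}" using n by auto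
    qed
  qed auto
  also have "\<dots> = (\<integral>\<^sup>+r. f (1 / r) * ennreal (1 / r\<^sup>2) * indicator {0<..<1} r \<partial>lborel)"
    by (subst nn_integral_real_affine[where c = "-1" and t = 0])
      (auto intro!: nn_integral_cong simp: indicator_def)
  finally show ?thesis .
qed

lemma nn_integral_powr_finite:
  fixes R \<beta> :: real
  assumes "\<beta> > 0" "R \<ge> 0"
  shows "(\<integral>\<^sup>+r. ennreal (r powr (\<beta> - 1)) * indicator {0..R} r \<partial>lborel) < \<infinity>"
proof -
  have "((\<lambda>r. r powr (\<beta> - 1)) has_integral (R powr (\<beta> - 1 + 1) / (\<beta> - 1 + 1))) {0..R}"
    using assms by (intro has_integral_powr_from_0) auto
  from nn_integral_has_integral_lebesgue[OF _ this] show ?thesis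
    by (simp add: nn_integral_completion ennreal_mult' ennreal_indicator mult.commute)
qed

lemma nn_integral_interval_pos:
  fixes f :: "real \<Rightarrow> ennreal"
  assumes [measurable]: "f \<in> borel_measurable borel" and "a < b"
    and pos: "\<And>x. a < x \<Longrightarrow> x < b \<Longrightarrow> f x \<noteq> 0"
  shows "(\<integral>\<^sup>+x. indicator {a<..<b} x * f x \<partial>lborel) \<noteq> 0"
proof
  assume "(\<integral>\<^sup>+x. indicator {a<..<b} x * f x \<partial>lborel) = 0"
  then have "AE x in lborel. indicator {a<..<b} x * f x = 0"
    by (subst (asm) nn_integral_0_iff_AE) auto
  then have "AE x in lborel. x \<notin> {a<..<b}"
    by (rule eventually_mono) (use pos in \<open>auto simp: indicator_def split: if_splits\<close>)
  then have "emeasure lborel {a<..<b} = 0"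
    by (subst (asm) AE_iff_measurable[of "{a<..<b}"]) auto
  then show False using \<open>a < b\<close> by simp
qed

definition sphere_weight :: "nat \<Rightarrow> real \<Rightarrow> real" where
  "sphere_weight N t = unit_sphere_area (N - 1) * (1 - t\<^sup>2) powr ((real N - 3) / 2)"

text \<open>The kernel \<open>Psi\<close>, where \<open>q\<close> stands for \<open>N + ps\<close>, as an extended nonnegative integral: it can be used
  before anything is known about integrability.\<close>
definition Psi_nn :: "nat \<Rightarrow> real \<Rightarrow> real \<Rightarrow> ennreal" where
  "Psi_nn N q r = (\<integral>\<^sup>+t. indicator {-1<..<1} t *
     ennreal (sphere_weight N t / (1 - 2 * r * t + r\<^sup>2) powr (q / 2)) \<partial>lborel)"

lemma sphere_weight_measurable[measurable]: "sphere_weight N \<in> borel_measurable borel"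
  unfolding sphere_weight_def by measurable

lemma sphere_weight_nonneg: "sphere_weight N t \<ge> 0"
  by (simp add: sphere_weight_def unit_sphere_area_def)

lemma Psi_nn_measurable[measurable]: "Psi_nn N q \<in> borel_measurable borel"
  unfolding Psi_nn_def by measurable

text \<open>In dimension 2 the weight is singular at the poles.  Its integral is a factor of the volume of
  the unit ball, and is therefore finite.\<close>
lemma nn_integral_sphere_weight_finite:
  assumes "2 \<le> DIM('a::euclidean_space)"
  shows "(\<integral>\<^sup>+t. indicator {-1<..<1} t * ennreal (sphere_weight DIM('a) t) \<partial>lborel) < \<infinity>"
    (is "?W < \<infinity>")
proof -
  let ?N = "DIM('a)"
  obtain b :: 'a where b: "b \<in> Basis" using nonempty_Basis by blast
  have ball: "emeasure lborel (cball (0::'a) 1) = (\<integral>\<^sup>+y. indicator {..1} (norm (y::'a)) \<partial>lborel)"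
    by (subst nn_integral_indicator[symmetric], simp, rule nn_integral_cong) (simp add: indicator_def)
  have "(\<integral>\<^sup>+y. indicator {..1} (norm (y::'a)) \<partial>lborel) =
    (\<integral>\<^sup>+r. indicator {0<..} r * (\<integral>\<^sup>+t. indicator {-1<..<1} t *
        ennreal (unit_sphere_area (?N - 1) * r ^ (?N - 1) * (1 - t\<^sup>2) powr ((real ?N - 3) / 2)) *
        indicator {..1} r \<partial>lborel) \<partial>lborel)"
    using b assms by (intro nn_integral_axial_polar[where h = "\<lambda>a r. indicator {..1} r" and e = b]) auto
  also have "\<dots> = (\<integral>\<^sup>+r. indicator {0<..<1} r * ennreal (r ^ (?N - 1)) * ?W \<partial>lborel)"
  proof (rule nn_integral_cong_AE)
    have "AE r in lborel. (r::real) \<notin> {1}" by (intro AE_not_in countable_imp_null_set_lborel) simp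
    then show "AE r in lborel. indicator {0<..} r * (\<integral>\<^sup>+t. indicator {-1<..<1} t *
        ennreal (unit_sphere_area (?N - 1) * r ^ (?N - 1) * (1 - t\<^sup>2) powr ((real ?N - 3) / 2)) *
        indicator {..1} r \<partial>lborel) = indicator {0<..<1} r * ennreal (r ^ (?N - 1)) * ?W"
    proof eventually_elim
      case (elim r)
      show ?case
      proof (cases "0 < r \<and> r < 1")
        case True
        have "(\<integral>\<^sup>+t. indicator {-1<..<1} t *
          ennreal (unit_sphere_area (?N - 1) * r ^ (?N - 1) * (1 - t\<^sup>2) powr ((real ?N - 3) / 2)) * indicator {..1} r \<partial>lborel)
          = (\<integral>\<^sup>+t. ennreal (r ^ (?N - 1)) * (indicator {-1<..<1} t * ennreal (sphere_weight ?N t)) \<partial>lborel)"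
          using True sphere_weight_nonneg
          by (intro nn_integral_cong)
            (auto simp: sphere_weight_def ennreal_mult'[symmetric] mult_ac indicator_def)
        also have "\<dots> = ennreal (r ^ (?N - 1)) * ?W"
          by (rule nn_integral_cmult) measurable
        finally show ?thesis using True by simp
      qed (use elim in \<open>auto simp: indicator_def\<close>)
    qed
  qed
  also have "\<dots> = (\<integral>\<^sup>+r. indicator {0<..<1} r * ennreal (r ^ (?N - 1)) \<partial>lborel) * ?W"
    by (rule nn_integral_multc) measurable
  finally have eq: "emeasure lborel (cball (0::'a) 1) = (\<integral>\<^sup>+r. indicator {0<..<1} r * ennreal (r ^ (?N - 1)) \<partial>lborel) * ?W"
    by (simp only: ball)
  have "(\<integral>\<^sup>+r. indicator {0<..<1} r * ennreal (r ^ (?N - 1)) \<partial>lborel) \<noteq> 0"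
    by (rule nn_integral_interval_pos) auto
  moreover have "emeasure lborel (cball (0::'a) 1) < \<infinity>"
    using emeasure_lborel_cball_finite by auto
  ultimately show ?thesis
    unfolding eq by (auto simp: ennreal_mult_less_top less_top)
qed

lemma one_minus_sq_le_kernel:
  fixes r t :: real
  assumes "0 \<le> r" "t \<le> 1"
  shows "(1 - r)\<^sup>2 \<le> 1 - 2 * r * t + r\<^sup>2"
  using mult_left_mono[OF assms(2,1)] by (simp add: power2_diff algebra_simps power2_eq_square)

lemma Psi_nn_le:
  assumes "0 \<le> r" "r \<le> \<kappa>" "\<kappa> < 1" "q \<ge> 0"
  shows "Psi_nn N q r \<le> ennreal ((1 - \<kappa>) powr (- q)) *
    (\<integral>\<^sup>+t. indicator {-1<..<1} t * ennreal (sphere_weight N t) \<partial>lborel)"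
proof -
  have "Psi_nn N q r \<le> (\<integral>\<^sup>+t. ennreal ((1 - \<kappa>) powr (- q)) * (indicator {-1<..<1} t * ennreal (sphere_weight N t)) \<partial>lborel)"
    unfolding Psi_nn_def
  proof (rule nn_integral_mono)
    fix t :: real
    show "indicator {-1<..<1} t * ennreal (sphere_weight N t / (1 - 2 * r * t + r\<^sup>2) powr (q / 2))
      \<le> ennreal ((1 - \<kappa>) powr (- q)) * (indicator {-1<..<1} t * ennreal (sphere_weight N t))"
    proof (cases "-1 < t \<and> t < 1")
      case True
      have "(1 - \<kappa>)\<^sup>2 \<le> (1 - r)\<^sup>2" using assms by (intro power_mono) auto
      also have "\<dots> \<le> 1 - 2 * r * t + r\<^sup>2" using True assms by (intro one_minus_sq_le_kernel) auto
      finally have "((1 - \<kappa>)\<^sup>2) powr (q / 2) \<le> (1 - 2 * r * t + r\<^sup>2) powr (q / 2)"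
        using assms by (intro powr_mono2) auto
      also have "((1 - \<kappa>)\<^sup>2) powr (q / 2) = (1 - \<kappa>) powr q"
        using assms powr_powr[of "1 - \<kappa>" 2 "q / 2"] by simp
      finally have le: "(1 - \<kappa>) powr q \<le> (1 - 2 * r * t + r\<^sup>2) powr (q / 2)" .
      have "sphere_weight N t / (1 - 2 * r * t + r\<^sup>2) powr (q / 2) \<le> sphere_weight N t / (1 - \<kappa>) powr q"
        using assms le by (intro divide_left_mono sphere_weight_nonneg)
          (auto intro!: mult_pos_pos order.strict_trans2[OF _ le])
      also have "\<dots> = (1 - \<kappa>) powr (- q) * sphere_weight N t"
        by (simp add: powr_minus field_simps)
      finally show ?thesis using True sphere_weight_nonneg
        by (simp add: ennreal_mult'[symmetric] ennreal_leI)
    qed simp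
  qed
  also have "\<dots> = ennreal ((1 - \<kappa>) powr (- q)) *
    (\<integral>\<^sup>+t. indicator {-1<..<1} t * ennreal (sphere_weight N t) \<partial>lborel)"
    by (rule nn_integral_cmult) measurable
  finally show ?thesis .
qed

lemma Psi_eq_Psi_nn:
  assumes "2 \<le> DIM('a::euclidean_space)" "0 \<le> r" "r < 1" "0 \<le> p * s"
  shows "ennreal (Psi DIM('a) s p r) = Psi_nn DIM('a) (real DIM('a) + p * s) r"
proof -
  let ?N = "DIM('a)" and ?q = "real DIM('a) + p * s"
  let ?S = "unit_sphere_area (?N - 1)"
  define f where "f t = indicator {-1..1} t * ((1 - t\<^sup>2) powr ((real ?N - 3) / 2) /
        (1 - 2 * r * t + r\<^sup>2) powr (?q / 2))" for t :: real
  have f0: "f t \<ge> 0" for t by (simp add: f_def)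
  have [measurable]: "f \<in> borel_measurable borel" unfolding f_def by measurable
  have S: "?S > 0" using assms(1) by (auto simp: unit_sphere_area_def intro!: mult_pos_pos)
  have ae: "AE t in lborel. (t::real) \<notin> {-1, 1}" by (intro AE_not_in countable_imp_null_set_lborel) simp
  have eq: "Psi_nn ?N ?q r = (\<integral>\<^sup>+t. ennreal ?S * ennreal (f t) \<partial>lborel)"
    unfolding Psi_nn_def using ae
    by (intro nn_integral_cong_AE, eventually_elim)
      (use S in \<open>auto simp: sphere_weight_def f_def indicator_def ennreal_mult'[symmetric]\<close>)
  also have "\<dots> = ennreal ?S * (\<integral>\<^sup>+t. ennreal (f t) \<partial>lborel)"
    by (rule nn_integral_cmult) measurable
  finally have eq: "Psi_nn ?N ?q r = ennreal ?S * (\<integral>\<^sup>+t. ennreal (f t) \<partial>lborel)" .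
  have "Psi_nn ?N ?q r < \<infinity>"
    using Psi_nn_le[of r r ?q ?N] assms nn_integral_sphere_weight_finite[where 'a = 'a]
    by (auto simp: ennreal_mult_less_top elim!: order.strict_trans1)
  then have fin: "(\<integral>\<^sup>+t. ennreal (f t) \<partial>lborel) < \<infinity>"
    using S unfolding eq by (auto simp: ennreal_mult_less_top)
  have "integral\<^sup>L lborel f = enn2real (\<integral>\<^sup>+t. ennreal (f t) \<partial>lborel)"
    by (rule integral_eq_nn_integral) (auto simp: f0)
  then have "ennreal (integral\<^sup>L lborel f) = (\<integral>\<^sup>+t. ennreal (f t) \<partial>lborel)"
    using fin by simp
  moreover have "Psi ?N s p r = ?S * integral\<^sup>L lborel f"
    by (simp add: Psi_def set_lebesgue_integral_def f_def[abs_def])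
  ultimately show ?thesis
    unfolding eq using S by (simp add: ennreal_mult')
qed

text \<open>The counterpart of \<open>|e - \<omega> / r| = |e - r \<omega>| / r\<close> for unit vectors \<open>e\<close> and \<open>\<omega>\<close>.\<close>
lemma Psi_nn_inversion:
  assumes "0 < r"
  shows "Psi_nn N q (1 / r) = ennreal (r powr q) * Psi_nn N q r"
proof -
  have "Psi_nn N q (1 / r) = (\<integral>\<^sup>+t. ennreal (r powr q) * (indicator {-1<..<1} t *
     ennreal (sphere_weight N t / (1 - 2 * r * t + r\<^sup>2) powr (q / 2))) \<partial>lborel)"
    unfolding Psi_nn_def
  proof (rule nn_integral_cong)
    fix t :: real
    show "indicator {-1<..<1} t * ennreal (sphere_weight N t / (1 - 2 * (1 / r) * t + (1 / r)\<^sup>2) powr (q / 2))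
      = ennreal (r powr q) * (indicator {-1<..<1} t *
        ennreal (sphere_weight N t / (1 - 2 * r * t + r\<^sup>2) powr (q / 2)))"
    proof (cases "-1 < t \<and> t < 1")
      case True
      have "1 - 2 * (1 / r) * t + (1 / r)\<^sup>2 = (1 - 2 * r * t + r\<^sup>2) / r powr 2"
        using assms by (simp add: field_simps power2_eq_square)
      moreover have "0 \<le> 1 - 2 * r * t + r\<^sup>2"
        using one_minus_sq_le_kernel[of r t] True assms by (auto intro: order_trans[rotated])
      ultimately have "(1 - 2 * (1 / r) * t + (1 / r)\<^sup>2) powr (q / 2) = (1 - 2 * r * t + r\<^sup>2) powr (q / 2) / r powr q"
        using assms by (simp only: powr_divide powr_powr) (simp add: powr_powr)
      then show ?thesis
        using True by (simp add: ennreal_mult'[symmetric] mult.commute)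
    qed simp
  qed
  also have "\<dots> = ennreal (r powr q) * Psi_nn N q r"
    unfolding Psi_nn_def by (rule nn_integral_cmult) measurable
  finally show ?thesis .
qed

text \<open>The meaning of the angular kernel: it is the integral of \<open>|e - y|\<^bsup>-q\<^esup>\<close> over the sphere of radius
  \<open>r\<close>, relative to \<open>r\<^bsup>N-1\<^esup>\<close>.\<close>
lemma nn_integral_radial_kernel:
  fixes e :: "'a::euclidean_space" and F :: "real \<Rightarrow> ennreal"
  assumes [measurable]: "F \<in> borel_measurable borel" and e: "norm e = 1" and N: "2 \<le> DIM('a)"
  shows "(\<integral>\<^sup>+y. F (norm y) * ennreal (1 / norm (e - y) powr q) \<partial>lborel) =
    (\<integral>\<^sup>+r. indicator {0<..} r * (F r * ennreal (r ^ (DIM('a) - 1)) * Psi_nn DIM('a) q r) \<partial>lborel)"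
proof -
  let ?N = "DIM('a)"
  have nrm: "norm (e - y) powr q = (1 - 2 * (y \<bullet> e) + (norm y)\<^sup>2) powr (q / 2)" for y
  proof -
    have "(norm (e - y)) powr 2 = 1 - 2 * (y \<bullet> e) + (norm y)\<^sup>2"
      using e dot_norm_neg[of e y] by (simp add: inner_commute)
    moreover have "norm (e - y) powr q = (norm (e - y) powr 2) powr (q / 2)"
      by (simp only: powr_powr) simp
    ultimately show ?thesis by simp
  qed
  have "(\<integral>\<^sup>+y. F (norm y) * ennreal (1 / norm (e - y) powr q) \<partial>lborel) =
    (\<integral>\<^sup>+y. F (norm y) * ennreal (1 / (1 - 2 * (y \<bullet> e) + (norm y)\<^sup>2) powr (q / 2)) \<partial>lborel)"
    by (simp add: nrm)
  also have "\<dots> = (\<integral>\<^sup>+r. indicator {0<..} r * (\<integral>\<^sup>+t. indicator {-1<..<1} t *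
        ennreal (unit_sphere_area (?N - 1) * r ^ (?N - 1) * (1 - t\<^sup>2) powr ((real ?N - 3) / 2)) *
        (F r * ennreal (1 / (1 - 2 * (r * t) + r\<^sup>2) powr (q / 2))) \<partial>lborel) \<partial>lborel)"
    by (rule nn_integral_axial_polar[where h = "\<lambda>a r. F r * ennreal (1 / (1 - 2 * a + r\<^sup>2) powr (q / 2))"])
      (use e N in measurable)
  also have "\<dots> = (\<integral>\<^sup>+r. indicator {0<..} r * (F r * ennreal (r ^ (?N - 1)) * Psi_nn ?N q r) \<partial>lborel)"
  proof (rule nn_integral_cong)
    fix r :: real
    show "indicator {0<..} r * (\<integral>\<^sup>+t. indicator {-1<..<1} t *
        ennreal (unit_sphere_area (?N - 1) * r ^ (?N - 1) * (1 - t\<^sup>2) powr ((real ?N - 3) / 2)) *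
        (F r * ennreal (1 / (1 - 2 * (r * t) + r\<^sup>2) powr (q / 2))) \<partial>lborel)
      = indicator {0<..} r * (F r * ennreal (r ^ (?N - 1)) * Psi_nn ?N q r)"
    proof (cases "r > 0")
      case True
      have "(\<integral>\<^sup>+t. indicator {-1<..<1} t *
        ennreal (unit_sphere_area (?N - 1) * r ^ (?N - 1) * (1 - t\<^sup>2) powr ((real ?N - 3) / 2)) *
        (F r * ennreal (1 / (1 - 2 * (r * t) + r\<^sup>2) powr (q / 2))) \<partial>lborel)
        = (\<integral>\<^sup>+t. (F r * ennreal (r ^ (?N - 1))) * (indicator {-1<..<1} t *
     ennreal (sphere_weight ?N t / (1 - 2 * r * t + r\<^sup>2) powr (q / 2))) \<partial>lborel)"
      proof (rule nn_integral_cong)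
        fix t :: real
        have 1: "ennreal (unit_sphere_area (?N - 1) * r ^ (?N - 1) * (1 - t\<^sup>2) powr ((real ?N - 3) / 2)) =
          ennreal (r ^ (?N - 1)) * ennreal (sphere_weight ?N t)"
          using True by (subst ennreal_mult'[symmetric]) (auto simp: sphere_weight_def mult_ac)
        have 2: "ennreal (sphere_weight ?N t / (1 - 2 * r * t + r\<^sup>2) powr (q / 2)) =
          ennreal (sphere_weight ?N t) * ennreal (1 / (1 - 2 * (r * t) + r\<^sup>2) powr (q / 2))"
          by (subst ennreal_mult'[symmetric]) (auto simp: sphere_weight_nonneg mult.assoc)
        show "indicator {-1<..<1} t *
          ennreal (unit_sphere_area (?N - 1) * r ^ (?N - 1) * (1 - t\<^sup>2) powr ((real ?N - 3) / 2)) *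
          (F r * ennreal (1 / (1 - 2 * (r * t) + r\<^sup>2) powr (q / 2)))
          = (F r * ennreal (r ^ (?N - 1))) * (indicator {-1<..<1} t *
           ennreal (sphere_weight ?N t / (1 - 2 * r * t + r\<^sup>2) powr (q / 2)))"
          unfolding 1 2 by (simp only: mult_ac)
      qed
      also have "\<dots> = F r * ennreal (r ^ (?N - 1)) * Psi_nn ?N q r"
        unfolding Psi_nn_def by (rule nn_integral_cmult) measurable
      finally show ?thesis by simp
    qed simp
  qed
  finally show ?thesis .
qed

text \<open>The right-hand side depends on \<open>x\<close> only through a power of \<open>|x|\<close>: the dilation by \<open>|x|\<close> moves
  \<open>x\<close> to the unit sphere.\<close>
lemma nn_integral_scaled_kernel:
  fixes x :: "'a::euclidean_space" and G :: "real \<Rightarrow> ennreal"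
  assumes [measurable]: "G \<in> borel_measurable borel" and x: "x \<noteq> 0" and N: "2 \<le> DIM('a)"
  shows "(\<integral>\<^sup>+y. G (norm y / norm x) * ennreal (1 / norm (x - y) powr q) \<partial>lborel) =
    ennreal (norm x powr (real DIM('a) - q)) *
    (\<integral>\<^sup>+r. indicator {0<..} r * (G r * ennreal (r ^ (DIM('a) - 1)) * Psi_nn DIM('a) q r) \<partial>lborel)"
proof -
  let ?N = "DIM('a)" and ?c = "norm x"
  define e where "e = (1 / ?c) *\<^sub>R x"
  have c: "?c > 0" using x by simp
  have e: "norm e = 1" and xe: "x = ?c *\<^sub>R e" using x by (auto simp: e_def)
  have "(\<integral>\<^sup>+y. G (norm y / ?c) * ennreal (1 / norm (x - y) powr q) \<partial>lborel) =
    ennreal (?c ^ ?N) * (\<integral>\<^sup>+y. G (norm (?c *\<^sub>R y) / ?c) * ennreal (1 / norm (x - ?c *\<^sub>R y) powr q) \<partial>lborel)"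
    by (rule nn_integral_lborel_dilation[OF _ c]) measurable
  also have "(\<integral>\<^sup>+y. G (norm (?c *\<^sub>R y) / ?c) * ennreal (1 / norm (x - ?c *\<^sub>R y) powr q) \<partial>lborel)
    = (\<integral>\<^sup>+y. ennreal (?c powr (- q)) * (G (norm y) * ennreal (1 / norm (e - y) powr q)) \<partial>lborel)"
  proof (rule nn_integral_cong)
    fix y
    have "x - ?c *\<^sub>R y = ?c *\<^sub>R (e - y)"
      by (subst (1) xe) (simp add: scaleR_diff_right)
    then have "norm (x - ?c *\<^sub>R y) = ?c * norm (e - y)" by simp
    then have "1 / norm (x - ?c *\<^sub>R y) powr q = ?c powr (- q) * (1 / norm (e - y) powr q)"
      using c by (simp add: powr_mult powr_minus field_simps)
    then show "G (norm (?c *\<^sub>R y) / ?c) * ennreal (1 / norm (x - ?c *\<^sub>R y) powr q) =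
      ennreal (?c powr (- q)) * (G (norm y) * ennreal (1 / norm (e - y) powr q))"
      using c by (simp add: ennreal_mult mult_ac del: times_divide_eq_right mult_1_right)
  qed
  also have "\<dots> = ennreal (?c powr (- q)) *
    (\<integral>\<^sup>+r. indicator {0<..} r * (G r * ennreal (r ^ (?N - 1)) * Psi_nn ?N q r) \<partial>lborel)"
    by (subst nn_integral_cmult) (auto simp: nn_integral_radial_kernel[OF _ e N])
  also have "ennreal (?c ^ ?N) * (ennreal (?c powr (- q)) * R) = ennreal (?c powr (real ?N - q)) * R" for R
  proof -
    have "?c ^ ?N * ?c powr (- q) = ?c powr (real ?N - q)"
      by (simp add: powr_diff powr_minus_divide powr_realpow[OF c])
    then show ?thesis using c by (simp add: mult.assoc[symmetric] ennreal_mult'[symmetric])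
  qed
  finally show ?thesis .
qed

text \<open>The same with the roles of the two variables exchanged.  The integral now runs over \<open>|x| > |y|\<close>,
  and the inversion of radii brings it back to \<open>r < 1\<close>.\<close>
lemma nn_integral_scaled_kernel_inverse:
  fixes y :: "'a::euclidean_space" and G :: "real \<Rightarrow> ennreal"
  assumes [measurable]: "G \<in> borel_measurable borel" and y: "y \<noteq> 0" and N: "2 \<le> DIM('a)"
    and G0: "\<And>r. \<not> (0 < r \<and> r < 1) \<Longrightarrow> G r = 0"
  shows "(\<integral>\<^sup>+x. G (norm y / norm x) * ennreal (1 / norm (x - y) powr q) \<partial>lborel) =
    ennreal (norm y powr (real DIM('a) - q)) *
    (\<integral>\<^sup>+r. indicator {0<..<1} r * (G r * ennreal (r powr (q - real DIM('a) - 1)) * Psi_nn DIM('a) q r) \<partial>lborel)"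
proof -
  let ?N = "DIM('a)"
  have "(\<integral>\<^sup>+x. G (norm y / norm x) * ennreal (1 / norm (x - y) powr q) \<partial>lborel) =
    (\<integral>\<^sup>+x. G (1 / (norm x / norm y)) * ennreal (1 / norm (y - x) powr q) \<partial>lborel)"
    by (simp add: norm_minus_commute)
  also have "\<dots> = ennreal (norm y powr (real ?N - q)) *
    (\<integral>\<^sup>+r. indicator {0<..} r * (G (1 / r) * ennreal (r ^ (?N - 1)) * Psi_nn ?N q r) \<partial>lborel)"
    by (rule nn_integral_scaled_kernel[of "\<lambda>r. G (1 / r)"]) (use y N in auto)
  also have "(\<integral>\<^sup>+r. indicator {0<..} r * (G (1 / r) * ennreal (r ^ (?N - 1)) * Psi_nn ?N q r) \<partial>lborel)
    = (\<integral>\<^sup>+r. (G (1 / r) * ennreal (r ^ (?N - 1)) * Psi_nn ?N q r) * indicator {1<..} r \<partial>lborel)"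
  proof (rule nn_integral_cong)
    fix r :: real
    have "G (1 / r) = 0" if "\<not> 1 < r" using that by (intro G0) (auto simp: field_simps)
    then show "indicator {0<..} r * (G (1 / r) * ennreal (r ^ (?N - 1)) * Psi_nn ?N q r) =
      (G (1 / r) * ennreal (r ^ (?N - 1)) * Psi_nn ?N q r) * indicator {1<..} r"
      by (cases "1 < r") auto
  qed
  also have "\<dots> = (\<integral>\<^sup>+r. (G (1 / (1 / r)) * ennreal ((1 / r) ^ (?N - 1)) * Psi_nn ?N q (1 / r)) * ennreal (1 / r\<^sup>2) * indicator {0<..<1} r \<partial>lborel)"
    by (rule nn_integral_inversion_substitution) measurable
  also have "\<dots> = (\<integral>\<^sup>+r. indicator {0<..<1} r * (G r * ennreal (r powr (q - real ?N - 1)) * Psi_nn ?N q r) \<partial>lborel)"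
  proof (rule nn_integral_cong)
    fix r :: real
    show "(G (1 / (1 / r)) * ennreal ((1 / r) ^ (?N - 1)) * Psi_nn ?N q (1 / r)) * ennreal (1 / r\<^sup>2) * indicator {0<..<1} r
      = indicator {0<..<1} r * (G r * ennreal (r powr (q - real ?N - 1)) * Psi_nn ?N q r)"
    proof (cases "0 < r \<and> r < 1")
      case True
      then have r: "0 < r" by simp
      have "(1 / r) ^ (?N - 1) = r powr (- (real ?N - 1))"
      proof -
        have "(1 / r) ^ (?N - 1) = 1 / r powr (real (?N - 1))"
          using r by (simp only: powr_realpow power_divide) simp
        then show ?thesis using N by (simp only: powr_minus_divide) (simp add: of_nat_diff)
      qed
      moreover have "1 / r\<^sup>2 = r powr (- 2)"
        using r by (simp add: powr_minus_divide)
      ultimately have "(1 / r) ^ (?N - 1) * r powr q * (1 / r\<^sup>2) = r powr (- (real ?N - 1) + q + (- 2))"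
        by (simp only: powr_add)
      also have "- (real ?N - 1) + q + (- 2) = q - real ?N - 1" by simp
      finally have "ennreal ((1 / r) ^ (?N - 1)) * ennreal (r powr q) * ennreal (1 / r\<^sup>2) = ennreal (r powr (q - real ?N - 1))"
        using r by (subst ennreal_mult'[symmetric], simp)+ simp
      then have "G r * (ennreal ((1 / r) ^ (?N - 1)) * ennreal (r powr q) * ennreal (1 / r\<^sup>2)) * Psi_nn ?N q r =
          G r * ennreal (r powr (q - real ?N - 1)) * Psi_nn ?N q r"
        by (simp only:)
      moreover have "1 / (1 / r) = r" by simp
      moreover have "indicator {0<..<1} r = (1 :: ennreal)" using True by simp
      ultimately show ?thesis
        unfolding Psi_nn_inversion[OF r] by (simp only: mult_ac mult_1_right)
    qed auto
  qed
  finally show ?thesis .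
qed

text \<open>The tangent line at 1 for \<open>\<alpha> \<ge> 1\<close>, in the guise of Young's inequality, and monotonicity in the
  exponent for \<open>\<alpha> \<le> 1\<close>.\<close>
lemma one_minus_powr_le:
  fixes r \<alpha> :: real
  assumes "0 < r" "r < 1"
  shows "1 - r powr \<alpha> \<le> max 1 \<alpha> * (1 - r)"
proof (cases "\<alpha> \<le> 1")
  case True
  have "r powr 1 \<le> r powr \<alpha>" using assms True by (intro powr_mono') auto
  then show ?thesis using True assms by simp
next
  case False
  have "r * 1 \<le> r powr \<alpha> / \<alpha> + 1 powr (\<alpha> / (\<alpha> - 1)) / (\<alpha> / (\<alpha> - 1))"
    using False assms by (intro Youngs_inequality) (auto simp: field_simps)
  then have "\<alpha> * r \<le> \<alpha> * (r powr \<alpha> / \<alpha> + (\<alpha> - 1) / \<alpha>)"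
    using False by (intro mult_left_mono) auto
  also have "\<dots> = r powr \<alpha> + (\<alpha> - 1)"
    using False by (simp add: distrib_left)
  finally have "\<alpha> * r \<le> r powr \<alpha> + (\<alpha> - 1)" .
  then show ?thesis using False by (simp add: max_def algebra_simps)
qed

lemma nn_integral_norm_powr_finite:
  assumes "\<beta> > 0" "R \<ge> 0"
  shows "(\<integral>\<^sup>+x. indicator {..R} (norm x) * ennreal (norm (x::'a::euclidean_space) powr (\<beta> - real DIM('a))) \<partial>lborel) < \<infinity>"
proof -
  let ?N = "DIM('a)" and ?S = "unit_sphere_area DIM('a)"
  have N: "?N \<ge> 1" by (simp add: Suc_leI)
  have S: "?S \<ge> 0" by (simp add: unit_sphere_area_def)
  have "(\<integral>\<^sup>+x. indicator {..R} (norm x) * ennreal (norm (x::'a) powr (\<beta> - real ?N)) \<partial>lborel)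
    = (\<integral>\<^sup>+r. ennreal (?S * r ^ (?N - 1)) * indicator {0..} r * (indicator {..R} r * ennreal (r powr (\<beta> - real ?N))) \<partial>lborel)"
    by (rule nn_integral_radial[where g = "\<lambda>r. indicator {..R} r * ennreal (r powr (\<beta> - real ?N))"]) measurable
  also have "\<dots> = (\<integral>\<^sup>+r. ennreal ?S * (ennreal (r powr (\<beta> - 1)) * indicator {0..R} r) \<partial>lborel)"
  proof (rule nn_integral_cong)
    fix r :: real
    show "ennreal (?S * r ^ (?N - 1)) * indicator {0..} r * (indicator {..R} r * ennreal (r powr (\<beta> - real ?N)))
      = ennreal ?S * (ennreal (r powr (\<beta> - 1)) * indicator {0..R} r)"
    proof (cases "0 < r \<and> r \<le> R")
      case True
      then have r: "r > 0" by simp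
      have "r ^ (?N - 1) * r powr (\<beta> - real ?N) = r powr (real (?N - 1)) * r powr (\<beta> - real ?N)"
        by (simp only: powr_realpow[OF r])
      also have "\<dots> = r powr (\<beta> - 1)" using N by (simp add: of_nat_diff flip: powr_add)
      finally have "?S * r ^ (?N - 1) * r powr (\<beta> - real ?N) = ?S * r powr (\<beta> - 1)" by (simp add: mult.assoc)
      then show ?thesis using True S by (simp add: ennreal_mult[symmetric])
    next
      case False
      then show ?thesis by (cases "r = 0") (auto simp: indicator_def)
    qed
  qed
  also have "\<dots> = ennreal ?S * (\<integral>\<^sup>+r. ennreal (r powr (\<beta> - 1)) * indicator {0..R} r \<partial>lborel)"
    by (rule nn_integral_cmult) measurable
  also have "\<dots> < \<infinity>"
    using nn_integral_powr_finite[OF assms] by (simp add: ennreal_mult_less_top)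
  finally show ?thesis .
qed

text \<open>The angular kernel is singular at \<open>r = 1\<close>, but the zero of \<open>(1 - r\<^bsup>\<alpha>\<^esup>)\<^sup>p\<close> compensates it.  This
  is seen best after unfolding the polar coordinates: with \<open>d = |e - y| \<ge> 1 - |y|\<close> the integrand is at
  most a constant times \<open>|y|\<^bsup>ps-N\<^esup> d\<^bsup>p-ps-N\<^esup>\<close>, and both singularities are integrable.\<close>
lemma frac_hardy_integral_finite:
  assumes s: "0 < s" "s < 1" and p: "1 < p" "p < real DIM('a::euclidean_space)" and N: "2 \<le> DIM('a)"
  shows "(\<integral>\<^sup>+r. indicator {0<..<1} r * (ennreal (r powr (p * s - 1) *
      (1 - r powr ((real DIM('a) - p * s) / p)) powr p) * Psi_nn DIM('a) (real DIM('a) + p * s) r) \<partial>lborel) < \<infinity>"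
    (is "?D < \<infinity>")
proof -
  let ?N = "DIM('a)"
  define q where "q = real ?N + p * s"
  define \<alpha> where "\<alpha> = (real ?N - p * s) / p"
  define F where "F r = ennreal (indicator {..<1} r * (r powr (p * s - real ?N) * (1 - r powr \<alpha>) powr p))" for r
  define C where "C = max 1 \<alpha>"
  define c1 where "c1 = C powr p * (1 / 2) powr (p - q)"
  define c2 where "c2 = C powr p * (1 / 2) powr (p * s - real ?N)"
  have ps: "0 < p * s" "p * s < p" "p * s < real ?N" using s p by (auto intro: order.strict_trans[of _ p])
  have pq: "p - q < 0" "p - q = (p - p * s) - real ?N" using ps p by (auto simp: q_def)
  have \<alpha>: "\<alpha> > 0" using ps p by (simp add: \<alpha>_def)
  have C: "C \<ge> 1" by (simp add: C_def)
  obtain e :: 'a where "e \<in> Basis" using nonempty_Basis by blast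
  then have e: "norm e = 1" by simp
  have [measurable]: "F \<in> borel_measurable borel" unfolding F_def by measurable
  \<comment> \<open>The factor \<open>r\<^bsup>ps-N\<^esup>\<close> in \<open>F\<close> absorbs the Jacobian
    \<open>r\<^bsup>N-1\<^esup>\<close> of the polar coordinates.\<close>
  have "?D = (\<integral>\<^sup>+r. indicator {0<..} r * (F r * ennreal (r ^ (?N - 1)) * Psi_nn ?N q r) \<partial>lborel)"
    unfolding q_def[symmetric] \<alpha>_def[symmetric]
  proof (rule nn_integral_cong)
    fix r :: real
    show "indicator {0<..<1} r * (ennreal (r powr (p * s - 1) * (1 - r powr \<alpha>) powr p) * Psi_nn ?N q r) =
      indicator {0<..} r * (F r * ennreal (r ^ (?N - 1)) * Psi_nn ?N q r)"
    proof (cases "0 < r \<and> r < 1")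
      case True
      then have r: "r > 0" by simp
      have "r powr (p * s - real ?N) * r ^ (?N - 1) = r powr (p * s - real ?N) * r powr (real (?N - 1))"
        by (simp only: powr_realpow[OF r])
      also have "\<dots> = r powr (p * s - 1)" using N by (simp add: of_nat_diff flip: powr_add)
      finally have "r powr (p * s - 1) * (1 - r powr \<alpha>) powr p = (r powr (p * s - real ?N) * (1 - r powr \<alpha>) powr p) * r ^ (?N - 1)"
        by (simp add: mult_ac)
      then have eq: "ennreal (r powr (p * s - 1) * (1 - r powr \<alpha>) powr p) =
        ennreal (r powr (p * s - real ?N) * (1 - r powr \<alpha>) powr p) * ennreal (r ^ (?N - 1))"
        using r by (simp only: ennreal_mult''[symmetric] zero_le_power less_imp_le)
      have F: "F r = ennreal (r powr (p * s - real ?N) * (1 - r powr \<alpha>) powr p)"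
        using True by (simp add: F_def)
      show ?thesis unfolding eq F using True by simp
    qed (auto simp: F_def indicator_def)
  qed
  also have "\<dots> = (\<integral>\<^sup>+y. F (norm y) * ennreal (1 / norm (e - y) powr q) \<partial>lborel)"
    by (rule nn_integral_radial_kernel[OF _ e N, symmetric]) measurable
  also have "\<dots> \<le> (\<integral>\<^sup>+y. ennreal c1 * (indicator {..1} (norm y) * ennreal (norm y powr (p * s - real ?N)))
      + ennreal c2 * (indicator {..2} (norm (e - y)) * ennreal (norm (e - y) powr (p - q))) \<partial>lborel)"
  proof (rule nn_integral_mono)
    fix y :: 'a
    show "F (norm y) * ennreal (1 / norm (e - y) powr q) \<le>
      ennreal c1 * (indicator {..1} (norm y) * ennreal (norm y powr (p * s - real ?N)))
      + ennreal c2 * (indicator {..2} (norm (e - y)) * ennreal (norm (e - y) powr (p - q)))"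
    proof (cases "0 < norm y \<and> norm y < 1 \<and> e \<noteq> y")
      case True
      define r where "r = norm y"
      define d where "d = norm (e - y)"
      have r: "0 < r" "r < 1" and d: "0 < d" using True by (auto simp: r_def d_def)
      have d1: "1 - r \<le> d" "d \<le> 2"
        using norm_triangle_ineq2[of e y] norm_triangle_ineq4[of e y] e r by (auto simp: r_def d_def)
      have "r powr \<alpha> \<le> 1" using r \<alpha> by (intro powr_le1) auto
      moreover have "1 - r powr \<alpha> \<le> C * d"
        using one_minus_powr_le[OF r, of \<alpha>, folded C_def] mult_left_mono[OF d1(1), of C] C by linarith
      ultimately have "(1 - r powr \<alpha>) powr p \<le> (C * d) powr p" using p by (intro powr_mono2) auto
      also have "\<dots> = C powr p * d powr p" using C d by (simp add: powr_mult)
      finally have "r powr (p * s - real ?N) * (1 - r powr \<alpha>) powr p * (1 / d powr q) \<le>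
          r powr (p * s - real ?N) * (C powr p * d powr p) * (1 / d powr q)"
        by (intro mult_right_mono mult_left_mono) auto
      also have "\<dots> = C powr p * (r powr (p * s - real ?N) * d powr (p - q))"
        by (simp add: powr_diff)
      also have "\<dots> \<le> c1 * r powr (p * s - real ?N) + c2 * d powr (p - q)"
      \<comment> \<open>At most one of the two singularities is near: \<open>d \<ge> 1/2\<close> in the first case, \<open>r \<ge>
        1/2\<close> in the second.\<close>
      proof (cases "r \<le> 1 / 2")
        case True
        have "d powr (p - q) \<le> (1 / 2) powr (p - q)"
          using True d1 pq by (intro powr_mono2') auto
        then have "C powr p * (r powr (p * s - real ?N) * d powr (p - q)) \<le> C powr p * (r powr (p * s - real ?N) * (1 / 2) powr (p - q))"
          by (intro mult_left_mono) auto
        also have "\<dots> = c1 * r powr (p * s - real ?N)" by (simp add: c1_def)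
        finally show ?thesis by (simp add: c2_def add_increasing2)
      next
        case False
        have "r powr (p * s - real ?N) \<le> (1 / 2) powr (p * s - real ?N)"
          using False ps by (intro powr_mono2') auto
        then have "C powr p * (r powr (p * s - real ?N) * d powr (p - q)) \<le> C powr p * ((1 / 2) powr (p * s - real ?N) * d powr (p - q))"
          by (intro mult_left_mono mult_right_mono) auto
        also have "\<dots> = c2 * d powr (p - q)" by (simp add: c2_def)
        finally show ?thesis by (simp add: c1_def add_increasing)
      qed
      finally have "ennreal (r powr (p * s - real ?N) * (1 - r powr \<alpha>) powr p * (1 / d powr q)) \<le>
        ennreal (c1 * r powr (p * s - real ?N) + c2 * d powr (p - q))"
        by (rule ennreal_leI)
      also have "\<dots> = ennreal c1 * ennreal (r powr (p * s - real ?N)) + ennreal c2 * ennreal (d powr (p - q))"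
        by (simp add: c1_def c2_def ennreal_mult[symmetric] ennreal_plus[symmetric] del: ennreal_plus)
      finally show ?thesis
        using r d1 by (simp add: F_def r_def[symmetric] d_def[symmetric] ennreal_mult[symmetric])
    next
      case False
      then have "F (norm y) * ennreal (1 / norm (e - y) powr q) = 0"
        by (cases "y = 0"; cases "e = y") (auto simp: F_def)
      then show ?thesis by (simp only: zero_le)
    qed
  qed
  also have "\<dots> = ennreal c1 * (\<integral>\<^sup>+y. indicator {..1} (norm y) * ennreal (norm (y::'a) powr (p * s - real ?N)) \<partial>lborel) +
      ennreal c2 * (\<integral>\<^sup>+y. indicator {..2} (norm (e - y)) * ennreal (norm (e - y) powr (p - q)) \<partial>lborel)"
    by (simp add: nn_integral_add nn_integral_cmult)
  also have "(\<integral>\<^sup>+y. indicator {..2} (norm (e - y)) * ennreal (norm (e - y) powr (p - q)) \<partial>lborel)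
    = (\<integral>\<^sup>+y. indicator {..2} (norm y) * ennreal (norm (y::'a) powr (p - q)) \<partial>lborel)"
    using nn_integral_lborel_translation[of "\<lambda>y::'a. indicator {..2} (norm y) * ennreal (norm y powr (p - q))" "- e"]
    by (simp add: norm_minus_commute)
  finally show ?thesis
    using nn_integral_norm_powr_finite[of "p * s" 1, where 'a = 'a] ps
      nn_integral_norm_powr_finite[of "p - p * s" 2, where 'a = 'a] pq(2)
    by (auto simp: ennreal_mult_less_top elim!: order.strict_trans1)
qed

text \<open>
  The constant is defined by a Lebesgue integral, whose value is 0 for integrands that are not
  integrable.  Finiteness of the extended integral makes it the true value, and positivity
  makes its reciprocal meaningful.\<close>
lemma
  assumes s: "0 < s" "s < 1" and p: "1 < p" "p < real DIM('a::euclidean_space)" and N: "2 \<le> DIM('a)"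
  defines "D \<equiv> \<integral>\<^sup>+r. indicator {0<..<1} r * (ennreal (r powr (p * s - 1) *
      (1 - r powr ((real DIM('a) - p * s) / p)) powr p) * Psi_nn DIM('a) (real DIM('a) + p * s) r) \<partial>lborel"
  shows ennreal_frac_hardy_const: "ennreal (frac_hardy_const DIM('a) p s) = 2 * D"
    and frac_hardy_const_pos: "frac_hardy_const DIM('a) p s > 0"
proof -
  let ?N = "DIM('a)"
  define \<alpha> where "\<alpha> = (real ?N - p * s) / p"
  have ps: "0 < p * s" "p * s < real ?N" using s p by (auto intro: order.strict_trans[of _ p])
  have \<alpha>: "\<alpha> > 0" using ps p by (simp add: \<alpha>_def)
  have Dfin: "D < \<infinity>" unfolding D_def by (rule frac_hardy_integral_finite[OF s p N])
  define f where "f r = indicator {0..1} r * (r powr (p * s - 1) * \<bar>1 - r powr \<alpha>\<bar> powr p * Psi ?N s p r)" for r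
  have [measurable]: "Psi ?N s p \<in> borel_measurable borel"
    unfolding Psi_def set_lebesgue_integral_def by measurable
  have [measurable]: "f \<in> borel_measurable borel" unfolding f_def by measurable
  have Psi0: "Psi ?N s p r \<ge> 0" for r
    unfolding Psi_def set_lebesgue_integral_def
    by (intro mult_nonneg_nonneg integral_nonneg_AE) (auto simp: unit_sphere_area_def)
  have lt1: "r powr \<alpha> < 1" if "0 < r" "r < 1" for r
    using that \<alpha> powr_less_mono2[of \<alpha> r 1] by auto
  have "AE r in lborel. (r::real) \<notin> {0, 1}" by (intro AE_not_in countable_imp_null_set_lborel) simp
  then have "(\<integral>\<^sup>+r. ennreal (f r) \<partial>lborel) = D"
    unfolding D_def
  proof (intro nn_integral_cong_AE, eventually_elim)
    case (elim r)
    show ?case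
    proof (cases "0 < r \<and> r < 1")
      case True
      then have "Psi_nn ?N (real ?N + p * s) r = ennreal (Psi ?N s p r)"
        using ps by (intro Psi_eq_Psi_nn[symmetric] N) auto
      then show ?thesis using True lt1[of r]
        by (simp add: f_def \<alpha>_def ennreal_mult[symmetric] Psi0)
    qed (use elim in \<open>auto simp: f_def\<close>)
  qed
  moreover have "integral\<^sup>L lborel f = enn2real (\<integral>\<^sup>+r. ennreal (f r) \<partial>lborel)"
    by (rule integral_eq_nn_integral) (auto simp: f_def Psi0)
  moreover have "frac_hardy_const ?N p s = 2 * integral\<^sup>L lborel f"
    by (simp add: frac_hardy_const_def set_lebesgue_integral_def f_def[abs_def] \<alpha>_def)
  ultimately have c: "frac_hardy_const ?N p s = 2 * enn2real D" by simp
  then show eq: "ennreal (frac_hardy_const ?N p s) = 2 * D"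
    using Dfin by (simp add: ennreal_mult')
  have "D \<noteq> 0"
    unfolding D_def
  proof (rule nn_integral_interval_pos)
    fix r :: real assume r: "0 < r" "r < 1"
    have "Psi_nn ?N (real ?N + p * s) r \<noteq> 0"
      unfolding Psi_nn_def
    proof (rule nn_integral_interval_pos)
      fix t :: real assume t: "- 1 < t" "t < 1"
      have "0 < (1 - r)\<^sup>2" using r by simp
      also have "\<dots> \<le> 1 - 2 * r * t + r\<^sup>2" using r t by (intro one_minus_sq_le_kernel) auto
      finally have "0 < 1 - 2 * r * t + r\<^sup>2" .
      moreover have "t\<^sup>2 < 1" using t by (simp add: abs_square_less_1 abs_less_iff)
      moreover have "unit_sphere_area (?N - 1) > 0"
        using N by (auto simp: unit_sphere_area_def intro!: mult_pos_pos)
      ultimately show "ennreal (sphere_weight ?N t / (1 - 2 * r * t + r\<^sup>2) powr ((real ?N + p * s) / 2)) \<noteq> 0"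
        by (auto simp: sphere_weight_def ennreal_eq_0_iff not_le intro!: mult_pos_pos divide_pos_pos)
    qed auto
    then show "ennreal (r powr (p * s - 1) * (1 - r powr ((real ?N - p * s) / p)) powr p) *
      Psi_nn ?N (real ?N + p * s) r \<noteq> 0"
      using r lt1[OF r] by (auto simp: \<alpha>_def ennreal_eq_0_iff not_le intro!: mult_pos_pos)
  qed auto
  then show "frac_hardy_const ?N p s > 0"
    using c Dfin by (auto simp: enn2real_positive_iff zero_less_iff_neq_zero)
qed

section \<open>The fractional Hardy inequality\<close>

text \<open>Convexity of the \<open>p\<close>-th power at \<open>a + b = (1 - t) (a / (1 - t)) + t (b / t)\<close>.  Equality holds for
  \<open>b / t = a / (1 - t)\<close>, which is why no constant is lost when \<open>t\<close> is chosen well.\<close>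
lemma powr_add_le_weighted:
  fixes a b p t :: real
  assumes "1 \<le> p" "0 < t" "t < 1" "0 \<le> a" "0 \<le> b"
  shows "(a + b) powr p \<le> (1 - t) powr (1 - p) * a powr p + t powr (1 - p) * b powr p"
proof (cases "a = 0 \<or> b = 0")
  case True
  have "1 \<le> x powr (1 - p)" if "0 < x" "x < 1" for x
    using that assms ge_one_powr_ge_zero[of "1/x" "p - 1"] by (simp add: powr_divide powr_diff)
  then have "1 * a powr p \<le> (1 - t) powr (1 - p) * a powr p" "1 * b powr p \<le> t powr (1 - p) * b powr p"
    using assms by (intro mult_right_mono; simp)+
  then show ?thesis using True by auto
next
  case False
  have "((1 - t) *\<^sub>R (a / (1 - t)) + t *\<^sub>R (b / t)) powr p
      \<le> (1 - t) * (a / (1 - t)) powr p + t * (b / t) powr p"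
    using assms False by (intro convex_onD[OF powr_convex]) auto
  moreover have "(1 - t) * (a / (1 - t)) powr p = (1 - t) powr (1 - p) * a powr p"
    using assms by (simp add: powr_divide powr_diff)
  moreover have "t * (b / t) powr p = t powr (1 - p) * b powr p"
    using assms by (simp add: powr_divide powr_diff)
  ultimately show ?thesis using assms by simp
qed

text \<open>Convexity applied to \<open>b = (b - a) + a\<close>.  There is equality for \<open>a = t b\<close>, which is the relation
  between the values of the ground state at \<open>x\<close> and \<open>y\<close>.\<close>
lemma powr_diff_ge_weighted:
  fixes a b p t :: real
  assumes "1 \<le> p" "0 < t" "t < 1"
  shows "(1 - t) powr (p - 1) * \<bar>b\<bar> powr p \<le> \<bar>a - b\<bar> powr p + (1 - t) powr (p - 1) * t powr (1 - p) * \<bar>a\<bar> powr p"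
proof -
  have "\<bar>b\<bar> powr p \<le> (\<bar>a - b\<bar> + \<bar>a\<bar>) powr p"
    using assms by (intro powr_mono2) auto
  also have "\<dots> \<le> (1 - t) powr (1 - p) * \<bar>a - b\<bar> powr p + t powr (1 - p) * \<bar>a\<bar> powr p"
    using assms by (intro powr_add_le_weighted) auto
  finally have "(1 - t) powr (p - 1) * \<bar>b\<bar> powr p \<le> (1 - t) powr (p - 1) *
    ((1 - t) powr (1 - p) * \<bar>a - b\<bar> powr p + t powr (1 - p) * \<bar>a\<bar> powr p)"
    by (intro mult_left_mono) auto
  also have "\<dots> = ((1 - t) powr (p - 1) * (1 - t) powr (1 - p)) * \<bar>a - b\<bar> powr p + (1 - t) powr (p - 1) * t powr (1 - p) * \<bar>a\<bar> powr p"
    by (simp add: algebra_simps)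
  also have "(1 - t) powr (p - 1) * (1 - t) powr (1 - p) = 1"
    using assms by (simp flip: powr_add)
  finally show ?thesis by simp
qed

text \<open>The inequality with the radial integral cut off at \<open>\<kappa> < 1\<close>.  The factor 2 arises since the argument
  uses only the half \<open>|y| < |x|\<close> of the symmetric double integral.\<close>
lemma fractional_hardy_truncated:
  fixes v :: "'a::euclidean_space \<Rightarrow> real"
  assumes [measurable]: "v \<in> borel_measurable borel"
    and s: "0 < s" and p: "1 < p" and ps: "p * s < real DIM('a)" and N: "2 \<le> DIM('a)"
    and \<kappa>: "0 < \<kappa>" "\<kappa> < 1"
    and fin: "(\<integral>\<^sup>+x. ennreal (\<bar>v x\<bar> powr p * norm x powr (- (p * s))) \<partial>lborel) < \<infinity>"
  defines "q \<equiv> real DIM('a) + p * s" and "\<alpha> \<equiv> (real DIM('a) - p * s) / p"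
  shows "2 * (\<integral>\<^sup>+r. indicator {0<..<\<kappa>} r * (ennreal (r powr (p * s - 1) * (1 - r powr \<alpha>) powr p) * Psi_nn DIM('a) q r) \<partial>lborel)
      * (\<integral>\<^sup>+x. ennreal (\<bar>v x\<bar> powr p * norm x powr (- (p * s))) \<partial>lborel)
    \<le> (\<integral>\<^sup>+x. (\<integral>\<^sup>+y. ennreal (\<bar>v x - v y\<bar> powr p / norm (x - y) powr q) \<partial>lborel) \<partial>lborel)"
    (is "2 * ?T * ?H \<le> ?J")
proof -
  let ?N = "DIM('a)"
  have \<alpha>: "\<alpha> > 0" and \<alpha>p: "\<alpha> * p = real ?N - p * s" using ps p by (auto simp: \<alpha>_def)
  \<comment> \<open>\<open>GA\<close> and \<open>GB\<close> are the two coefficients of the pointwise inequality as functions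
    of \<open>r = |y| / |x|\<close>.\<close>
  define GA where "GA r = indicator {0<..<\<kappa>} r * ennreal ((1 - r powr \<alpha>) powr (p - 1))" for r
  define GB where "GB r = GA r * ennreal (r powr (\<alpha> * (1 - p)))" for r
  define K where "K x y = ennreal (1 / norm (x - y) powr q)" for x y :: 'a
  define W where "W x = ennreal (\<bar>v x\<bar> powr p)" for x
  define E where "E x y = ennreal (\<bar>v x - v y\<bar> powr p / norm (x - y) powr q)" for x y
  have [measurable]: "GA \<in> borel_measurable borel" unfolding GA_def by measurable
  have [measurable]: "GB \<in> borel_measurable borel" unfolding GB_def by measurable
  have [measurable]: "W \<in> borel_measurable borel" unfolding W_def by measurable
  have [measurable]: "(\<lambda>x. K (f x) (g x)) \<in> borel_measurable M"
    if [measurable]: "f \<in> borel_measurable M" "g \<in> borel_measurable M" for f g and M :: "'z measure"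
    unfolding K_def by measurable
  have [measurable]: "(\<lambda>x. E (f x) (g x)) \<in> borel_measurable M"
    if [measurable]: "f \<in> borel_measurable M" "g \<in> borel_measurable M" for f g and M :: "'z measure"
    unfolding E_def by measurable
  have K_commute: "K x y = K y x" for x y by (simp add: K_def norm_minus_commute)
  have E_commute: "E x y = E y x" for x y by (simp add: E_def norm_minus_commute abs_minus_commute)
  have G0: "GA r = 0" "GB r = 0" if "\<not> (0 < r \<and> r < 1)" for r
    using that \<kappa> by (auto simp: GA_def GB_def)
  define A where "A = (\<integral>\<^sup>+r. indicator {0<..<1} r * (GA r * ennreal (r powr (q - real ?N - 1)) * Psi_nn ?N q r) \<partial>lborel)"
  define B where "B = (\<integral>\<^sup>+r. indicator {0<..} r * (GB r * ennreal (r ^ (?N - 1)) * Psi_nn ?N q r) \<partial>lborel)"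
  define I where "I = (\<integral>\<^sup>+x. (\<integral>\<^sup>+y. indicator {z. norm (snd z) < norm (fst z)} (x, y) * E x y \<partial>lborel) \<partial>lborel)"
  have powr_mono_1: "r powr \<alpha> < 1" "0 < r powr \<alpha>" if "0 < r" "r < 1" for r
    using that \<alpha> powr_less_mono2[of \<alpha> r 1] by auto
  have ae0: "AE x in lborel. (x::'a) \<noteq> 0" by (rule AE_lborel_singleton)

  have pointwise: "GA (norm y / norm x) * W y * K x y \<le>
      indicator {z. norm (snd z) < norm (fst z)} (x, y) * E x y + GB (norm y / norm x) * W x * K x y" for x y
  proof (cases "0 < norm y / norm x \<and> norm y / norm x < \<kappa>")
    case True
    define t where "t = (norm y / norm x) powr \<alpha>"
    have x0: "norm x > 0" using True by (auto simp: zero_less_divide_iff)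
    have lt1: "norm y / norm x < 1" using True \<kappa> by simp
    then have lt: "norm y < norm x" using x0 by (simp add: divide_simps)
    have t: "0 < t" "t < 1" using powr_mono_1[of "norm y / norm x"] True lt1 by (auto simp: t_def)
    have GA: "GA (norm y / norm x) = ennreal ((1 - t) powr (p - 1))"
      using True by (simp add: GA_def t_def)
    have GB: "GB (norm y / norm x) = ennreal ((1 - t) powr (p - 1) * t powr (1 - p))"
      by (simp add: GB_def GA ennreal_mult t_def powr_powr)
    define k where "k = 1 / norm (x - y) powr q"
    have k: "k \<ge> 0" by (simp add: k_def)
    have "(1 - t) powr (p - 1) * \<bar>v y\<bar> powr p * k \<le>
        (\<bar>v x - v y\<bar> powr p + (1 - t) powr (p - 1) * t powr (1 - p) * \<bar>v x\<bar> powr p) * k"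
      using p t k by (intro mult_right_mono powr_diff_ge_weighted) auto
    also have "\<dots> = \<bar>v x - v y\<bar> powr p / norm (x - y) powr q + (1 - t) powr (p - 1) * t powr (1 - p) * \<bar>v x\<bar> powr p * k"
      by (simp add: k_def algebra_simps)
    finally show ?thesis
      using k lt by (simp add: GA GB W_def K_def E_def k_def[symmetric] ennreal_mult[symmetric] ennreal_plus[symmetric]
          ennreal_leI del: ennreal_plus)
  next
    case False
    then have "GA (norm y / norm x) = 0" by (auto simp: GA_def)
    then show ?thesis by simp
  qed

  have "(\<integral>\<^sup>+x. (\<integral>\<^sup>+y. GA (norm y / norm x) * W y * K x y \<partial>lborel) \<partial>lborel) \<le>
     (\<integral>\<^sup>+x. (\<integral>\<^sup>+y. indicator {z. norm (snd z) < norm (fst z)} (x, y) * E x y + GB (norm y / norm x) * W x * K x y \<partial>lborel) \<partial>lborel)"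
    by (intro nn_integral_mono pointwise)
  also have "\<dots> = I + (\<integral>\<^sup>+x. (\<integral>\<^sup>+y. GB (norm y / norm x) * W x * K x y \<partial>lborel) \<partial>lborel)"
    unfolding I_def by (simp add: nn_integral_add)
  finally have sum: "(\<integral>\<^sup>+x. (\<integral>\<^sup>+y. GA (norm y / norm x) * W y * K x y \<partial>lborel) \<partial>lborel) \<le>
    I + (\<integral>\<^sup>+x. (\<integral>\<^sup>+y. GB (norm y / norm x) * W x * K x y \<partial>lborel) \<partial>lborel)" .

  have H: "?H = (\<integral>\<^sup>+x. W x * ennreal (norm x powr (real ?N - q)) \<partial>lborel)"
    by (simp add: W_def q_def ennreal_mult)

  have "(\<integral>\<^sup>+x. (\<integral>\<^sup>+y. GA (norm y / norm x) * W y * K x y \<partial>lborel) \<partial>lborel)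
    = (\<integral>\<^sup>+y. (\<integral>\<^sup>+x. W y * (GA (norm y / norm x) * K x y) \<partial>lborel) \<partial>lborel)"
    by (subst lborel_pair.Fubini') (simp_all add: mult_ac)
  also have "\<dots> = (\<integral>\<^sup>+y. W y * ennreal (norm y powr (real ?N - q)) * A \<partial>lborel)"
    using ae0
  proof (intro nn_integral_cong_AE, eventually_elim)
    case (elim y)
    then show ?case
      using nn_integral_scaled_kernel_inverse[of GA y q, OF _ _ N G0(1)]
      by (simp add: nn_integral_cmult A_def K_def mult.assoc)
  qed
  also have "\<dots> = A * ?H"
    unfolding H by (subst nn_integral_multc) (auto simp: mult.commute)
  finally have lhs: "(\<integral>\<^sup>+x. (\<integral>\<^sup>+y. GA (norm y / norm x) * W y * K x y \<partial>lborel) \<partial>lborel) = A * ?H" .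

  have "(\<integral>\<^sup>+x. (\<integral>\<^sup>+y. GB (norm y / norm x) * W x * K x y \<partial>lborel) \<partial>lborel)
    = (\<integral>\<^sup>+x. (\<integral>\<^sup>+y. W x * (GB (norm y / norm x) * K x y) \<partial>lborel) \<partial>lborel)"
    by (simp add: mult_ac)
  also have "\<dots> = (\<integral>\<^sup>+x. W x * ennreal (norm x powr (real ?N - q)) * B \<partial>lborel)"
    using ae0
  proof (intro nn_integral_cong_AE, eventually_elim)
    case (elim x)
    then show ?case
      using nn_integral_scaled_kernel[of GB x q, OF _ _ N]
      by (simp add: nn_integral_cmult B_def K_def mult.assoc)
  qed
  also have "\<dots> = B * ?H"
    unfolding H by (subst nn_integral_multc) (auto simp: mult.commute)
  finally have rhs: "(\<integral>\<^sup>+x. (\<integral>\<^sup>+y. GB (norm y / norm x) * W x * K x y \<partial>lborel) \<partial>lborel) = B * ?H" .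

  \<comment> \<open>The regions \<open>|y| < |x|\<close> and \<open>|x| < |y|\<close> contribute equally to the double
    integral.\<close>
  have "I = (\<integral>\<^sup>+y. (\<integral>\<^sup>+x. indicator {z. norm (snd z) < norm (fst z)} (x, y) * E x y \<partial>lborel) \<partial>lborel)"
    unfolding I_def by (rule lborel_pair.Fubini') measurable
  then have "I + I = (\<integral>\<^sup>+x. (\<integral>\<^sup>+y. indicator {z. norm (snd z) < norm (fst z)} (x, y) * E x y
       + indicator {z. norm (snd z) < norm (fst z)} (y, x) * E x y \<partial>lborel) \<partial>lborel)"
    unfolding I_def by (simp add: nn_integral_add E_commute)
  also have "\<dots> \<le> (\<integral>\<^sup>+x. (\<integral>\<^sup>+y. E x y \<partial>lborel) \<partial>lborel)"
    by (intro nn_integral_mono) (auto simp: indicator_def)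
  finally have IJ: "I + I \<le> ?J" by (simp add: E_def)

  \<comment> \<open>With \<open>t = r\<^bsup>\<alpha>\<^esup>\<close>, the integrands of \<open>A\<close> and \<open>B\<close>
    are \<open>(1 - t)\<^bsup>p-1\<^esup>\<close> and \<open>(1 - t)\<^bsup>p-1\<^esup> t\<close> times the same factor; they
    differ by \<open>(1 - t)\<^sup>p\<close>.\<close>
  have AB: "A = ?T + B"
  proof -
    have "A = (\<integral>\<^sup>+r. indicator {0<..<\<kappa>} r * (ennreal (r powr (p * s - 1) * (1 - r powr \<alpha>) powr p) * Psi_nn ?N q r) +
        indicator {0<..} r * (GB r * ennreal (r ^ (?N - 1)) * Psi_nn ?N q r) \<partial>lborel)"
      unfolding A_def
    proof (rule nn_integral_cong)
      fix r :: real
      show "indicator {0<..<1} r * (GA r * ennreal (r powr (q - real ?N - 1)) * Psi_nn ?N q r) =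
         indicator {0<..<\<kappa>} r * (ennreal (r powr (p * s - 1) * (1 - r powr \<alpha>) powr p) * Psi_nn ?N q r) +
        indicator {0<..} r * (GB r * ennreal (r ^ (?N - 1)) * Psi_nn ?N q r)"
      proof (cases "0 < r \<and> r < \<kappa>")
        case True
        then have r: "0 < r" "r < 1" using \<kappa> by auto
        define t where "t = r powr \<alpha>"
        have t: "0 < t" "t < 1" using powr_mono_1[OF r] by (auto simp: t_def)
        have "r powr (\<alpha> * (1 - p)) * r ^ (?N - 1) = r powr (\<alpha> * (1 - p)) * r powr (real (?N - 1))"
          by (simp only: powr_realpow[OF r(1)])
        also have "\<dots> = r powr (\<alpha> + (p * s - 1))"
          using N \<alpha>p by (simp add: of_nat_diff right_diff_distrib flip: powr_add)
        also have "\<dots> = t * r powr (p * s - 1)" by (simp add: t_def powr_add)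
        finally have 1: "r powr (\<alpha> * (1 - p)) * r ^ (?N - 1) = t * r powr (p * s - 1)" .
        have "(1 - t) powr p = (1 - t) powr (p - 1) * (1 - t) powr 1"
          by (simp only: powr_add[symmetric]) simp
        then have 2: "(1 - t) powr p = (1 - t) powr (p - 1) * (1 - t)" using t by simp
        have "(1 - t) powr (p - 1) * r powr (p * s - 1) =
          r powr (p * s - 1) * (1 - t) powr p + (1 - t) powr (p - 1) * (r powr (\<alpha> * (1 - p)) * r ^ (?N - 1))"
          unfolding 1 2 by (simp add: algebra_simps)
        then have "ennreal ((1 - t) powr (p - 1)) * ennreal (r powr (p * s - 1)) =
          ennreal (r powr (p * s - 1) * (1 - t) powr p) +
          ennreal ((1 - t) powr (p - 1)) * ennreal (r powr (\<alpha> * (1 - p))) * ennreal (r ^ (?N - 1))"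
          using r by (simp add: ennreal_mult[symmetric] ennreal_plus[symmetric] mult.assoc del: ennreal_plus)
        then show ?thesis
          using True r by (simp add: GA_def GB_def t_def q_def distrib_right)
      next
        case False
        then have "GA r = 0" by (auto simp: GA_def)
        then show ?thesis using False by (auto simp: GB_def)
      qed
    qed
    also have "\<dots> = ?T + B" unfolding B_def by (rule nn_integral_add) measurable
    finally show ?thesis .
  qed

  have Bfin: "B < \<infinity>"
  proof -
    define C where "C = ennreal ((1 - \<kappa>) powr (- q)) *
      (\<integral>\<^sup>+t. indicator {-1<..<1} t * ennreal (sphere_weight ?N t) \<partial>lborel)"
    have C: "C < \<infinity>" unfolding C_def
      using nn_integral_sphere_weight_finite[OF N] by (simp add: ennreal_mult_less_top)
    have q0: "q \<ge> 0" using s p by (simp add: q_def)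
    have "B \<le> (\<integral>\<^sup>+r. (ennreal (r powr ((\<alpha> + p * s) - 1)) * indicator {0..1} r) * C \<partial>lborel)"
      unfolding B_def
    proof (rule nn_integral_mono)
      fix r :: real
      show "indicator {0<..} r * (GB r * ennreal (r ^ (?N - 1)) * Psi_nn ?N q r)
        \<le> (ennreal (r powr ((\<alpha> + p * s) - 1)) * indicator {0..1} r) * C"
      proof (cases "0 < r \<and> r < \<kappa>")
        case True
        then have r: "0 < r" "r < 1" using \<kappa> by auto
        have "r powr (\<alpha> * (1 - p)) * r ^ (?N - 1) = r powr (\<alpha> * (1 - p)) * r powr (real (?N - 1))"
          by (simp only: powr_realpow[OF r(1)])
        also have "\<dots> = r powr ((\<alpha> + p * s) - 1)"
          using N \<alpha>p by (simp add: of_nat_diff right_diff_distrib add_diff_eq flip: powr_add)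
        finally have 1: "r powr (\<alpha> * (1 - p)) * r ^ (?N - 1) = r powr ((\<alpha> + p * s) - 1)" .
        have 2: "(1 - r powr \<alpha>) powr (p - 1) \<le> 1"
          using powr_mono_1[OF r] p by (intro powr_le1) auto
        have "GB r * ennreal (r ^ (?N - 1)) = ennreal ((1 - r powr \<alpha>) powr (p - 1)) * ennreal (r powr ((\<alpha> + p * s) - 1))"
          unfolding 1[symmetric] using True r by (simp add: GB_def GA_def ennreal_mult mult.assoc)
        also have "\<dots> \<le> 1 * ennreal (r powr ((\<alpha> + p * s) - 1))"
          using 2 by (intro mult_right_mono) (auto simp: ennreal_le_1)
        finally have 3: "GB r * ennreal (r ^ (?N - 1)) \<le> ennreal (r powr ((\<alpha> + p * s) - 1))" by simp
        have "Psi_nn ?N q r \<le> C"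
          unfolding C_def using True \<kappa> q0 by (intro Psi_nn_le) auto
        then have "GB r * ennreal (r ^ (?N - 1)) * Psi_nn ?N q r \<le> ennreal (r powr ((\<alpha> + p * s) - 1)) * C"
          by (intro mult_mono 3) auto
        then show ?thesis using True r by simp
      next
        case False
        then have "GA r = 0" by (auto simp: GA_def)
        then show ?thesis by (auto simp: GB_def)
      qed
    qed
    also have "\<dots> = (\<integral>\<^sup>+r. ennreal (r powr ((\<alpha> + p * s) - 1)) * indicator {0..1} r \<partial>lborel) * C"
      by (rule nn_integral_multc) measurable
    also have "\<dots> < \<infinity>"
      using C nn_integral_powr_finite[of "\<alpha> + p * s" 1] \<alpha> s p
      by (simp add: ennreal_mult_less_top add_pos_pos mult_pos_pos)
    finally show ?thesis .
  qed

  have "A * ?H \<le> I + B * ?H" using sum unfolding lhs rhs .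
  then have le: "?T * ?H + B * ?H \<le> I + B * ?H" unfolding AB by (simp add: distrib_right)
  have "B * ?H \<noteq> \<infinity>" using Bfin fin by (simp add: ennreal_mult_eq_top_iff less_top)
  then have "?T * ?H \<le> I"
    using le by (simp add: add.commute[of _ "B * ?H"] ennreal_add_left_cancel_le)
  then have "?T * ?H + ?T * ?H \<le> I + I" by (intro add_mono)
  also note IJ
  finally show ?thesis by (simp add: mult_2 distrib_right mult.assoc)
qed

text \<open>Monotone convergence as \<open>\<kappa> \<rightarrow> 1\<close> in the truncated inequality.\<close>
theorem fractional_hardy:
  fixes v :: "'a::euclidean_space \<Rightarrow> real"
  assumes [measurable]: "v \<in> borel_measurable borel"
    and s: "0 < s" "s < 1" and p: "1 < p" "p < real DIM('a)"
    and fin: "(\<integral>\<^sup>+x. ennreal (\<bar>v x\<bar> powr p * norm x powr (- (p * s))) \<partial>lborel) < \<infinity>"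
  shows "(\<integral>\<^sup>+x. ennreal (\<bar>v x\<bar> powr p * norm x powr (- (p * s))) \<partial>lborel)
    \<le> ennreal (1 / frac_hardy_const DIM('a) p s) *
      (\<integral>\<^sup>+x. (\<integral>\<^sup>+y. ennreal (\<bar>v x - v y\<bar> powr p / norm (x - y) powr (real DIM('a) + p * s)) \<partial>lborel) \<partial>lborel)"
    (is "?H \<le> _ * ?J")
proof -
  let ?N = "DIM('a)" and ?C = "frac_hardy_const DIM('a) p s"
  define f where "f r = ennreal (r powr (p * s - 1) *
      (1 - r powr ((real ?N - p * s) / p)) powr p) * Psi_nn ?N (real ?N + p * s) r" for r
  have [measurable]: "f \<in> borel_measurable borel" unfolding f_def by measurable
  have N: "2 \<le> ?N" using p by linarith
  have ps: "p * s < real ?N" using s p by (auto intro: order.strict_trans[of _ p])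
  define \<kappa> where "\<kappa> n = 1 - inverse (real (n + 2))" for n
  have \<kappa>: "0 < \<kappa> n" "\<kappa> n < 1" for n by (auto simp: \<kappa>_def field_simps)
  have \<kappa>_mono: "\<kappa> m \<le> \<kappa> n" if "m \<le> n" for m n
    using that by (auto simp: \<kappa>_def intro!: le_imp_inverse_le)
  have \<kappa>_ex: "\<exists>n. r < \<kappa> n" if "r < 1" for r
  proof -
    obtain n where "inverse (real (Suc n)) < 1 - r" using reals_Archimedean[of "1 - r"] \<open>r < 1\<close> by auto
    moreover have "inverse (real (n + 2)) \<le> inverse (real (Suc n))" by (intro le_imp_inverse_le) auto
    ultimately have "r < \<kappa> n" unfolding \<kappa>_def by linarith
    then show ?thesis by blast
  qed
  have SUP_ind: "(SUP n. indicator {0<..<\<kappa> n} r * f r) = indicator {0<..<1} r * f r" for r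
  proof (cases "0 < r \<and> r < 1")
    case True
    then obtain n where "r < \<kappa> n" using \<kappa>_ex by auto
    then show ?thesis using True by (intro antisym SUP_least) (auto simp: indicator_def intro!: SUP_upper2[of n])
  next
    case False
    then have "indicator {0<..<\<kappa> n} r = (0::ennreal)" for n using \<kappa>[of n] by (auto simp: indicator_def)
    then show ?thesis using False by auto
  qed
  have "2 * (\<integral>\<^sup>+r. indicator {0<..<\<kappa> n} r * f r \<partial>lborel) * ?H \<le> ?J" for n
    unfolding f_def by (rule fractional_hardy_truncated[OF assms(1) s(1) p(1) ps N \<kappa> fin])
  then have "(SUP n. 2 * (\<integral>\<^sup>+r. indicator {0<..<\<kappa> n} r * f r \<partial>lborel) * ?H) \<le> ?J"
    by (intro SUP_least)
  also have "(SUP n. 2 * (\<integral>\<^sup>+r. indicator {0<..<\<kappa> n} r * f r \<partial>lborel) * ?H) =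
     2 * (SUP n. \<integral>\<^sup>+r. indicator {0<..<\<kappa> n} r * f r \<partial>lborel) * ?H"
    by (simp add: SUP_mult_left_ennreal SUP_mult_right_ennreal)
  also have "(SUP n. \<integral>\<^sup>+r. indicator {0<..<\<kappa> n} r * f r \<partial>lborel) = (\<integral>\<^sup>+r. (SUP n. indicator {0<..<\<kappa> n} r * f r) \<partial>lborel)"
    using \<kappa>_mono
    by (intro nn_integral_monotone_convergence_SUP[symmetric])
      (auto simp: incseq_def le_fun_def indicator_def intro: order.strict_trans2)
  also have "2 * \<dots> = ennreal ?C"
    unfolding SUP_ind unfolding f_def by (rule ennreal_frac_hardy_const[OF s p N, symmetric])
  finally have CH: "ennreal ?C * ?H \<le> ?J" .
  have C: "?C > 0" by (rule frac_hardy_const_pos[OF s p N])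
  have "?H = ennreal (1 / ?C) * (ennreal ?C * ?H)"
    using C by (simp add: mult.assoc[symmetric] ennreal_mult[symmetric])
  also have "\<dots> \<le> ennreal (1 / ?C) * ?J" by (intro mult_left_mono CH) auto
  finally show ?thesis .
qed

section \<open>The classical Hardy inequality for test functions\<close>

text \<open>Jensen's inequality for the \<open>p\<close>-th power and the density \<open>w\<close>.  The number \<open>i\<close> is any lower bound
  for the mean, so the mean may be infinite.  The pointwise
  tangent inequality \<open>p i\<^bsup>p-1\<^esup> F \<le> F\<^sup>p + (p - 1) i\<^sup>p\<close> is integrated against \<open>w\<close>.\<close>
lemma nn_integral_powr_ge_density:
  fixes F :: "'b \<Rightarrow> real" and w :: "'b \<Rightarrow> ennreal" and i p :: real
  assumes [measurable]: "F \<in> borel_measurable M" "w \<in> borel_measurable M"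
    and F: "\<And>x. F x \<ge> 0" and w: "(\<integral>\<^sup>+x. w x \<partial>M) \<le> 1"
    and p: "1 < p" and i: "0 \<le> i" "ennreal i \<le> (\<integral>\<^sup>+x. ennreal (F x) * w x \<partial>M)"
  shows "ennreal (i powr p) \<le> (\<integral>\<^sup>+x. ennreal (F x powr p) * w x \<partial>M)" (is "_ \<le> ?X")
proof -
  have young: "p * i powr (p - 1) * F x \<le> F x powr p + (p - 1) * i powr p" for x
  proof -
    have q: "p / (p - 1) > 1" "1 / p + 1 / (p / (p - 1)) = 1" using p by (auto simp: field_simps)
    have "F x * i powr (p - 1) \<le> F x powr p / p + (i powr (p - 1)) powr (p / (p - 1)) / (p / (p - 1))"
      using p F q by (intro Youngs_inequality) auto
    also have "(i powr (p - 1)) powr (p / (p - 1)) = i powr p" using p by (simp add: powr_powr)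
    finally have "p * (F x * i powr (p - 1)) \<le> p * (F x powr p / p + i powr p / (p / (p - 1)))"
      using p by (intro mult_left_mono) auto
    also have "\<dots> = F x powr p + (p - 1) * i powr p" using p by (simp add: field_simps)
    finally show ?thesis by (simp add: mult_ac)
  qed
  have "ennreal (p * i powr p) = ennreal (p * i powr (p - 1)) * ennreal i"
    using p i by (cases "i = 0") (auto simp: ennreal_mult[symmetric] powr_diff)
  also have "\<dots> \<le> ennreal (p * i powr (p - 1)) * (\<integral>\<^sup>+x. ennreal (F x) * w x \<partial>M)"
    by (intro mult_left_mono i) auto
  also have "\<dots> = (\<integral>\<^sup>+x. ennreal (p * i powr (p - 1)) * (ennreal (F x) * w x) \<partial>M)"
    by (rule nn_integral_cmult[symmetric]) measurable
  also have "\<dots> \<le> (\<integral>\<^sup>+x. ennreal (F x powr p) * w x + ennreal ((p - 1) * i powr p) * w x \<partial>M)"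
  proof (rule nn_integral_mono)
    fix x
    have "ennreal (p * i powr (p - 1)) * ennreal (F x) \<le> ennreal (F x powr p) + ennreal ((p - 1) * i powr p)"
      using young[of x] p F[of x] by (simp add: ennreal_mult[symmetric] ennreal_plus[symmetric] ennreal_leI del: ennreal_plus)
    then show "ennreal (p * i powr (p - 1)) * (ennreal (F x) * w x) \<le> ennreal (F x powr p) * w x + ennreal ((p - 1) * i powr p) * w x"
      unfolding mult.assoc[symmetric] distrib_right[symmetric] by (rule mult_right_mono) simp
  qed
  also have "\<dots> = ?X + ennreal ((p - 1) * i powr p) * (\<integral>\<^sup>+x. w x \<partial>M)"
    by (simp add: nn_integral_add nn_integral_cmult)
  also have "\<dots> \<le> ?X + ennreal ((p - 1) * i powr p) * 1"
    by (intro add_mono mult_left_mono w) auto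
  also have "p * i powr p = i powr p + (p - 1) * i powr p" by (simp add: algebra_simps)
  also have "ennreal \<dots> = ennreal (i powr p) + ennreal ((p - 1) * i powr p)"
    using p by (intro ennreal_plus) auto
  finally have "ennreal (i powr p) + ennreal ((p - 1) * i powr p) \<le> ?X + ennreal ((p - 1) * i powr p)"
    by simp
  then show ?thesis
    by (simp add: add.commute[of _ "ennreal ((p - 1) * i powr p)"] ennreal_add_left_cancel_le)
qed

lemma nn_integral_power_density:
  fixes c :: real
  assumes "c > 0"
  shows "(\<integral>\<^sup>+x. ennreal (c * x powr (- c - 1)) * indicator {1..} x \<partial>lborel) = 1"
proof -
  have "(\<integral>\<^sup>+x. ennreal (c * x powr (- c - 1)) * indicator {1..} x \<partial>lborel) = ennreal (0 - (- (1 powr (- c))))"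
  proof (rule nn_integral_FTC_atLeast)
    show "((\<lambda>x. - (x powr (- c))) has_real_derivative c * x powr (- c - 1)) (at x)" if "1 \<le> x" for x
      using that by (auto intro!: derivative_eq_intros)
    show "((\<lambda>x. - (x powr (- c))) \<longlongrightarrow> 0) at_top"
      using assms tendsto_minus[OF tendsto_neg_powr[of "- c" "\<lambda>x. x" at_top]] by (simp add: filterlim_ident)
  qed (use assms in auto)
  then show ?thesis by simp
qed

lemma frechet_derivative_eq_gradient:
  fixes f :: "'a::euclidean_space \<Rightarrow> real"
  assumes "f differentiable (at z)"
  shows "frechet_derivative f (at z) h = gradient f z \<bullet> h"
proof -
  interpret linear "frechet_derivative f (at z)"
    using assms by (rule linear_frechet_derivative)
  have "frechet_derivative f (at z) h = frechet_derivative f (at z) (\<Sum>b\<in>Basis. (h \<bullet> b) *\<^sub>R b)"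
    by (simp add: euclidean_representation)
  also have "\<dots> = (\<Sum>b\<in>Basis. (h \<bullet> b) * frechet_derivative f (at z) b)"
    by (simp add: sum scaleR)
  also have "\<dots> = gradient f z \<bullet> h"
    by (simp add: gradient_def inner_sum_right inner_commute[of _ h] mult.commute)
  finally show ?thesis .
qed

text \<open>The fundamental theorem of calculus along the ray from \<open>x\<close> away from the origin, which leaves
  the support.\<close>
lemma abs_le_nn_integral_ray_gradient:
  fixes \<phi> :: "'a::euclidean_space \<Rightarrow> real"
  assumes diff: "\<And>z. \<phi> differentiable (at z)" and cont: "continuous_on UNIV (gradient \<phi>)"
    and supp: "\<And>z. norm z > R \<Longrightarrow> \<phi> z = 0" and x: "x \<noteq> 0"
  shows "ennreal \<bar>\<phi> x\<bar> \<le> (\<integral>\<^sup>+r. ennreal (norm (gradient \<phi> (r *\<^sub>R x)) * norm x) * indicator {1..} r \<partial>lborel)"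
proof -
  \<comment> \<open>\<open>L x\<close> lies outside the support.\<close>
  define L where "L = max 1 (R / norm x + 1)"
  have "R < L * norm x"
  proof -
    have "R < (R / norm x + 1) * norm x" using x by (simp add: distrib_right)
    also have "\<dots> \<le> L * norm x" by (intro mult_right_mono) (auto simp: L_def)
    finally show ?thesis .
  qed
  then have 0: "\<phi> (L *\<^sub>R x) = 0" by (intro supp) (simp add: L_def)
  define f where "f r = gradient \<phi> (r *\<^sub>R x) \<bullet> x" for r
  have contf: "continuous_on UNIV f"
    unfolding f_def by (intro continuous_intros continuous_on_compose2[OF cont]) auto
  have "has_bochner_integral lborel (\<lambda>r. f r * indicator {1..L} r) (\<phi> (L *\<^sub>R x) - \<phi> (1 *\<^sub>R x))"
  proof (rule has_bochner_integral_FTC_Icc_real)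
    show "1 \<le> L" by (simp add: L_def)
    fix r :: real
    show "isCont f r" using contf by (simp add: continuous_on_eq_continuous_at)
    have "frechet_derivative \<phi> (at (r *\<^sub>R x)) = (\<lambda>h. gradient \<phi> (r *\<^sub>R x) \<bullet> h)"
      by (intro ext frechet_derivative_eq_gradient diff)
    then have "(\<phi> has_derivative (\<lambda>h. gradient \<phi> (r *\<^sub>R x) \<bullet> h)) (at (r *\<^sub>R x))"
      using frechet_derivative_works[THEN iffD1, OF diff[of "r *\<^sub>R x"]] by simp
    then have "((\<lambda>r. \<phi> (r *\<^sub>R x)) has_derivative (\<lambda>h. gradient \<phi> (r *\<^sub>R x) \<bullet> (h *\<^sub>R x))) (at r)"
      by (rule has_derivative_compose[rotated]) (auto intro!: derivative_eq_intros)
    then show "((\<lambda>r. \<phi> (r *\<^sub>R x)) has_real_derivative f r) (at r)"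
      by (simp add: has_field_derivative_def f_def mult_commute_abs)
  qed
  then have int: "integrable lborel (\<lambda>r. f r * indicator {1..L} r)"
    and val: "(\<integral>r. f r * indicator {1..L} r \<partial>lborel) = - \<phi> x"
    using 0 by (auto simp: has_bochner_integral_iff)
  have "ennreal \<bar>\<phi> x\<bar> = ennreal (norm (\<integral>r. f r * indicator {1..L} r \<partial>lborel))"
    by (simp add: val)
  also have "\<dots> \<le> (\<integral>\<^sup>+r. ennreal (norm (f r * indicator {1..L} r)) \<partial>lborel)"
    by (rule integral_norm_bound_ennreal[OF int])
  also have "\<dots> \<le> (\<integral>\<^sup>+r. ennreal (norm (gradient \<phi> (r *\<^sub>R x)) * norm x) * indicator {1..} r \<partial>lborel)"
    by (intro nn_integral_mono) (auto simp: f_def indicator_def ennreal_leI Cauchy_Schwarz_ineq2)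
  finally show ?thesis .
qed

text \<open>The ray formula bounds \<open>|\<phi>(x)| / |x|\<close> by \<open>\<integral>\<^sub>1\<^sup>\<infinity> |\<nabla>\<phi>(rx)| dr\<close>.  Minkowski's integral inequality
  would give the result at once; here it is replaced by Jensen's inequality for the probability density
  \<open>c r\<^bsup>-c-1\<^esup>\<close> on \<open>[1, \<infinity>)\<close>, \<open>c = (N - p) / p\<close>, which is proportional to the norms \<open>r\<^bsup>-N/p\<^esup>\<close> of the
  dilates and therefore keeps the constant sharp.\<close>
lemma hardy_inequality_smooth:
  fixes \<phi> :: "'a::euclidean_space \<Rightarrow> real"
  assumes diff: "\<And>z. \<phi> differentiable (at z)" and cont: "continuous_on UNIV (gradient \<phi>)"
    and supp: "\<And>z. norm z > R \<Longrightarrow> \<phi> z = 0"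
    and p: "1 < p" "p < real DIM('a)"
  shows "(\<integral>\<^sup>+x. ennreal ((\<bar>\<phi> x\<bar> / norm x) powr p) \<partial>lborel)
    \<le> ennreal (1 / hardy_const DIM('a) p) * (\<integral>\<^sup>+x. ennreal (norm (gradient \<phi> x) powr p) \<partial>lborel)"
proof -
  let ?N = "DIM('a)"
  define c where "c = (real ?N - p) / p"
  have c: "c > 0" using p by (simp add: c_def)
  have c1: "c + 1 = real ?N / p" using p by (simp add: c_def field_simps)
  have [measurable]: "gradient \<phi> \<in> borel_measurable borel" using cont by (rule borel_measurable_continuous_onI)
  define w where "w r = ennreal (c * r powr (- c - 1)) * indicator {1..} r" for r :: real
  have [measurable]: "w \<in> borel_measurable borel" unfolding w_def by measurable
  have w1: "(\<integral>\<^sup>+r. w r \<partial>lborel) = 1" unfolding w_def by (rule nn_integral_power_density[OF c])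
  \<comment> \<open>\<open>F x\<close> is chosen so that \<open>F x r\<close> times the density is
    \<open>|\<nabla>\<phi>(rx)|\<close>.\<close>
  define F where "F x r = norm (gradient \<phi> (r *\<^sub>R x)) * r powr (c + 1) / c" for x r
  have [measurable]: "(\<lambda>z. F (f z) (g z)) \<in> borel_measurable M"
    if [measurable]: "f \<in> borel_measurable M" "g \<in> borel_measurable M" for f g and M :: "'z measure"
    unfolding F_def by measurable
  have F0: "F x r \<ge> 0" for x r using c by (simp add: F_def)
  have "(\<integral>\<^sup>+x. ennreal ((\<bar>\<phi> x\<bar> / norm x) powr p) \<partial>lborel) \<le>
    (\<integral>\<^sup>+x. (\<integral>\<^sup>+r. ennreal (F x r powr p) * w r \<partial>lborel) \<partial>lborel)"
  proof (rule nn_integral_mono)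
    fix x
    show "ennreal ((\<bar>\<phi> x\<bar> / norm x) powr p) \<le> (\<integral>\<^sup>+r. ennreal (F x r powr p) * w r \<partial>lborel)"
    proof (cases "x = 0")
      case False
      show ?thesis
      proof (rule nn_integral_powr_ge_density)
        have "ennreal (\<bar>\<phi> x\<bar> / norm x) = ennreal (1 / norm x) * ennreal \<bar>\<phi> x\<bar>"
          by (simp add: ennreal_mult[symmetric])
        also have "\<dots> \<le> ennreal (1 / norm x) *
           (\<integral>\<^sup>+r. ennreal (norm (gradient \<phi> (r *\<^sub>R x)) * norm x) * indicator {1..} r \<partial>lborel)"
          using False by (intro mult_left_mono abs_le_nn_integral_ray_gradient[OF diff cont supp]) auto
        also have "\<dots> = (\<integral>\<^sup>+r. ennreal (1 / norm x) *
           (ennreal (norm (gradient \<phi> (r *\<^sub>R x)) * norm x) * indicator {1..} r) \<partial>lborel)"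
          by (rule nn_integral_cmult[symmetric]) measurable
        also have "\<dots> = (\<integral>\<^sup>+r. ennreal (F x r) * w r \<partial>lborel)"
        proof (rule nn_integral_cong)
          fix r :: real
          show "ennreal (1 / norm x) * (ennreal (norm (gradient \<phi> (r *\<^sub>R x)) * norm x) * indicator {1..} r) =
            ennreal (F x r) * w r"
          proof (cases "r \<ge> 1")
            case True
            have "r powr (c + 1) * r powr (- c - 1) = 1" using True by (simp flip: powr_add)
            then have "F x r * (c * r powr (- c - 1)) = norm (gradient \<phi> (r *\<^sub>R x))"
              using c by (simp add: F_def mult.assoc)
            then show ?thesis
              using True False F0[of x r] c by (simp add: w_def ennreal_mult[symmetric])
          qed (simp add: w_def)
        qed
        finally show "ennreal (\<bar>\<phi> x\<bar> / norm x) \<le> (\<integral>\<^sup>+r. ennreal (F x r) * w r \<partial>lborel)" .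
      qed (use p w1 F0 in auto)
    qed simp
  qed
  also have "\<dots> = (\<integral>\<^sup>+r. (\<integral>\<^sup>+x. ennreal (F x r powr p) * w r \<partial>lborel) \<partial>lborel)"
    by (rule lborel_pair.Fubini') measurable
  also have "\<dots> = (\<integral>\<^sup>+r. ennreal (c powr (- p)) * (\<integral>\<^sup>+x. ennreal (norm (gradient \<phi> x) powr p) \<partial>lborel) * w r \<partial>lborel)"
  proof (rule nn_integral_cong)
    fix r :: real
    show "(\<integral>\<^sup>+x. ennreal (F x r powr p) * w r \<partial>lborel) =
      ennreal (c powr (- p)) * (\<integral>\<^sup>+x. ennreal (norm (gradient \<phi> x) powr p) \<partial>lborel) * w r"
    proof (cases "r \<ge> 1")
      case True
      then have r: "r > 0" by simp
      have "F x r powr p = c powr (- p) * (r ^ ?N * norm (gradient \<phi> (r *\<^sub>R x)) powr p)" for x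
      proof -
        have "(r powr (c + 1)) powr p = r powr (real ?N)" unfolding c1 using p by (simp add: powr_powr)
        also have "\<dots> = r ^ ?N" using r by (rule powr_realpow)
        finally show ?thesis
          using c by (simp add: F_def powr_divide powr_mult powr_minus_divide)
      qed
      then have "(\<integral>\<^sup>+x. ennreal (F x r powr p) \<partial>lborel) =
        (\<integral>\<^sup>+x. ennreal (c powr (- p)) * (ennreal (r ^ ?N) * ennreal (norm (gradient \<phi> (r *\<^sub>R x)) powr p)) \<partial>lborel)"
        using r by (simp add: ennreal_mult[symmetric])
      also have "\<dots> = ennreal (c powr (- p)) * (ennreal (r ^ ?N) * (\<integral>\<^sup>+x. ennreal (norm (gradient \<phi> (r *\<^sub>R x)) powr p) \<partial>lborel))"
        by (simp add: nn_integral_cmult)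
      also have "ennreal (r ^ ?N) * (\<integral>\<^sup>+x. ennreal (norm (gradient \<phi> (r *\<^sub>R x)) powr p) \<partial>lborel)
        = (\<integral>\<^sup>+x. ennreal (norm (gradient \<phi> x) powr p) \<partial>lborel)"
        by (rule nn_integral_lborel_dilation[symmetric]) (use r in measurable)
      finally show ?thesis by (simp add: nn_integral_multc)
    qed (simp add: w_def)
  qed
  also have "\<dots> = ennreal (c powr (- p)) * (\<integral>\<^sup>+x. ennreal (norm (gradient \<phi> x) powr p) \<partial>lborel)"
    by (simp add: nn_integral_cmult w1)
  also have "c powr (- p) = 1 / hardy_const ?N p"
    by (simp add: hardy_const_def c_def powr_minus_divide)
  finally show ?thesis .
qed

lemma test_function_differentiable:
  assumes "\<phi> \<in> test_functions \<Omega>"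
  shows "\<phi> differentiable (at z)"
proof -
  have "C_k (Suc 0) \<phi>" using assms unfolding test_functions_def by blast
  then show ?thesis by simp
qed

lemma test_function_continuous_gradient:
  assumes "\<phi> \<in> test_functions \<Omega>"
  shows "continuous_on S (gradient \<phi>)"
proof -
  have "C_k (Suc 0) \<phi>" using assms unfolding test_functions_def by blast
  then show ?thesis
    unfolding gradient_def by (intro continuous_intros) (auto intro: continuous_on_subset)
qed

lemma test_function_eq_0:
  assumes "\<phi> \<in> test_functions \<Omega>" "x \<notin> \<Omega>"
  shows "\<phi> x = 0" "gradient \<phi> x = 0"
proof -
  let ?S = "closure {x. \<phi> x \<noteq> 0}"
  have S: "?S \<subseteq> \<Omega>" using assms by (auto simp: test_functions_def)
  then have x: "x \<in> - ?S" using assms by auto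
  have 0: "\<phi> y = 0" if "y \<in> - ?S" for y
    using that subsetD[OF closure_subset[of "{x. \<phi> x \<noteq> 0}"], of y] by blast
  then show "\<phi> x = 0" using x by blast
  have "(\<phi> has_derivative (\<lambda>_. 0)) (at x)"
  proof (rule has_derivative_transform_within_open)
    show "((\<lambda>_. 0) has_derivative (\<lambda>_. 0)) (at x)" by (rule has_derivative_const)
    show "open (- ?S)" by (rule open_Compl) (rule closed_closure)
    show "x \<in> - ?S" by (rule x)
    show "0 = \<phi> y" if "y \<in> - ?S" for y using 0[OF that] by simp
  qed
  then have "frechet_derivative \<phi> (at x) = (\<lambda>_. 0)"
    by (rule frechet_derivative_at[symmetric])
  then show "gradient \<phi> x = 0" by (simp add: gradient_def)
qed

lemma hardy_inequality_test_function:
  fixes \<phi> :: "'a::euclidean_space \<Rightarrow> real"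
  assumes "\<phi> \<in> test_functions \<Omega>" and p: "1 < p" "p < real DIM('a)"
  shows "(\<integral>\<^sup>+x. ennreal ((\<bar>\<phi> x\<bar> / norm x) powr p) \<partial>lborel)
    \<le> ennreal (1 / hardy_const DIM('a) p) * (\<integral>\<^sup>+x. ennreal (norm (gradient \<phi> x) powr p) \<partial>lborel)"
proof -
  have "bounded {x. \<phi> x \<noteq> 0}"
    using assms(1) by (auto simp: test_functions_def intro: bounded_subset[OF compact_imp_bounded closure_subset])
  then obtain R where "\<forall>x\<in>{x. \<phi> x \<noteq> 0}. norm x \<le> R" by (auto simp: bounded_iff)
  then have "\<phi> z = 0" if "norm z > R" for z using that by force
  then show ?thesis
    using test_function_differentiable[OF assms(1)] test_function_continuous_gradient[OF assms(1)] p
    by (intro hardy_inequality_smooth[where R = R]) auto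
qed

section \<open>Smooth bump functions and uniqueness of weak gradients\<close>

lemma C_k_Suc_imp: "C_k (Suc k) f \<Longrightarrow> C_k k f"
proof (induction k arbitrary: f)
  case 0
  then show ?case
    by (auto intro!: continuous_at_imp_continuous_on differentiable_imp_continuous_within)
next
  case (Suc k)
  then show ?case by (metis C_k.simps(2))
qed

lemma C_k_const: "C_k k (\<lambda>x. c)"
proof (induction k arbitrary: c)
  case (Suc k)
  have "frechet_derivative (\<lambda>x::'a. c) (at x) = (\<lambda>h. 0)" for x
    by (rule frechet_derivative_at[symmetric]) auto
  then show ?case using Suc[of 0] by simp
qed simp

lemma C_k_add: "C_k k f \<Longrightarrow> C_k k g \<Longrightarrow> C_k k (\<lambda>x. f x + g x)"
proof (induction k arbitrary: f g)
  case (Suc k)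
  have "(f has_derivative frechet_derivative f (at x)) (at x)" "(g has_derivative frechet_derivative g (at x)) (at x)" for x
    using Suc.prems by (auto simp flip: frechet_derivative_works)
  then have fd: "frechet_derivative (\<lambda>x. f x + g x) (at x) = (\<lambda>h. frechet_derivative f (at x) h + frechet_derivative g (at x) h)" for x
    by (intro frechet_derivative_at[symmetric] has_derivative_add)
  moreover have "C_k k (\<lambda>x. frechet_derivative f (at x) b + frechet_derivative g (at x) b)" if "b \<in> Basis" for b
    using Suc.prems that by (intro Suc.IH) auto
  moreover have "(\<lambda>x. f x + g x) differentiable (at x)" for x
    using Suc.prems by (intro differentiable_add) auto
  ultimately show ?case unfolding C_k.simps fd by blast
qed (auto intro: continuous_intros)

lemma C_k_mult: "C_k k f \<Longrightarrow> C_k k g \<Longrightarrow> C_k k (\<lambda>x. f x * g x)"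
proof (induction k arbitrary: f g)
  case (Suc k)
  have "(f has_derivative frechet_derivative f (at x)) (at x)" "(g has_derivative frechet_derivative g (at x)) (at x)" for x
    using Suc.prems by (auto simp flip: frechet_derivative_works)
  then have fd: "frechet_derivative (\<lambda>x. f x * g x) (at x) = (\<lambda>h. f x * frechet_derivative g (at x) h + frechet_derivative f (at x) h * g x)" for x
    by (intro frechet_derivative_at[symmetric] has_derivative_mult)
  have "C_k k (\<lambda>x. f x * frechet_derivative g (at x) b + frechet_derivative f (at x) b * g x)"
    if "b \<in> Basis" for b
  proof -
    have "C_k k (\<lambda>x. frechet_derivative f (at x) b)" "C_k k (\<lambda>x. frechet_derivative g (at x) b)"
      using Suc.prems that by auto
    moreover have "C_k k f" "C_k k g" using Suc.prems C_k_Suc_imp by blast+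
    ultimately show ?thesis by (intro C_k_add Suc.IH)
  qed
  moreover have "(\<lambda>x. f x * g x) differentiable (at x)" for x
    using Suc.prems by (intro differentiable_mult) auto
  ultimately show ?case unfolding C_k.simps fd by blast
qed (auto intro: continuous_intros)

lemma C_k_prod: "finite A \<Longrightarrow> (\<And>i. i \<in> A \<Longrightarrow> C_k k (f i)) \<Longrightarrow> C_k k (\<lambda>x. \<Prod>i\<in>A. f i x)"
  by (induction A rule: finite_induct) (auto intro: C_k_const C_k_mult)

text \<open>The powers of \<open>t\<close> in the denominator make the family closed under differentiation, up to linear
  combinations (\<open>flat_has_derivative\<close>), so that smoothness follows by one induction over all \<open>m\<close>.\<close>
definition flat :: "nat \<Rightarrow> real \<Rightarrow> real \<Rightarrow> real" where
  "flat m c t = (if t > 0 then exp (- c / t) / t ^ m else 0)"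

lemma flat_tendsto_0:
  assumes "c > 0"
  shows "(flat m c \<longlongrightarrow> 0) (at 0)"
proof (rule filterlim_split_at)
  have "\<forall>\<^sub>F t in at_left 0. flat m c t = 0"
    by (auto simp: flat_def eventually_at_filter)
  then show "(flat m c \<longlongrightarrow> 0) (at_left 0)" by (rule tendsto_eventually)
  have "filterlim (\<lambda>t::real. c * inverse t) at_top (at_right 0)"
    using assms by (intro filterlim_tendsto_pos_mult_at_top[OF tendsto_const]) (auto intro: filterlim_inverse_at_top_right)
  then have "((\<lambda>t. (c * inverse t) ^ m / exp (c * inverse t)) \<longlongrightarrow> 0) (at_right 0)"
    by (rule filterlim_compose[OF tendsto_power_div_exp_0])
  then have "((\<lambda>t. (c * inverse t) ^ m / exp (c * inverse t) / c ^ m) \<longlongrightarrow> 0 / c ^ m) (at_right 0)"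
    using assms by (intro tendsto_divide tendsto_const) auto
  moreover have "\<forall>\<^sub>F t in at_right 0. (c * inverse t) ^ m / exp (c * inverse t) / c ^ m = flat m c t"
    using assms by (auto simp: flat_def eventually_at_filter power_mult_distrib exp_minus field_simps)
  ultimately show "(flat m c \<longlongrightarrow> 0) (at_right 0)"
    by (simp add: tendsto_cong)
qed

lemma flat_has_derivative:
  assumes "c > 0"
  shows "(flat m c has_real_derivative c * flat (m + 2) c t - real m * flat (m + 1) c t) (at t)"
proof -
  consider "t > 0" | "t < 0" | "t = 0" by linarith
  then show ?thesis
  proof cases
    case 1
    have "((\<lambda>t. exp (- c / t) / t ^ m) has_real_derivative c * flat (m + 2) c t - real m * flat (m + 1) c t) (at t)"
    proof -
      have "((\<lambda>t. exp (- c / t) / t ^ m) has_real_derivative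
          ((exp (- c / t) * (c / t\<^sup>2)) * t ^ m - exp (- c / t) * (real m * t ^ (m - 1))) / (t ^ m * t ^ m)) (at t)"
        using 1 by (auto intro!: derivative_eq_intros simp: power2_eq_square)
      also have "((exp (- c / t) * (c / t\<^sup>2)) * t ^ m - exp (- c / t) * (real m * t ^ (m - 1))) / (t ^ m * t ^ m)
        = c * flat (m + 2) c t - real m * flat (m + 1) c t"
        using 1 by (cases m) (auto simp: flat_def field_simps power2_eq_square)
      finally show ?thesis .
    qed
    then show ?thesis
      by (rule has_field_derivative_transform_within_open[where S = "{0<..}"]) (use 1 in \<open>auto simp: flat_def\<close>)
  next
    case 2
    have "((\<lambda>t. 0) has_real_derivative 0) (at t)" by simp
    then have "(flat m c has_real_derivative 0) (at t)"
      by (rule has_field_derivative_transform_within_open[where S = "{..<0}"]) (use 2 in \<open>auto simp: flat_def\<close>)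
    then show ?thesis using 2 by (simp add: flat_def)
  next
    case 3
    have "((\<lambda>h. (flat m c (0 + h) - flat m c 0) / h) \<longlongrightarrow> 0) (at 0)"
    proof (rule Lim_transform_eventually[OF flat_tendsto_0[OF assms, of "m + 1"]])
      show "\<forall>\<^sub>F h in at 0. flat (m + 1) c h = (flat m c (0 + h) - flat m c 0) / h"
        by (auto simp: flat_def eventually_at_filter)
    qed
    then show ?thesis using 3 by (simp add: DERIV_def flat_def)
  qed
qed

lemma C_k_flat_affine:
  fixes v :: "'a::euclidean_space"
  assumes c: "c > 0"
  shows "C_k k (\<lambda>x. flat m c (x \<bullet> v + l))"
proof (induction k arbitrary: m)
  case 0
  have "continuous_on UNIV (flat m c)"
    using DERIV_isCont[OF flat_has_derivative[OF c]] by (simp add: continuous_on_eq_continuous_at)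
  then show ?case by (auto intro!: continuous_on_compose2[of UNIV "flat m c"] continuous_intros)
next
  case (Suc k)
  let ?d = "\<lambda>x. c * flat (m + 2) c (x \<bullet> v + l) + (- real m) * flat (m + 1) c (x \<bullet> v + l)"
  have deriv: "((\<lambda>x. flat m c (x \<bullet> v + l)) has_derivative (\<lambda>h. ?d x * (h \<bullet> v))) (at x)" for x
  proof -
    have "(flat m c has_derivative (\<lambda>h. ?d x * h)) (at (x \<bullet> v + l))"
      using flat_has_derivative[OF c, of m "x \<bullet> v + l"] by (simp add: has_field_derivative_def)
    moreover have "((\<lambda>x. x \<bullet> v + l) has_derivative (\<lambda>h. h \<bullet> v)) (at x)"
      by (auto intro!: derivative_eq_intros)
    ultimately show ?thesis by (rule has_derivative_compose[rotated])
  qed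
  have fd: "frechet_derivative (\<lambda>x. flat m c (x \<bullet> v + l)) (at x) = (\<lambda>h. ?d x * (h \<bullet> v))" for x
    by (rule frechet_derivative_at[symmetric, OF deriv])
  have "C_k k (\<lambda>x. ?d x * (h \<bullet> v))" for h
    by (intro C_k_mult C_k_add C_k_const Suc)
  moreover have "(\<lambda>x. flat m c (x \<bullet> v + l)) differentiable (at x)" for x
    using deriv differentiable_def by blast
  ultimately show ?case unfolding C_k.simps fd by blast
qed

text \<open>A smooth function that is positive exactly on \<open>box l u\<close>.  As \<open>c\<close> tends to 0 it increases to the indicator
  function of that box, without any further cut-off or mollification.\<close>
definition box_bump :: "'a::euclidean_space \<Rightarrow> 'a \<Rightarrow> real \<Rightarrow> 'a \<Rightarrow> real" where
  "box_bump l u c x = (\<Prod>b\<in>Basis. flat 0 c (x \<bullet> b + (- (l \<bullet> b))) * flat 0 c (x \<bullet> (- b) + u \<bullet> b))"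

lemma flat_0_bounds: "c > 0 \<Longrightarrow> 0 \<le> flat 0 c t \<and> flat 0 c t \<le> 1"
  by (auto simp: flat_def)

lemma box_bump_bounds:
  assumes "c > 0" shows "0 \<le> box_bump l u c x \<and> box_bump l u c x \<le> 1"
  unfolding box_bump_def using flat_0_bounds[OF assms]
  by (auto intro!: prod_nonneg prod_le_1 mult_nonneg_nonneg mult_le_one)

lemma box_bump_eq_0: "x \<notin> box l u \<Longrightarrow> box_bump l u c x = 0"
  by (auto simp: box_bump_def box_def flat_def prod_zero_iff)

lemma box_bump_tendsto: "(\<lambda>n. box_bump l u (inverse (real (Suc n))) x) \<longlonglongrightarrow> indicator (box l u) x"
proof (cases "x \<in> box l u")
  case True
  have flat: "(\<lambda>n. flat 0 (inverse (real (Suc n))) t) \<longlonglongrightarrow> 1" if "t > 0" for t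
  proof -
    have "(\<lambda>n. exp (- inverse (real (Suc n)) / t)) \<longlonglongrightarrow> exp (- 0 / t)"
      using that by (intro tendsto_intros LIMSEQ_inverse_real_of_nat) auto
    then show ?thesis using that by (simp add: flat_def)
  qed
  have "(\<lambda>n. box_bump l u (inverse (real (Suc n))) x) \<longlonglongrightarrow> (\<Prod>b\<in>(Basis::'a set). 1 * 1)"
    unfolding box_bump_def using True by (intro tendsto_prod tendsto_mult flat) (auto simp: box_def)
  then show ?thesis using True by simp
qed (simp add: box_bump_eq_0)

lemma box_bump_test_function:
  assumes "c > 0" "cbox l u \<subseteq> \<Omega>"
  shows "box_bump l u c \<in> test_functions \<Omega>"
proof -
  have "{x. box_bump l u c x \<noteq> 0} \<subseteq> cbox l u"
    using box_bump_eq_0[of _ l u c] box_subset_cbox[of l u] by blast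
  then have sub: "closure {x. box_bump l u c x \<noteq> 0} \<subseteq> cbox l u"
    by (rule closure_minimal) (rule closed_cbox)
  have "C_k k (box_bump l u c)" for k
    unfolding box_bump_def[abs_def] by (intro C_k_prod C_k_mult C_k_flat_affine assms finite_Basis)
  moreover have "compact (closure {x. box_bump l u c x \<noteq> 0})"
    using sub by (meson bounded_cbox bounded_subset closed_closure compact_eq_bounded_closed)
  ultimately show ?thesis using sub assms by (auto simp: test_functions_def)
qed

text \<open>Boxes form an intersection stable generator of the Borel sets, so the integral of \<open>w\<close> over every
  Borel set, and then over every Lebesgue set, vanishes.\<close>
lemma AE_eq_0_of_box_integrals:
  fixes w :: "'a::euclidean_space \<Rightarrow> real"
  assumes w: "integrable lebesgue w" and total: "(\<integral>x. w x \<partial>lebesgue) = 0"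
    and boxes: "\<And>l u. (\<integral>x. indicator (box l u) x * w x \<partial>lebesgue) = 0"
  shows "AE x in lebesgue. w x = 0"
proof -
  have int: "integrable lebesgue (\<lambda>x. indicator A x * w x)" if "A \<in> sets lebesgue" for A
    using integrable_mult_indicator[OF that w] by simp
  have borel: "(\<integral>x. indicator A x * w x \<partial>lebesgue) = 0" if A: "A \<in> sets borel" for A
  proof -
    have "Int_stable (range (\<lambda>(a, b). box a b :: 'a set))"
      by (auto simp: Int_stable_def box_Int_box)
    moreover have "range (\<lambda>(a, b). box a b :: 'a set) \<subseteq> Pow UNIV" by auto
    moreover have "A \<in> sigma_sets UNIV (range (\<lambda>(a, b). box a b))"
      using A unfolding borel_eq_box by simp
    ultimately show ?thesis
    proof (induction rule: sigma_sets_induct_disjoint)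
      case (basic A)
      then show ?case using boxes by auto
    next
      case empty
      then show ?case by simp
    next
      case (compl A)
      then have "A \<in> sets borel" by (simp add: borel_eq_box)
      then have A: "A \<in> sets lebesgue" by (intro sets_completionI_sets) simp
      have "(\<integral>x. indicator (UNIV - A) x * w x \<partial>lebesgue) = (\<integral>x. w x - indicator A x * w x \<partial>lebesgue)"
        by (intro Bochner_Integration.integral_cong) (auto simp: indicator_def)
      also have "\<dots> = (\<integral>x. w x \<partial>lebesgue) - (\<integral>x. indicator A x * w x \<partial>lebesgue)"
        by (intro Bochner_Integration.integral_diff w int A)
      finally show ?case using compl total by simp
    next
      case (union F)
      then have "F i \<in> sets borel" for i by (simp add: borel_eq_box subset_eq)
      then have F: "F i \<in> sets lebesgue" for i by (intro sets_completionI_sets) simp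
      have "set_integrable lebesgue (\<Union>i. F i) w"
        unfolding set_integrable_def using F by (intro integrable_mult_indicator w) auto
      then have "(LINT x:(\<Union>i. F i)|lebesgue. w x) = (\<Sum>i. (LINT x:F i|lebesgue. w x))"
        using union(1) F by (intro lebesgue_integral_countable_add) (auto simp: disjoint_family_on_def)
      then show ?case using union by (simp add: set_lebesgue_integral_def)
    qed
  qed
  have leb: "(\<integral>x. indicator A x * w x \<partial>lebesgue) = 0" if A: "A \<in> sets lebesgue" for A
  proof -
    obtain S N N' where N: "A = S \<union> N" "S \<in> sets lborel" "N \<subseteq> N'" "N' \<in> null_sets lborel"
      using sets_completionE[OF A] by metis
    then have "N' \<in> null_sets lebesgue" by (intro null_sets_completionI)
    then have "AE x in lebesgue. x \<notin> N'" by (rule AE_not_in)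
    then have "AE x in lebesgue. indicator A x * w x = indicator S x * w x"
      by eventually_elim (use N in \<open>auto simp: indicator_def\<close>)
    then have "(\<integral>x. indicator A x * w x \<partial>lebesgue) = (\<integral>x. indicator S x * w x \<partial>lebesgue)"
      using A N w by (intro integral_cong_AE) (auto intro!: borel_measurable_integrable[OF int] sets_completionI_sets)
    then show ?thesis using borel N by simp
  qed
  have "AE x in lebesgue. w x = (\<lambda>_. 0) x"
    by (rule density_unique_real) (use w leb in \<open>auto simp: set_lebesgue_integral_def\<close>)
  then show ?thesis by simp
qed

lemma weak_gradient_test_integral_eq:
  assumes "is_weak_gradient \<Omega> u g" "is_weak_gradient \<Omega> u g'" "\<phi> \<in> test_functions \<Omega>"
  shows "(LINT x:\<Omega>|lebesgue. \<phi> x *\<^sub>R g x) = (LINT x:\<Omega>|lebesgue. \<phi> x *\<^sub>R g' x)"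
  using assms unfolding is_weak_gradient_def by (metis neg_equal_iff_equal)

lemma box_bump_integral_tendsto:
  fixes g :: "'a::euclidean_space \<Rightarrow> 'a"
  assumes g: "locally_integrable_on g \<Omega>" and sub: "cbox l u \<subseteq> \<Omega>"
  shows "(\<lambda>n. LINT x:\<Omega>|lebesgue. box_bump l u (inverse (real (Suc n))) x *\<^sub>R g x)
     \<longlonglongrightarrow> (\<integral>x. indicator (box l u) x *\<^sub>R g x \<partial>lebesgue)"
proof -
  let ?\<psi> = "\<lambda>n. box_bump l u (inverse (real (Suc n)))"
  define h where "h x = indicator (cbox l u) x *\<^sub>R g x" for x
  have h: "integrable lebesgue h"
    using g sub by (auto simp: locally_integrable_on_def set_integrable_def h_def[abs_def])
  have \<psi>: "?\<psi> n \<in> borel_measurable lebesgue" for n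
  proof -
    have "continuous_on UNIV (?\<psi> n)"
      by (intro continuous_at_imp_continuous_on ballI differentiable_imp_continuous_within
          test_function_differentiable[OF box_bump_test_function[OF _ sub]]) simp
    then have "?\<psi> n \<in> borel_measurable borel" by (rule borel_measurable_continuous_onI)
    then show ?thesis by (intro measurable_completion) simp
  qed
  have "(\<lambda>n. \<integral>x. ?\<psi> n x *\<^sub>R h x \<partial>lebesgue) \<longlonglongrightarrow> (\<integral>x. indicator (box l u) x *\<^sub>R h x \<partial>lebesgue)"
  proof (rule integral_dominated_convergence)
    show "integrable lebesgue (\<lambda>x. norm (h x))" using h by simp
    show "AE x in lebesgue. (\<lambda>n. ?\<psi> n x *\<^sub>R h x) \<longlonglongrightarrow> indicator (box l u) x *\<^sub>R h x"
      by (intro AE_I2 tendsto_scaleR box_bump_tendsto tendsto_const)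
    show "AE x in lebesgue. norm (?\<psi> n x *\<^sub>R h x) \<le> norm (h x)" for n
      using box_bump_bounds[of "inverse (real (Suc n))" l u] by (auto intro!: mult_left_le_one_le)
    show "(\<lambda>x. indicator (box l u) x *\<^sub>R h x) \<in> borel_measurable lebesgue"
      using h by (intro borel_measurable_scaleR borel_measurable_indicator) auto
    show "(\<lambda>x. ?\<psi> n x *\<^sub>R h x) \<in> borel_measurable lebesgue" for n
      using h by (intro borel_measurable_scaleR \<psi>) auto
  qed
  moreover have "(\<integral>x. ?\<psi> n x *\<^sub>R h x \<partial>lebesgue) = (LINT x:\<Omega>|lebesgue. ?\<psi> n x *\<^sub>R g x)" for n
    unfolding set_lebesgue_integral_def
  proof (intro Bochner_Integration.integral_cong refl)
    fix x
    show "?\<psi> n x *\<^sub>R h x = indicator \<Omega> x *\<^sub>R ?\<psi> n x *\<^sub>R g x"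
    proof (cases "x \<in> box l u")
      case True
      then have "x \<in> cbox l u" "x \<in> \<Omega>" using box_subset_cbox[of l u] sub by auto
      then show ?thesis by (simp add: h_def)
    qed (simp add: box_bump_eq_0)
  qed
  moreover have "(\<integral>x. indicator (box l u) x *\<^sub>R h x \<partial>lebesgue) = (\<integral>x. indicator (box l u) x *\<^sub>R g x \<partial>lebesgue)"
    using box_subset_cbox[of l u]
    by (intro Bochner_Integration.integral_cong refl) (auto simp: h_def indicator_def)
  ultimately show ?thesis by simp
qed

text \<open>Tested with bump functions of a box inside \<open>\<Omega>\<close>, the two gradients have the same integral over the
  box by dominated convergence.  This holds for all smaller boxes too, so the gradients agree almost
  everywhere on the box, and \<open>\<Omega>\<close> is a countable union of closed boxes.\<close>
theorem weak_gradient_unique: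
  fixes g g' :: "'a::euclidean_space \<Rightarrow> 'a"
  assumes g: "is_weak_gradient \<Omega> u g" and g': "is_weak_gradient \<Omega> u g'" and \<Omega>: "open \<Omega>"
  shows "AE x in lebesgue. x \<in> \<Omega> \<longrightarrow> g x = g' x"
proof -
  have loc: "locally_integrable_on g \<Omega>" "locally_integrable_on g' \<Omega>"
    using g g' by (auto simp: is_weak_gradient_def)
  have int: "integrable lebesgue (\<lambda>x. indicator (box l u) x *\<^sub>R f x)"
    if f: "locally_integrable_on f \<Omega>" and sub: "cbox l u \<subseteq> \<Omega>" for l u and f :: "'a \<Rightarrow> 'a"
  proof -
    have "integrable lebesgue (\<lambda>x. indicator (cbox l u) x *\<^sub>R f x)"
      using f sub by (auto simp: locally_integrable_on_def set_integrable_def)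
    then have "integrable lebesgue (\<lambda>x. indicator (box l u) x *\<^sub>R indicator (cbox l u) x *\<^sub>R f x)"
      by (rule integrable_mult_indicator[rotated]) simp
    moreover have "indicator (box l u) x *\<^sub>R indicator (cbox l u) x *\<^sub>R f x = indicator (box l u) x *\<^sub>R f x" for x
      using box_subset_cbox[of l u] by (auto simp: indicator_def)
    ultimately show ?thesis by (simp only:)
  qed
  have boxeq: "(\<integral>x. indicator (box l u) x *\<^sub>R g x \<partial>lebesgue) = (\<integral>x. indicator (box l u) x *\<^sub>R g' x \<partial>lebesgue)"
    if sub: "cbox l u \<subseteq> \<Omega>" for l u
  proof (rule LIMSEQ_unique)
    show "(\<lambda>n. LINT x:\<Omega>|lebesgue. box_bump l u (inverse (real (Suc n))) x *\<^sub>R g x)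
     \<longlonglongrightarrow> (\<integral>x. indicator (box l u) x *\<^sub>R g x \<partial>lebesgue)"
      by (rule box_bump_integral_tendsto[OF loc(1) sub])
    have "(LINT x:\<Omega>|lebesgue. box_bump l u (inverse (real (Suc n))) x *\<^sub>R g x) =
      (LINT x:\<Omega>|lebesgue. box_bump l u (inverse (real (Suc n))) x *\<^sub>R g' x)" for n
      by (rule weak_gradient_test_integral_eq[OF g g' box_bump_test_function[OF _ sub]]) simp
    then show "(\<lambda>n. LINT x:\<Omega>|lebesgue. box_bump l u (inverse (real (Suc n))) x *\<^sub>R g x)
     \<longlonglongrightarrow> (\<integral>x. indicator (box l u) x *\<^sub>R g' x \<partial>lebesgue)"
      using box_bump_integral_tendsto[OF loc(2) sub] by simp
  qed
  have on_box: "AE x in lebesgue. x \<in> box a b \<longrightarrow> g x = g' x" if sub: "cbox a b \<subseteq> \<Omega>" for a b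
  proof -
    have "AE x in lebesgue. indicator (box a b) x * ((g x - g' x) \<bullet> i) = 0" for i
    proof (rule AE_eq_0_of_box_integrals)
      have *: "integrable lebesgue (\<lambda>x. indicator (box l u) x * ((g x - g' x) \<bullet> i)) \<and>
          (\<integral>x. indicator (box l u) x * ((g x - g' x) \<bullet> i) \<partial>lebesgue) = 0" if s: "cbox l u \<subseteq> \<Omega>" for l u
      proof -
        have eq: "indicator (box l u) x * ((g x - g' x) \<bullet> i) =
            (indicator (box l u) x *\<^sub>R g x - indicator (box l u) x *\<^sub>R g' x) \<bullet> i" for x
          by (simp add: inner_diff_left right_diff_distrib)
        have i: "integrable lebesgue (\<lambda>x. indicator (box l u) x *\<^sub>R g x - indicator (box l u) x *\<^sub>R g' x)"
          by (intro Bochner_Integration.integrable_diff int loc s)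
        have "(\<integral>x. indicator (box l u) x *\<^sub>R g x - indicator (box l u) x *\<^sub>R g' x \<partial>lebesgue) = 0"
          using boxeq[OF s] int[OF loc(1) s] int[OF loc(2) s] by simp
        then show ?thesis
          unfolding eq using i integral_inner_left[OF i, of i] by auto
      qed
      show "integrable lebesgue (\<lambda>x. indicator (box a b) x * ((g x - g' x) \<bullet> i))"
        "(\<integral>x. indicator (box a b) x * ((g x - g' x) \<bullet> i) \<partial>lebesgue) = 0"
        using *[OF sub] by auto
      fix l u :: 'a
      obtain l' u' where lu: "box l u \<inter> box a b = box l' u'" using box_Int_box by blast
      have "(\<integral>x. indicator (box l u) x * (indicator (box a b) x * ((g x - g' x) \<bullet> i)) \<partial>lebesgue)
        = (\<integral>x. indicator (box l' u') x * ((g x - g' x) \<bullet> i) \<partial>lebesgue)"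
        unfolding lu[symmetric] by (simp add: indicator_inter_arith mult.assoc)
      also have "\<dots> = 0"
      proof (cases "box l' u' = {}")
        case False
        have "box l' u' \<subseteq> cbox a b" using lu box_subset_cbox[of a b] by blast
        then have "closure (box l' u') \<subseteq> cbox a b" by (rule closure_minimal) (rule closed_cbox)
        then have "cbox l' u' \<subseteq> \<Omega>" using closure_box[OF False] sub by simp
        then show ?thesis using * by auto
      qed simp
      finally show "(\<integral>x. indicator (box l u) x * (indicator (box a b) x * ((g x - g' x) \<bullet> i)) \<partial>lebesgue) = 0" .
    qed
    then have "AE x in lebesgue. \<forall>i\<in>Basis. indicator (box a b) x * ((g x - g' x) \<bullet> i) = 0"
      by (intro AE_finite_allI) auto
    then show ?thesis
    proof eventually_elim
      case (elim x)
      show ?case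
      proof
        assume x: "x \<in> box a b"
        show "g x = g' x"
        proof (rule euclidean_eqI)
          fix i :: 'a assume "i \<in> Basis"
          with elim have "indicator (box a b) x * ((g x - g' x) \<bullet> i) = 0" by blast
          then show "g x \<bullet> i = g' x \<bullet> i" using x by (simp add: inner_diff_left)
        qed
      qed
    qed
  qed
  obtain D where D: "countable D" "D \<subseteq> Pow \<Omega>" "\<And>X. X \<in> D \<Longrightarrow> \<exists>a b. X = cbox a b" "\<Union>D = \<Omega>"
    using open_countable_Union_open_cbox[OF \<Omega>] by metis
  have "AE x in lebesgue. \<forall>X\<in>D. x \<in> X \<longrightarrow> g x = g' x"
  proof (subst AE_ball_countable[OF D(1)], intro ballI)
    fix X assume X: "X \<in> D"
    then obtain a b where ab: "X = cbox a b" using D(3) by blast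
    have "cbox a b - box a b \<in> null_sets lebesgue"
      using negligible_frontier_interval negligible_iff_null_sets by blast
    then have "AE x in lebesgue. x \<notin> cbox a b - box a b" by (rule AE_not_in)
    moreover have "AE x in lebesgue. x \<in> box a b \<longrightarrow> g x = g' x"
      using X D(2) ab by (intro on_box) auto
    ultimately show "AE x in lebesgue. x \<in> X \<longrightarrow> g x = g' x"
      unfolding ab by eventually_elim auto
  qed
  then show ?thesis by eventually_elim (use D(4) in blast)
qed

section \<open>The Hardy inequalities on the Sobolev space\<close>

text \<open>On a compact set a subsequence of \<open>\<phi>\<close> converges almost everywhere, so Fatou's lemma applies to the
  inequalities for \<open>\<phi> n\<close>.  The \<open>L\<^sup>p\<close> norms of the gradients are compared by weighted convexity, with an
  error factor \<open>(1 - t)\<^bsup>1-p\<^esup>\<close> that tends to 1 with \<open>t \<rightarrow> 0\<close>.\<close>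
theorem hardy_inequality_gradient_limit:
  fixes u :: "'a::euclidean_space \<Rightarrow> real"
  assumes \<Omega>: "open \<Omega>" and u: "locally_integrable_on u \<Omega>" and p: "1 < p" "p < real DIM('a)"
    and gLp: "in_Lp p \<Omega> g"
    and \<phi>: "\<And>n::nat. \<phi> n \<in> test_functions \<Omega>"
    and lim_grad: "(\<lambda>n. \<integral>\<^sup>+x\<in>\<Omega>. ennreal (norm (gradient (\<phi> n) x - g x) powr p) \<partial>lebesgue) \<longlonglongrightarrow> 0"
    and lim_u: "\<And>K. compact K \<Longrightarrow> K \<subseteq> \<Omega> \<Longrightarrow>
        (\<lambda>n. \<integral>\<^sup>+x\<in>K. ennreal \<bar>\<phi> n x - u x\<bar> \<partial>lebesgue) \<longlonglongrightarrow> 0"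
  shows "(\<integral>\<^sup>+x\<in>\<Omega>. ennreal ((\<bar>u x\<bar> / norm x) powr p) \<partial>lebesgue)
    \<le> ennreal (1 / hardy_const DIM('a) p) * (\<integral>\<^sup>+x\<in>\<Omega>. ennreal (norm (g x) powr p) \<partial>lebesgue)"
proof -
  let ?C = "1 / hardy_const DIM('a) p"
  define X where "X = (\<integral>\<^sup>+x\<in>\<Omega>. ennreal (norm (g x) powr p) \<partial>lebesgue)"
  define A where "A n = (\<integral>\<^sup>+x\<in>\<Omega>. ennreal (norm (gradient (\<phi> n) x - g x) powr p) \<partial>lebesgue)" for n
  have Xfin: "X < \<infinity>" using gLp by (simp add: in_Lp_def X_def)
  have \<Omega>m: "\<Omega> \<in> sets lebesgue" using \<Omega> by (intro sets_completionI_sets) simp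
  have g_meas: "(\<lambda>x. indicator \<Omega> x *\<^sub>R g x) \<in> borel_measurable lebesgue"
    using gLp \<Omega>m by (simp add: in_Lp_def borel_measurable_restrict_space_iff)
  have grad_meas: "gradient (\<phi> n) \<in> borel_measurable lebesgue" for n
    using borel_measurable_continuous_onI[OF test_function_continuous_gradient[OF \<phi>]]
    by (intro measurable_completion) simp
  have \<phi>_cont: "continuous_on S (\<phi> n)" for n S
    by (intro continuous_at_imp_continuous_on ballI differentiable_imp_continuous_within
        test_function_differentiable[OF \<phi>])
  have \<phi>_meas: "\<phi> n \<in> borel_measurable lebesgue" for n
    using borel_measurable_continuous_onI[OF \<phi>_cont[of UNIV n]] by (intro measurable_completion) simp
  have bound: "(\<integral>\<^sup>+x. ennreal ((\<bar>\<phi> n x\<bar> / norm x) powr p) \<partial>lebesgue) \<le>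
      ennreal ?C * (ennreal ((1 - t) powr (1 - p)) * X + ennreal (t powr (1 - p)) * A n)"
    if t: "0 < t" "t < 1" for n t
  proof -
    have "(\<integral>\<^sup>+x. ennreal (norm (gradient (\<phi> n) x) powr p) \<partial>lebesgue) \<le>
      (\<integral>\<^sup>+x. ennreal ((1 - t) powr (1 - p)) * (ennreal (norm (g x) powr p) * indicator \<Omega> x) +
        ennreal (t powr (1 - p)) * (ennreal (norm (gradient (\<phi> n) x - g x) powr p) * indicator \<Omega> x) \<partial>lebesgue)"
    proof (rule nn_integral_mono)
      fix x
      show "ennreal (norm (gradient (\<phi> n) x) powr p) \<le> ennreal ((1 - t) powr (1 - p)) * (ennreal (norm (g x) powr p) * indicator \<Omega> x) +
        ennreal (t powr (1 - p)) * (ennreal (norm (gradient (\<phi> n) x - g x) powr p) * indicator \<Omega> x)"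
      proof (cases "x \<in> \<Omega>")
        case True
        have "norm (gradient (\<phi> n) x) \<le> norm (g x) + norm (gradient (\<phi> n) x - g x)"
          using norm_triangle_ineq[of "g x" "gradient (\<phi> n) x - g x"] by simp
        then have "norm (gradient (\<phi> n) x) powr p \<le> (norm (g x) + norm (gradient (\<phi> n) x - g x)) powr p"
          using p by (intro powr_mono2) auto
        also have "\<dots> \<le> (1 - t) powr (1 - p) * norm (g x) powr p + t powr (1 - p) * norm (gradient (\<phi> n) x - g x) powr p"
          using p t by (intro powr_add_le_weighted) auto
        finally show ?thesis
          using True by (simp add: ennreal_mult[symmetric] ennreal_plus[symmetric] ennreal_leI del: ennreal_plus)
      qed (simp add: test_function_eq_0[OF \<phi>])
    qed
    also have "\<dots> = ennreal ((1 - t) powr (1 - p)) * X + ennreal (t powr (1 - p)) * A n"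
    proof -
      have "(\<lambda>x. ennreal (norm (indicator \<Omega> x *\<^sub>R g x) powr p)) \<in> borel_measurable lebesgue"
        using g_meas by measurable
      moreover have "ennreal (norm (indicator \<Omega> x *\<^sub>R g x) powr p) = ennreal (norm (g x) powr p) * indicator \<Omega> x" for x
        by (auto simp: indicator_def)
      ultimately have m1: "(\<lambda>x. ennreal (norm (g x) powr p) * indicator \<Omega> x) \<in> borel_measurable lebesgue" by (simp only:)
      have "(\<lambda>x. ennreal (norm (gradient (\<phi> n) x - indicator \<Omega> x *\<^sub>R g x) powr p)) \<in> borel_measurable lebesgue"
        using g_meas grad_meas[of n] by measurable
      moreover have "ennreal (norm (gradient (\<phi> n) x - indicator \<Omega> x *\<^sub>R g x) powr p) =
          ennreal (norm (gradient (\<phi> n) x - g x) powr p) * indicator \<Omega> x" for x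
        by (cases "x \<in> \<Omega>") (auto simp: test_function_eq_0[OF \<phi>])
      ultimately have m2: "(\<lambda>x. ennreal (norm (gradient (\<phi> n) x - g x) powr p) * indicator \<Omega> x) \<in> borel_measurable lebesgue" by (simp only:)
      show ?thesis unfolding X_def A_def using m1 m2 by (simp add: nn_integral_add nn_integral_cmult)
    qed
    finally have grad: "(\<integral>\<^sup>+x. ennreal (norm (gradient (\<phi> n) x) powr p) \<partial>lebesgue) \<le>
      ennreal ((1 - t) powr (1 - p)) * X + ennreal (t powr (1 - p)) * A n" .
    have "(\<integral>\<^sup>+x. ennreal ((\<bar>\<phi> n x\<bar> / norm x) powr p) \<partial>lebesgue)
      \<le> ennreal ?C * (\<integral>\<^sup>+x. ennreal (norm (gradient (\<phi> n) x) powr p) \<partial>lebesgue)"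
      using hardy_inequality_test_function[OF \<phi> p] by (simp add: nn_integral_completion)
    also have "\<dots> \<le> ennreal ?C * (ennreal ((1 - t) powr (1 - p)) * X + ennreal (t powr (1 - p)) * A n)"
      by (intro mult_left_mono grad) auto
    finally show ?thesis .
  qed
  have on_compact: "(\<integral>\<^sup>+x\<in>K. ennreal ((\<bar>u x\<bar> / norm x) powr p) \<partial>lebesgue) \<le> ennreal ?C * X"
      and K_meas: "(\<lambda>x. ennreal ((\<bar>u x\<bar> / norm x) powr p) * indicator K x) \<in> borel_measurable lebesgue"
    if K: "compact K" "K \<subseteq> \<Omega>" for K
  proof -
    have Km: "K \<in> sets lebesgue" using K by (intro sets_completionI_sets) (simp add: borel_compact)
    have u_int: "integrable lebesgue (\<lambda>x. indicator K x *\<^sub>R u x)"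
      using u K by (auto simp: locally_integrable_on_def set_integrable_def)
    have u_meas: "(\<lambda>x. indicator K x *\<^sub>R u x) \<in> borel_measurable lebesgue"
      using u_int by (rule borel_measurable_integrable)
    have "(\<lambda>x. norm x) \<in> borel_measurable lebesgue" by (intro measurable_completion) simp
    then have "(\<lambda>x. ennreal ((\<bar>indicator K x *\<^sub>R u x\<bar> / norm x) powr p)) \<in> borel_measurable lebesgue"
      using u_meas by measurable
    moreover have "ennreal ((\<bar>indicator K x *\<^sub>R u x\<bar> / norm x) powr p) = ennreal ((\<bar>u x\<bar> / norm x) powr p) * indicator K x" for x
      by (auto simp: indicator_def)
    ultimately show "(\<lambda>x. ennreal ((\<bar>u x\<bar> / norm x) powr p) * indicator K x) \<in> borel_measurable lebesgue"
      by (simp only:)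
    define v where "v n x = indicator K x *\<^sub>R (\<phi> n x - u x)" for n x
    have v_int: "integrable lebesgue (v n)" for n
    proof -
      have "integrable lborel (\<lambda>x. indicator K x *\<^sub>R \<phi> n x)"
        by (rule borel_integrable_compact[OF K(1) \<phi>_cont])
      then have "integrable lebesgue (\<lambda>x. indicator K x *\<^sub>R \<phi> n x)"
        by (subst integrable_completion) auto
      then have "integrable lebesgue (\<lambda>x. indicator K x *\<^sub>R \<phi> n x - indicator K x *\<^sub>R u x)"
        using u_int by (rule Bochner_Integration.integrable_diff)
      then show ?thesis by (simp add: v_def[abs_def] right_diff_distrib)
    qed
    have "ennreal (\<integral>x. norm (v n x) \<partial>lebesgue) = (\<integral>\<^sup>+x\<in>K. ennreal \<bar>\<phi> n x - u x\<bar> \<partial>lebesgue)" for n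
    proof -
      have "ennreal (\<integral>x. norm (v n x) \<partial>lebesgue) = (\<integral>\<^sup>+x. ennreal (norm (v n x)) \<partial>lebesgue)"
        by (rule nn_integral_eq_integral[symmetric]) (use v_int in auto)
      also have "\<dots> = (\<integral>\<^sup>+x\<in>K. ennreal \<bar>\<phi> n x - u x\<bar> \<partial>lebesgue)"
        by (rule nn_integral_cong) (auto simp: v_def indicator_def)
      finally show ?thesis .
    qed
    then have "(\<lambda>n. ennreal (\<integral>x. norm (v n x) \<partial>lebesgue)) \<longlonglongrightarrow> ennreal 0"
      using lim_u[OF K] by simp
    then have "(\<lambda>n. \<integral>x. norm (v n x) \<partial>lebesgue) \<longlonglongrightarrow> 0"
      by (subst (asm) tendsto_ennreal_iff) auto
    then obtain r where r: "strict_mono r" "AE x in lebesgue. (\<lambda>n. v (r n) x) \<longlonglongrightarrow> 0"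
      using tendsto_L1_AE_subseq[of lebesgue v, OF v_int] by blast
    define h where "h n x = ennreal ((\<bar>\<phi> (r n) x\<bar> / norm x) powr p) * indicator K x" for n x
    have h_meas: "h n \<in> borel_measurable lebesgue" for n
    proof -
      have "(\<lambda>x. norm x) \<in> borel_measurable lebesgue" by (intro measurable_completion) simp
      then show ?thesis unfolding h_def using \<phi>_meas[of "r n"] Km by measurable
    qed
    have "(\<integral>\<^sup>+x\<in>K. ennreal ((\<bar>u x\<bar> / norm x) powr p) \<partial>lebesgue) = (\<integral>\<^sup>+x. liminf (\<lambda>n. h n x) \<partial>lebesgue)"
    proof (rule nn_integral_cong_AE)
      show "AE x in lebesgue. ennreal ((\<bar>u x\<bar> / norm x) powr p) * indicator K x = liminf (\<lambda>n. h n x)"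
        using r(2)
      proof eventually_elim
        case (elim x)
        have "(\<lambda>n. h n x) \<longlonglongrightarrow> ennreal ((\<bar>u x\<bar> / norm x) powr p) * indicator K x"
        proof (cases "x \<in> K")
          case True
          then have "(\<lambda>n. \<phi> (r n) x - u x) \<longlonglongrightarrow> 0" using elim by (simp add: v_def)
          then have "(\<lambda>n. \<phi> (r n) x) \<longlonglongrightarrow> u x" by (simp add: LIM_zero_iff)
          then have "(\<lambda>n. (\<bar>\<phi> (r n) x\<bar> / norm x) powr p) \<longlonglongrightarrow> (\<bar>u x\<bar> / norm x) powr p"
          proof (cases "x = 0")
            case False
            assume "(\<lambda>n. \<phi> (r n) x) \<longlonglongrightarrow> u x"
            with False show ?thesis using p
              by (intro tendsto_powr' tendsto_divide tendsto_rabs tendsto_const) auto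
          qed simp
          then show ?thesis using True by (simp add: h_def)
        qed (simp add: h_def)
        then show ?case by (intro lim_imp_Liminf[symmetric]) auto
      qed
    qed
    also have "\<dots> \<le> liminf (\<lambda>n. \<integral>\<^sup>+x. h n x \<partial>lebesgue)"
      by (rule nn_integral_liminf) (rule h_meas)
    finally have fatou: "(\<integral>\<^sup>+x\<in>K. ennreal ((\<bar>u x\<bar> / norm x) powr p) \<partial>lebesgue) \<le> liminf (\<lambda>n. \<integral>\<^sup>+x. h n x \<partial>lebesgue)" .
    have le_t: "(\<integral>\<^sup>+x\<in>K. ennreal ((\<bar>u x\<bar> / norm x) powr p) \<partial>lebesgue) \<le> ennreal ?C * (ennreal ((1 - t) powr (1 - p)) * X)"
      if t: "0 < t" "t < 1" for t
    proof -
      define B where "B n = ennreal ?C * (ennreal ((1 - t) powr (1 - p)) * X + ennreal (t powr (1 - p)) * A (r n))" for n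
      have "(\<integral>\<^sup>+x. h n x \<partial>lebesgue) \<le> B n" for n
        unfolding B_def
        by (rule order_trans[OF nn_integral_mono bound[OF t]]) (auto simp: h_def indicator_def)
      then have "liminf (\<lambda>n. \<integral>\<^sup>+x. h n x \<partial>lebesgue) \<le> liminf B" by (intro Liminf_mono) auto
      also have "B \<longlonglongrightarrow> ennreal ?C * (ennreal ((1 - t) powr (1 - p)) * X + ennreal (t powr (1 - p)) * 0)"
        unfolding B_def
        by (intro ennreal_tendsto_cmult tendsto_add tendsto_const LIMSEQ_subseq_LIMSEQ[OF lim_grad[folded A_def] r(1), unfolded comp_def]) auto
      then have "liminf B = ennreal ?C * (ennreal ((1 - t) powr (1 - p)) * X + ennreal (t powr (1 - p)) * 0)"
        by (intro lim_imp_Liminf) auto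
      finally show ?thesis using fatou by simp
    qed
    obtain X' where X': "X = ennreal X'" "X' \<ge> 0" using Xfin by (cases X) auto
    have "((\<lambda>t. ennreal (?C * ((1 - t) powr (1 - p) * X'))) \<longlongrightarrow> ennreal (?C * ((1 - 0) powr (1 - p) * X'))) (at_right 0)"
      by (intro tendsto_intros) auto
    moreover have "\<forall>\<^sub>F t in at_right 0. (\<integral>\<^sup>+x\<in>K. ennreal ((\<bar>u x\<bar> / norm x) powr p) \<partial>lebesgue) \<le>
        ennreal (?C * ((1 - t) powr (1 - p) * X'))"
    proof -
      have "\<forall>\<^sub>F t in at_right 0. (t::real) \<in> {0<..<1}" by (rule eventually_at_right_real) simp
      then show ?thesis
      proof eventually_elim
        case (elim t)
        have C0: "0 \<le> ?C" by (simp add: hardy_const_def)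
        have "ennreal (?C * ((1 - t) powr (1 - p) * X')) = ennreal ?C * (ennreal ((1 - t) powr (1 - p)) * X)"
          unfolding X'(1) using X'(2) C0 by (simp only: ennreal_mult powr_ge_zero mult_nonneg_nonneg)
        then show ?case using le_t[of t] elim by simp
      qed
    qed
    ultimately have "(\<integral>\<^sup>+x\<in>K. ennreal ((\<bar>u x\<bar> / norm x) powr p) \<partial>lebesgue) \<le> ennreal (?C * ((1 - 0) powr (1 - p) * X'))"
      by (rule tendsto_lowerbound) simp
    then show "(\<integral>\<^sup>+x\<in>K. ennreal ((\<bar>u x\<bar> / norm x) powr p) \<partial>lebesgue) \<le> ennreal ?C * X"
      using X'(2) unfolding X'(1) by (subst ennreal_mult'[symmetric]) (simp_all add: hardy_const_def)
  qed
  obtain K where K: "\<And>n. compact (K n)" "\<And>n. K n \<subseteq> \<Omega>" "\<And>n. K n \<subseteq> interior (K (Suc n))" "\<Union>(range K) = \<Omega>"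
    using open_Union_compact_subsets[OF \<Omega>] by metis
  have "K n \<subseteq> K (Suc n)" for n using K(3)[of n] interior_subset by blast
  then have K_mono: "K m \<subseteq> K n" if "m \<le> n" for m n using that by (rule lift_Suc_mono_le)
  let ?f = "\<lambda>x. ennreal ((\<bar>u x\<bar> / norm x) powr p)"
  have SUP_ind: "(SUP n. ?f x * indicator (K n) x) = ?f x * indicator \<Omega> x" for x
  proof -
    have "(SUP n. indicator (K n) x) = (indicator (\<Union>n. K n) x :: ennreal)"
      by (rule antisym) (auto simp: indicator_def intro!: SUP_least SUP_upper2)
    then show ?thesis using K(4) by (simp add: SUP_mult_left_ennreal[symmetric])
  qed
  have "(\<integral>\<^sup>+x\<in>\<Omega>. ?f x \<partial>lebesgue) = (\<integral>\<^sup>+x. (SUP n. ?f x * indicator (K n) x) \<partial>lebesgue)"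
    by (simp add: SUP_ind)
  also have "\<dots> = (SUP n. \<integral>\<^sup>+x. ?f x * indicator (K n) x \<partial>lebesgue)"
    using K_mono K_meas[OF K(1,2)]
    by (intro nn_integral_monotone_convergence_SUP) (auto simp: incseq_def le_fun_def subset_eq split: split_indicator)
  also have "\<dots> \<le> ennreal ?C * X"
    using on_compact[OF K(1,2)] by (intro SUP_least) auto
  finally show ?thesis by (simp add: X_def)
qed

text \<open>Test functions on \<open>\<Omega>\<close> are test functions on the whole space, and they vanish outside \<open>\<Omega>\<close> together
  with their gradients.\<close>
lemma is_weak_gradient_subset:
  assumes g: "is_weak_gradient UNIV u g"
  shows "is_weak_gradient \<Omega> u g"
  unfolding is_weak_gradient_def
proof (intro conjI ballI)
  show "locally_integrable_on u \<Omega>" "locally_integrable_on g \<Omega>"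
    using g by (auto simp: is_weak_gradient_def locally_integrable_on_def)
  fix \<phi> :: "'a \<Rightarrow> real" assume \<phi>: "\<phi> \<in> test_functions \<Omega>"
  then have "\<phi> \<in> test_functions UNIV" by (auto simp: test_functions_def)
  then have "(LINT x:UNIV|lebesgue. u x *\<^sub>R gradient \<phi> x) = - (LINT x:UNIV|lebesgue. \<phi> x *\<^sub>R g x)"
    using g by (auto simp: is_weak_gradient_def)
  moreover have "indicator UNIV x *\<^sub>R u x *\<^sub>R gradient \<phi> x = indicator \<Omega> x *\<^sub>R u x *\<^sub>R gradient \<phi> x"
    "indicator UNIV x *\<^sub>R \<phi> x *\<^sub>R g x = indicator \<Omega> x *\<^sub>R \<phi> x *\<^sub>R g x" for x
    using test_function_eq_0[OF \<phi>, of x] by (cases "x \<in> \<Omega>"; simp)+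
  ultimately show "(LINT x:\<Omega>|lebesgue. u x *\<^sub>R gradient \<phi> x) = - (LINT x:\<Omega>|lebesgue. \<phi> x *\<^sub>R g x)"
    unfolding set_lebesgue_integral_def by (simp only:)
qed

text \<open>The finiteness statement comes from the gradient in \<open>L\<^sup>p(\<Omega>)\<close> that membership in the closure of the
  test functions provides.\<close>
lemma X_space_hardy_inequality:
  fixes \<Omega> :: "'a::euclidean_space set"
  assumes \<Omega>: "open \<Omega>" and u: "u \<in> X_space p \<Omega>" and p: "1 < p" "p < real DIM('a)"
  shows "(\<integral>\<^sup>+x\<in>\<Omega>. ennreal ((\<bar>u x\<bar> / norm x) powr p) \<partial>lebesgue)
      \<le> ennreal (1 / hardy_const DIM('a) p) * (\<integral>\<^sup>+x\<in>\<Omega>. ennreal (norm (weak_gradient u x) powr p) \<partial>lebesgue)"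
    and "(\<integral>\<^sup>+x\<in>\<Omega>. ennreal ((\<bar>u x\<bar> / norm x) powr p) \<partial>lebesgue) < \<infinity>"
proof -
  obtain g \<phi> where H: "is_weak_gradient \<Omega> u g \<and> in_Lp p \<Omega> g \<and>
     (\<forall>n::nat. \<phi> n \<in> test_functions \<Omega>) \<and>
     (\<lambda>n. \<integral>\<^sup>+x\<in>\<Omega>. ennreal (norm (gradient (\<phi> n) x - g x) powr p) \<partial>lebesgue) \<longlonglongrightarrow> 0 \<and>
     (\<forall>K. compact K \<and> K \<subseteq> \<Omega> \<longrightarrow> (\<lambda>n. \<integral>\<^sup>+x\<in>K. ennreal \<bar>\<phi> n x - u x\<bar> \<partial>lebesgue) \<longlonglongrightarrow> 0)"
    using u unfolding X_space_def W0_1p_def by blast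
  then have g: "is_weak_gradient \<Omega> u g" "in_Lp p \<Omega> g"
    and \<phi>: "\<And>n. \<phi> n \<in> test_functions \<Omega>"
      "(\<lambda>n. \<integral>\<^sup>+x\<in>\<Omega>. ennreal (norm (gradient (\<phi> n) x - g x) powr p) \<partial>lebesgue) \<longlonglongrightarrow> 0"
      "\<And>K. compact K \<Longrightarrow> K \<subseteq> \<Omega> \<Longrightarrow> (\<lambda>n. \<integral>\<^sup>+x\<in>K. ennreal \<bar>\<phi> n x - u x\<bar> \<partial>lebesgue) \<longlonglongrightarrow> 0"
    by blast+
  have hardy: "(\<integral>\<^sup>+x\<in>\<Omega>. ennreal ((\<bar>u x\<bar> / norm x) powr p) \<partial>lebesgue)
      \<le> ennreal (1 / hardy_const DIM('a) p) * (\<integral>\<^sup>+x\<in>\<Omega>. ennreal (norm (g x) powr p) \<partial>lebesgue)"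
    using g by (intro hardy_inequality_gradient_limit[OF \<Omega> _ p g(2) \<phi>]) (simp add: is_weak_gradient_def)
  have "\<exists>G. is_weak_gradient UNIV u G" using u by (auto simp: X_space_def W1p_def)
  then have "is_weak_gradient UNIV u (weak_gradient u)"
    unfolding weak_gradient_def by (rule someI_ex)
  then have "AE x in lebesgue. x \<in> \<Omega> \<longrightarrow> g x = weak_gradient u x"
    by (rule weak_gradient_unique[OF g(1) is_weak_gradient_subset \<Omega>])
  then have "(\<integral>\<^sup>+x\<in>\<Omega>. ennreal (norm (g x) powr p) \<partial>lebesgue) =
      (\<integral>\<^sup>+x\<in>\<Omega>. ennreal (norm (weak_gradient u x) powr p) \<partial>lebesgue)"
    by (intro nn_integral_cong_AE) (auto elim!: eventually_mono simp: indicator_def)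
  with hardy show "(\<integral>\<^sup>+x\<in>\<Omega>. ennreal ((\<bar>u x\<bar> / norm x) powr p) \<partial>lebesgue)
      \<le> ennreal (1 / hardy_const DIM('a) p) * (\<integral>\<^sup>+x\<in>\<Omega>. ennreal (norm (weak_gradient u x) powr p) \<partial>lebesgue)"
    by simp
  have "(\<integral>\<^sup>+x\<in>\<Omega>. ennreal (norm (g x) powr p) \<partial>lebesgue) < \<infinity>" using g(2) by (simp add: in_Lp_def)
  with hardy show "(\<integral>\<^sup>+x\<in>\<Omega>. ennreal ((\<bar>u x\<bar> / norm x) powr p) \<partial>lebesgue) < \<infinity>"
    by (auto simp: ennreal_mult_less_top elim: order.strict_trans1)
qed

text \<open>The left-hand side is finite because \<open>|x|\<^bsup>-ps\<^esup> \<le> 1 + |x|\<^bsup>-p\<^esup>\<close>, where \<open>u\<close> itself is in \<open>L\<^sup>p\<close> and the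
  classical inequality controls the rest.  Fubini's theorem is available for Borel functions, so \<open>u\<close> is
  replaced by a Borel function that is equal to it almost everywhere.\<close>
lemma X_space_fractional_hardy:
  fixes \<Omega> :: "'a::euclidean_space set"
  assumes \<Omega>: "open \<Omega>" and u: "u \<in> X_space p \<Omega>" and p: "1 < p" "p < real DIM('a)" and s: "0 < s" "s < 1"
  shows "(\<integral>\<^sup>+x. ennreal (\<bar>u x\<bar> powr p * norm x powr (- (p * s))) \<partial>lebesgue)
    \<le> ennreal (1 / frac_hardy_const DIM('a) p s) *
      (\<integral>\<^sup>+x. (\<integral>\<^sup>+y. ennreal (\<bar>u x - u y\<bar> powr p / norm (x - y) powr (real DIM('a) + p * s)) \<partial>lebesgue) \<partial>lebesgue)"
proof -
  have Lp: "in_Lp p UNIV u" using u by (simp add: X_space_def W1p_def)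
  then have um: "u \<in> borel_measurable lebesgue" by (simp add: in_Lp_def lebesgue_on_UNIV_eq)
  then obtain v where v: "v \<in> borel_measurable lborel" "AE x in lborel. u x = v x"
    using completion_ex_borel_measurable_real by blast
  have uv: "AE x in lebesgue. u x = v x" using v(2) by (rule AE_completion)
  have zero: "AE x in lebesgue. x \<notin> \<Omega> \<longrightarrow> u x = 0" using u by (simp add: X_space_def)
  have nm: "(\<lambda>x::'a. norm x) \<in> borel_measurable lebesgue" by (intro measurable_completion) simp
  have \<Omega>m: "\<Omega> \<in> sets lebesgue" using \<Omega> by (intro sets_completionI_sets) simp
  have "(\<integral>\<^sup>+x. ennreal (\<bar>v x\<bar> powr p * norm x powr (- (p * s))) \<partial>lborel) =
      (\<integral>\<^sup>+x. ennreal (\<bar>u x\<bar> powr p * norm x powr (- (p * s))) \<partial>lebesgue)"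
    using v(2) unfolding nn_integral_completion
    by (intro nn_integral_cong_AE) (auto elim!: eventually_mono)
  note Heq = this
  have "(\<integral>\<^sup>+x. ennreal (\<bar>u x\<bar> powr p * norm x powr (- (p * s))) \<partial>lebesgue) \<le>
      (\<integral>\<^sup>+x. ennreal (\<bar>u x\<bar> powr p) + ennreal ((\<bar>u x\<bar> / norm x) powr p) * indicator \<Omega> x \<partial>lebesgue)"
  proof (rule nn_integral_mono_AE)
    show "AE x in lebesgue. ennreal (\<bar>u x\<bar> powr p * norm x powr (- (p * s))) \<le>
        ennreal (\<bar>u x\<bar> powr p) + ennreal ((\<bar>u x\<bar> / norm x) powr p) * indicator \<Omega> x"
      using zero
    proof eventually_elim
      case (elim x)
      show ?case
      proof (cases "x \<in> \<Omega> \<and> x \<noteq> 0")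
        case True
        have "norm x powr (- (p * s)) \<le> 1 + norm x powr (- p)"
        proof (cases "norm x \<le> 1")
          case le: True
          have "norm x powr (- (p * s)) \<le> norm x powr (- p)"
            using le True s p by (intro powr_mono') (auto simp: mult_left_le)
          then show ?thesis by simp
        next
          case False
          have "norm x powr (- (p * s)) \<le> norm x powr 0"
            using False s p by (intro powr_mono) auto
          then show ?thesis using True by (simp add: add_increasing2)
        qed
        then have "\<bar>u x\<bar> powr p * norm x powr (- (p * s)) \<le> \<bar>u x\<bar> powr p * (1 + norm x powr (- p))"
          by (intro mult_left_mono) auto
        also have "\<dots> = \<bar>u x\<bar> powr p + (\<bar>u x\<bar> / norm x) powr p"
          by (simp add: powr_divide powr_minus_divide distrib_left)
        finally show ?thesis
          using True by (simp add: ennreal_plus[symmetric] ennreal_leI del: ennreal_plus)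
      next
        case False
        then show ?thesis using elim by auto
      qed
    qed
  qed
  also have "\<dots> = (\<integral>\<^sup>+x. ennreal (\<bar>u x\<bar> powr p) \<partial>lebesgue) + (\<integral>\<^sup>+x\<in>\<Omega>. ennreal ((\<bar>u x\<bar> / norm x) powr p) \<partial>lebesgue)"
  proof (rule nn_integral_add)
    show "(\<lambda>x. ennreal (\<bar>u x\<bar> powr p)) \<in> borel_measurable lebesgue" using um by measurable
    show "(\<lambda>x. ennreal ((\<bar>u x\<bar> / norm x) powr p) * indicator \<Omega> x) \<in> borel_measurable lebesgue"
      using um nm \<Omega>m by measurable
  qed
  also have "\<dots> < \<infinity>"
    using X_space_hardy_inequality(2)[OF \<Omega> u p] Lp by (simp add: in_Lp_def)
  finally have fin: "(\<integral>\<^sup>+x. ennreal (\<bar>v x\<bar> powr p * norm x powr (- (p * s))) \<partial>lborel) < \<infinity>"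
    by (simp only: Heq)
  have "(\<integral>\<^sup>+x. (\<integral>\<^sup>+y. ennreal (\<bar>v x - v y\<bar> powr p / norm (x - y) powr (real DIM('a) + p * s)) \<partial>lborel) \<partial>lborel)
    = (\<integral>\<^sup>+x. (\<integral>\<^sup>+y. ennreal (\<bar>u x - u y\<bar> powr p / norm (x - y) powr (real DIM('a) + p * s)) \<partial>lebesgue) \<partial>lebesgue)"
    unfolding nn_integral_completion
  proof (rule nn_integral_cong_AE)
    show "AE x in lborel. (\<integral>\<^sup>+y. ennreal (\<bar>v x - v y\<bar> powr p / norm (x - y) powr (real DIM('a) + p * s)) \<partial>lborel)
      = (\<integral>\<^sup>+y. ennreal (\<bar>u x - u y\<bar> powr p / norm (x - y) powr (real DIM('a) + p * s)) \<partial>lborel)"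
      using v(2)
    proof eventually_elim
      case (elim x)
      then show ?case using v(2) by (intro nn_integral_cong_AE) (auto elim!: eventually_mono)
    qed
  qed
  moreover have "(\<integral>\<^sup>+x. ennreal (\<bar>v x\<bar> powr p * norm x powr (- (p * s))) \<partial>lborel)
    \<le> ennreal (1 / frac_hardy_const DIM('a) p s) *
      (\<integral>\<^sup>+x. (\<integral>\<^sup>+y. ennreal (\<bar>v x - v y\<bar> powr p / norm (x - y) powr (real DIM('a) + p * s)) \<partial>lborel) \<partial>lborel)"
    using v(1) by (intro fractional_hardy s p fin) simp
  ultimately show ?thesis by (simp only: Heq)
qed

section \<open>Interpolation between the two inequalities\<close>

text \<open>The weighted inequality between the arithmetic and the geometric mean.\<close>
lemma norm_powr_interpolation:
  fixes x :: "'a::real_normed_vector"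
  assumes "x \<noteq> 0" "0 \<le> \<mu>" "\<mu> \<le> 1"
  shows "norm x powr (- (\<mu> * a + (1 - \<mu>) * b)) \<le> \<mu> * norm x powr (- a) + (1 - \<mu>) * norm x powr (- b)"
proof -
  have "norm x powr (- (\<mu> * a + (1 - \<mu>) * b)) = (norm x powr (- a)) powr \<mu> * (norm x powr (- b)) powr (1 - \<mu>)"
    by (simp add: powr_powr powr_add[symmetric] algebra_simps)
  also have "\<dots> \<le> \<mu> * norm x powr (- a) + (1 - \<mu>) * norm x powr (- b)"
    using assms by (intro Youngs_inequality_0) auto
  finally show ?thesis .
qed

theorem lemma3p1:
  fixes \<Omega> :: "'a::euclidean_space set" and u :: "'a \<Rightarrow> real" and s \<theta> p :: real
  assumes "0 < s" and "s < 1"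
    and "s \<le> \<theta>" and "\<theta> \<le> 1"
    and "1 < p" and "p < real DIM('a)"
    and "open \<Omega>"
    and "u \<in> X_space p \<Omega>"
  shows "(\<integral>\<^sup>+x\<in>\<Omega>. ennreal (\<bar>u x\<bar> powr p / norm x powr (p * \<theta>)) \<partial>lebesgue)
    \<le> ennreal ((\<theta> - s) / ((1 - s) * hardy_const DIM('a) p)) *
        (\<integral>\<^sup>+x\<in>\<Omega>. ennreal (norm (weak_gradient u x) powr p) \<partial>lebesgue)
      + ennreal ((1 - \<theta>) / ((1 - s) * frac_hardy_const DIM('a) p s)) *
        (\<integral>\<^sup>+x. (\<integral>\<^sup>+y. ennreal (\<bar>u x - u y\<bar> powr p / norm (x - y) powr (real DIM('a) + s * p))
           \<partial>lebesgue) \<partial>lebesgue)"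
proof -
  let ?N = "DIM('a)"
  let ?J = "\<integral>\<^sup>+x. (\<integral>\<^sup>+y. ennreal (\<bar>u x - u y\<bar> powr p / norm (x - y) powr (real ?N + s * p)) \<partial>lebesgue) \<partial>lebesgue"
  let ?X = "\<integral>\<^sup>+x\<in>\<Omega>. ennreal (norm (weak_gradient u x) powr p) \<partial>lebesgue"
  note p = assms(5,6) and \<Omega> = assms(7) and u = assms(8)
  define \<mu> where "\<mu> = (\<theta> - s) / (1 - s)"
  have \<mu>: "0 \<le> \<mu>" "\<mu> \<le> 1" using assms(2-4) by (auto simp: \<mu>_def)
  have \<mu>': "1 - \<mu> = (1 - \<theta>) / (1 - s)" using assms(2) by (simp add: \<mu>_def field_simps)
  have "\<mu> * (1 - s) = \<theta> - s" using assms(2) by (simp add: \<mu>_def)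
  then have "\<theta> = \<mu> + (1 - \<mu>) * s" by (simp add: algebra_simps)
  then have p\<theta>: "\<mu> * p + (1 - \<mu>) * (p * s) = p * \<theta>" by (simp only:) (simp add: algebra_simps)
  have um: "u \<in> borel_measurable lebesgue"
    using u by (simp add: X_space_def W1p_def in_Lp_def lebesgue_on_UNIV_eq)
  have nm: "(\<lambda>x::'a. norm x) \<in> borel_measurable lebesgue" by (intro measurable_completion) simp
  have \<Omega>m: "\<Omega> \<in> sets lebesgue" using \<Omega> by (intro sets_completionI_sets) simp
  let ?f = "\<lambda>x. ennreal ((\<bar>u x\<bar> / norm x) powr p)"
  let ?h = "\<lambda>x. ennreal (\<bar>u x\<bar> powr p * norm x powr (- (p * s)))"
  have fm: "(\<lambda>x. ?f x * indicator \<Omega> x) \<in> borel_measurable lebesgue" using um nm \<Omega>m by measurable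
  have hm: "?h \<in> borel_measurable lebesgue" using um nm by measurable
  have "(\<integral>\<^sup>+x\<in>\<Omega>. ennreal (\<bar>u x\<bar> powr p / norm x powr (p * \<theta>)) \<partial>lebesgue) \<le>
      (\<integral>\<^sup>+x. ennreal \<mu> * (?f x * indicator \<Omega> x) + ennreal (1 - \<mu>) * ?h x \<partial>lebesgue)"
  proof (rule nn_integral_mono)
    fix x
    show "ennreal (\<bar>u x\<bar> powr p / norm x powr (p * \<theta>)) * indicator \<Omega> x \<le>
      ennreal \<mu> * (?f x * indicator \<Omega> x) + ennreal (1 - \<mu>) * ?h x"
    proof (cases "x \<in> \<Omega> \<and> x \<noteq> 0")
      case True
      have "\<bar>u x\<bar> powr p / norm x powr (p * \<theta>) = \<bar>u x\<bar> powr p * norm x powr (- (\<mu> * p + (1 - \<mu>) * (p * s)))"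
        unfolding p\<theta> by (simp add: powr_minus_divide)
      also have "\<dots> \<le> \<bar>u x\<bar> powr p * (\<mu> * norm x powr (- p) + (1 - \<mu>) * norm x powr (- (p * s)))"
        using True \<mu> by (intro mult_left_mono norm_powr_interpolation) auto
      also have "\<dots> = \<mu> * (\<bar>u x\<bar> / norm x) powr p + (1 - \<mu>) * (\<bar>u x\<bar> powr p * norm x powr (- (p * s)))"
        by (simp add: powr_divide powr_minus_divide distrib_left mult_ac)
      finally show ?thesis
        using True \<mu> by (simp add: ennreal_mult[symmetric] ennreal_plus[symmetric] ennreal_leI del: ennreal_plus)
    qed auto
  qed
  also have "\<dots> = ennreal \<mu> * (\<integral>\<^sup>+x\<in>\<Omega>. ?f x \<partial>lebesgue) + ennreal (1 - \<mu>) * (\<integral>\<^sup>+x. ?h x \<partial>lebesgue)"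
    using fm hm by (simp add: nn_integral_add nn_integral_cmult)
  also have "\<dots> \<le> ennreal \<mu> * (ennreal (1 / hardy_const ?N p) * ?X) +
      ennreal (1 - \<mu>) * (ennreal (1 / frac_hardy_const ?N p s) * ?J)"
    using X_space_hardy_inequality(1)[OF \<Omega> u p] X_space_fractional_hardy[OF \<Omega> u p assms(1,2)]
    by (intro add_mono mult_left_mono) (auto simp: mult.commute[of p s])
  also have "\<dots> = ennreal ((\<theta> - s) / ((1 - s) * hardy_const ?N p)) * ?X +
      ennreal ((1 - \<theta>) / ((1 - s) * frac_hardy_const ?N p s)) * ?J"
  proof -
    have "ennreal \<mu> * ennreal (1 / hardy_const ?N p) = ennreal ((\<theta> - s) / ((1 - s) * hardy_const ?N p))"
      by (subst ennreal_mult'[OF \<mu>(1), symmetric]) (simp add: \<mu>_def)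
    moreover have "ennreal (1 - \<mu>) * ennreal (1 / frac_hardy_const ?N p s) =
        ennreal ((1 - \<theta>) / ((1 - s) * frac_hardy_const ?N p s))"
      using \<mu>(2) by (subst ennreal_mult'[symmetric], simp) (simp add: \<mu>')
    ultimately show ?thesis by (simp only: mult.assoc[symmetric])
  qed
  finally show ?thesis .
qed

end
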